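(* Let $X$ be a compact metric space, let $T:X\to X$ be a strictly ergodic isometry (a homeomorphism that is minimal and uniquely ergodic) with unique invariant probability measure $\mu$, and suppose $\mathrm{supp}(\mu)=X$. Let $f,g:X\to i\,\mathrm{SU}(2)$ be continuous with $-\int_X\log|\rho_f|\,d\mu-\int_X\log|\rho_g|\,d\mu<\infty$, let $(\mathcal{E}_x)_{x\in X}$ be the associated family of generalized CMV operators, and let $\Sigma$ be their common spectrum. Then $$\Sigma=\{z\in\partial\mathbb{D}:(T,A^z_fA^z_g)\notin\mathcal{DS}\}.$$
   Context: $i\,\mathrm{SU}(2)$ is the set of $2\times2$ unitary matrices with determinant $-1$. Write $$f(x)=\begin{pmatrix}\overline{\alpha_f(x)}&\rho_f(x)\\ \overline{\rho_f(x)}&-\alpha_f(x)\end{pmatrix},\qquad g(x)=\begin{pmatrix}\overline{\alpha_g(x)}&\rho_g(x)\\ \overline{\rho_g(x)}&-\alpha_g(x)\end{pmatrix},$$ with $|\alpha_*|^2+|\rho_*|^2=1$ ($\rho_*$ may be complex). For $x\in X$, $\mathcal{E}_x=\mathcal{L}_x\mathcal{M}_x$ is the unitary operator on $\ell^2(\mathbb{Z})$ where $\mathcal{L}_x$ is block diagonal with $2\times 2$ block $f(T^kx)$ on the indices $\{2k-1,2k\}$ and $\mathcal{M}_x$ is block diagonal with block $g(T^kx)$ on the indices $\{2k-2,2k-1\}$, $k\in\mathbb{Z}$ (all other entries zero). By minimality of $T$, the spectrum of $\mathcal{E}_x$ does not depend on $x$; it is denoted $\Sigma$. For $z\in\mathbb{C}\setminus\{0\}$,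 $$A^z_f(x)=\begin{pmatrix}-\alpha_f(x)&1\\1&-\overline{\alpha_f(x)}\end{pmatrix},\qquad A^z_g(x)=\begin{pmatrix}-\overline{\alpha_g(x)}&z\\1/z&-\alpha_g(x)\end{pmatrix},$$ and $A^z_fA^z_g$ is the map $x\mapsto A^z_f(x)A^z_g(x)$. For $A\in C(X,\mathrm{M}_2(\mathbb{C}))$ put $A_n(x)=A(T^{n-1}x)\cdots A(x)$ for $n\geq 1$. The cocycle $(T,A)$ admits a dominated splitting, written $(T,A)\in\mathcal{DS}$, if there is a continuous decomposition $\mathbb{C}^2=E^+(x)\oplus E^-(x)$, $x\in X$, into one-dimensional subspaces such that (1) $A(x)E^\pm(x)\subseteq E^\pm(Tx)$ for all $x\in X$, and (2) there is $N\in\mathbb{Z}_+$ such that $\|A_N(x)v^+\|>\|A_N(x)v^-\|$ for all $x\in X$ and all unit vectors $v^\pm\in E^\pm(x)$. *)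

theory Defs
  imports "HOL-Probability.Probability"
begin

section \<open>Strictly ergodic homeomorphisms\<close>

definition iter_int :: "('a \<Rightarrow> 'a) \<Rightarrow> int \<Rightarrow> 'a \<Rightarrow> 'a" where
  "iter_int T k = (if 0 \<le> k then T ^^ nat k else inv T ^^ nat (- k))"

definition minimal :: "('a::topological_space \<Rightarrow> 'a) \<Rightarrow> bool" where
  "minimal T \<longleftrightarrow> (\<forall>x. closure (range (\<lambda>k. iter_int T k x)) = UNIV)"

definition invariant_prob :: "('a::topological_space \<Rightarrow> 'a) \<Rightarrow> 'a measure \<Rightarrow> bool" where
  "invariant_prob T \<mu> \<longleftrightarrow> sets \<mu> = sets borel \<and> prob_space \<mu> \<and> distr \<mu> borel T = \<mu>"

definition uniquely_ergodic :: "('a::topological_space \<Rightarrow> 'a) \<Rightarrow> bool" where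
  "uniquely_ergodic T \<longleftrightarrow> (\<exists>!\<mu>. invariant_prob T \<mu>)"

definition strictly_ergodic :: "('a::topological_space \<Rightarrow> 'a) \<Rightarrow> bool" where
  "strictly_ergodic T \<longleftrightarrow>
     (\<exists>S. homeomorphism UNIV UNIV T S) \<and> minimal T \<and> uniquely_ergodic T"

definition measure_support :: "'a::topological_space measure \<Rightarrow> 'a set" where
  "measure_support \<mu> = {x. \<forall>U. open U \<longrightarrow> x \<in> U \<longrightarrow> 0 < emeasure \<mu> U}"

section \<open>The matrices in i SU(2)\<close>

definition adjoint_mat :: "complex^'n^'m \<Rightarrow> complex^'m^'n" where
  "adjoint_mat U = (\<chi> i j. cnj (U $ j $ i))"

definition unitary_mat :: "complex^'n^'n \<Rightarrow> bool" where
  "unitary_mat U \<longleftrightarrow> adjoint_mat U ** U = mat 1 \<and> U ** adjoint_mat U = mat 1"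

definition iSU2 :: "(complex^2^2) set" where
  "iSU2 = {U. unitary_mat U \<and> det U = -1}"

definition alpha :: "complex^2^2 \<Rightarrow> complex" where
  "alpha U = - U $ 2 $ 2"

definition rho :: "complex^2^2 \<Rightarrow> complex" where
  "rho U = U $ 1 $ 2"

text \<open>The two coefficients determine a matrix in \<^const>\<open>iSU2\<close>, through the expected normal form.\<close>

lemma iSU2_iff:
  "U \<in> iSU2 \<longleftrightarrow>
     U = vector [vector [cnj (alpha U), rho U], vector [cnj (rho U), - alpha U]] \<and>
     (cmod (alpha U))\<^sup>2 + (cmod (rho U))\<^sup>2 = 1"
proof -
  define a b c d where abcd: "a = U $ 1 $ 1" "b = U $ 1 $ 2" "c = U $ 2 $ 1" "d = U $ 2 $ 2"
  have norm_sq: "(of_real ((cmod z)\<^sup>2) :: complex) = z * cnj z" for z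
    by (rule complex_norm_square)
  have det_U: "det U = a * d - b * c"
    by (simp add: det_2 abcd)
  have unitary_U: "unitary_mat U \<longleftrightarrow>
      cnj a * a + cnj c * c = 1 \<and> cnj a * b + cnj c * d = 0 \<and>
      cnj b * a + cnj d * c = 0 \<and> cnj b * b + cnj d * d = 1 \<and>
      a * cnj a + b * cnj b = 1 \<and> a * cnj c + b * cnj d = 0 \<and>
      c * cnj a + d * cnj b = 0 \<and> c * cnj c + d * cnj d = 1"
    by (auto simp: unitary_mat_def adjoint_mat_def vec_eq_iff forall_2 sum_2 mat_def abcd
        matrix_matrix_mult_def)
  have form: "U = vector [vector [cnj (alpha U), rho U], vector [cnj (rho U), - alpha U]] \<longleftrightarrow>
      a = - cnj d \<and> c = cnj b"
    by (auto simp: vec_eq_iff forall_2 alpha_def rho_def abcd)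
  have "(cmod (alpha U))\<^sup>2 + (cmod (rho U))\<^sup>2 = 1 \<longleftrightarrow>
      (of_real ((cmod (alpha U))\<^sup>2 + (cmod (rho U))\<^sup>2) :: complex) = of_real 1"
    by (simp only: of_real_eq_iff)
  also have "\<dots> \<longleftrightarrow> d * cnj d + b * cnj b = 1"
    unfolding of_real_add norm_sq by (simp add: alpha_def rho_def abcd)
  finally have unit: "(cmod (alpha U))\<^sup>2 + (cmod (rho U))\<^sup>2 = 1 \<longleftrightarrow>
      d * cnj d + b * cnj b = 1" .
  have "unitary_mat U \<and> a * d - b * c = -1 \<longleftrightarrow>
      (a = - cnj d \<and> c = cnj b) \<and> d * cnj d + b * cnj b = 1" (is "?l \<longleftrightarrow> ?r")
  proof
    assume l: ?l
    then have u: "cnj a * a + cnj c * c = 1" "cnj a * b + cnj c * d = 0"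
      "cnj b * b + cnj d * d = 1" "a * d - b * c = -1"
      unfolding unitary_U by auto
    have "d * (cnj a * a + cnj c * c) - c * (cnj a * b + cnj c * d) = cnj a * (a * d - b * c)"
      by algebra
    then have d: "d = - cnj a" using u by simp
    have "b * (cnj a * a + cnj c * c) - a * (cnj a * b + cnj c * d) = - cnj c * (a * d - b * c)"
      by algebra
    then have b: "b = cnj c" using u by simp
    show ?r using d b u(1) by (simp add: mult.commute)
  next
    assume ?r
    then show ?l unfolding unitary_U by (auto simp: algebra_simps)
  qed
  then show ?thesis
    unfolding iSU2_def mem_Collect_eq det_U form unit by simp
qed

text \<open>
  The extended value of \<open>- log r\<close> for \<open>0 \<le> r \<le> 1\<close>. The case \<open>r = 0\<close> is separate because
  \<open>ln 0 = 0\<close> in the library.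
\<close>

definition neg_ln :: "real \<Rightarrow> ennreal" where
  "neg_ln r = (if r = 0 then \<infinity> else ennreal (- ln r))"

section \<open>Operators on square-summable bi-infinite sequences\<close>

definition ell2 :: "(int \<Rightarrow> complex) set" where
  "ell2 = {\<psi>. (\<lambda>n. (cmod (\<psi> n))\<^sup>2) summable_on UNIV}"

definition ell2_norm :: "(int \<Rightarrow> complex) \<Rightarrow> real" where
  "ell2_norm \<psi> = sqrt (\<Sum>\<^sub>\<infinity>n. (cmod (\<psi> n))\<^sup>2)"

definition bounded_op :: "((int \<Rightarrow> complex) \<Rightarrow> int \<Rightarrow> complex) \<Rightarrow> bool" where
  "bounded_op R \<longleftrightarrow>
     (\<forall>\<psi>\<in>ell2. R \<psi> \<in> ell2) \<and>
     (\<forall>\<phi>\<in>ell2. \<forall>\<psi>\<in>ell2. \<forall>a b. R (\<lambda>n. a * \<phi> n + b * \<psi> n) = (\<lambda>n. a * R \<phi> n + b * R \<psi> n)) \<and>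
     (\<exists>K. \<forall>\<psi>\<in>ell2. ell2_norm (R \<psi>) \<le> K * ell2_norm \<psi>)"

definition spectrum :: "((int \<Rightarrow> complex) \<Rightarrow> int \<Rightarrow> complex) \<Rightarrow> complex set" where
  "spectrum A = {z. \<not> (\<exists>R. bounded_op R \<and>
     (\<forall>\<psi>\<in>ell2. R (\<lambda>n. A \<psi> n - z * \<psi> n) = \<psi> \<and> (\<lambda>n. A (R \<psi>) n - z * R \<psi> n) = \<psi>))}"

section \<open>Generalized CMV operators\<close>

text \<open>The block-diagonal operator whose block \<open>B k\<close> acts on the indices \<open>2 * k + s\<close> and \<open>2 * k + s + 1\<close>.\<close>

definition block_diag_op ::
    "int \<Rightarrow> (int \<Rightarrow> complex^2^2) \<Rightarrow> (int \<Rightarrow> complex) \<Rightarrow> int \<Rightarrow> complex" where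
  "block_diag_op s B \<psi> n =
     (let k = (n - s) div 2
      in (B k *v vector [\<psi> (2 * k + s), \<psi> (2 * k + s + 1)]) $ (if n = 2 * k + s then 1 else 2))"

lemma block_diag_op_fst:
  "block_diag_op s B \<psi> (2 * k + s) =
     B k $ 1 $ 1 * \<psi> (2 * k + s) + B k $ 1 $ 2 * \<psi> (2 * k + s + 1)"
  by (simp add: block_diag_op_def matrix_vector_mult_def sum_2)

lemma block_diag_op_snd:
  "block_diag_op s B \<psi> (2 * k + s + 1) =
     B k $ 2 $ 1 * \<psi> (2 * k + s) + B k $ 2 $ 2 * \<psi> (2 * k + s + 1)"
  by (simp add: block_diag_op_def matrix_vector_mult_def sum_2)

lemma has_sum_split_int:
  fixes u :: "int \<Rightarrow> real"
  assumes "\<And>n. 0 \<le> u n"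
  shows "(u has_sum c) UNIV \<longleftrightarrow> ((\<lambda>k. u (2 * k + s) + u (2 * k + s + 1)) has_sum c) UNIV"
    (is "_ \<longleftrightarrow> (?p has_sum c) UNIV")
proof -
  define e o' where eo: "e = (\<lambda>k::int. 2 * k + s)" "o' = (\<lambda>k::int. 2 * k + s + 1)"
  have inj: "inj e" "inj o'" by (auto simp: eo inj_on_def)
  have disj: "range e \<inter> range o' = {}" unfolding eo by auto presburger
  have "n \<in> range e \<union> range o'" for n
  proof (cases "even (n - s)")
    case True
    then obtain k where "n - s = 2 * k" by blast
    then have "n = e k" by (simp add: eo)
    then show ?thesis by blast
  next
    case False
    then obtain k where "n - s = 2 * k + 1" by (elim oddE)
    then have "n = o' k" by (simp add: eo)
    then show ?thesis by blast
  qed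
  then have cover: "range e \<union> range o' = UNIV" by blast
  have join: "(u has_sum (a + b)) UNIV" if "(u \<circ> e has_sum a) UNIV" "(u \<circ> o' has_sum b) UNIV" for a b
    using has_sum_Un_disjoint[of u "range e" a "range o'" b] that disj cover inj
    by (simp add: has_sum_reindex)
  have add: "(?p has_sum (a + b)) UNIV"
    if "(u \<circ> e has_sum a) UNIV" "(u \<circ> o' has_sum b) UNIV" for a b
    using has_sum_add[OF that] by (simp add: eo o_def)
  show ?thesis
  proof
    assume u: "(u has_sum c) UNIV"
    then have "u summable_on range e" "u summable_on range o'"
      by (meson has_sum_imp_summable summable_on_subset_banach subset_UNIV)+
    then obtain a b where ab: "(u \<circ> e has_sum a) UNIV" "(u \<circ> o' has_sum b) UNIV"
      using inj by (metis summable_on_def summable_on_reindex)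
    then have "c = a + b" using join u has_sum_unique by blast
    then show "(?p has_sum c) UNIV" using add[OF ab] by simp
  next
    assume p: "(?p has_sum c) UNIV"
    then have p': "?p summable_on UNIV" by (rule has_sum_imp_summable)
    have "u \<circ> e summable_on UNIV" "u \<circ> o' summable_on UNIV"
      by (rule summable_on_comparison_test[OF p']; use assms in \<open>simp add: eo\<close>)+
    then obtain a b where ab: "(u \<circ> e has_sum a) UNIV" "(u \<circ> o' has_sum b) UNIV"
      by (auto simp: summable_on_def)
    then have "c = a + b" using add p has_sum_unique by blast
    then show "(u has_sum c) UNIV" using join[OF ab] by simp
  qed
qed

lemma unitary_mat_norm:
  fixes U :: "complex^2^2"
  assumes "unitary_mat U"
  shows "(cmod (U $ 1 $ 1 * a + U $ 1 $ 2 * b))\<^sup>2 + (cmod (U $ 2 $ 1 * a + U $ 2 $ 2 * b))\<^sup>2 =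
    (cmod a)\<^sup>2 + (cmod b)\<^sup>2"
proof -
  define p q r t where pqrt: "p = U $ 1 $ 1" "q = U $ 1 $ 2" "r = U $ 2 $ 1" "t = U $ 2 $ 2"
  have u: "cnj p * p + cnj r * r = 1" "cnj p * q + cnj r * t = 0"
      "cnj q * p + cnj t * r = 0" "cnj q * q + cnj t * t = 1"
    using assms
    by (auto simp: unitary_mat_def adjoint_mat_def vec_eq_iff forall_2 sum_2 mat_def pqrt
        matrix_matrix_mult_def)
  have "(p * a + q * b) * cnj (p * a + q * b) + (r * a + t * b) * cnj (r * a + t * b) =
      (cnj p * p + cnj r * r) * (a * cnj a) + (cnj p * q + cnj r * t) * (b * cnj a) +
      (cnj q * p + cnj t * r) * (a * cnj b) + (cnj q * q + cnj t * t) * (b * cnj b)"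
    by (simp add: algebra_simps)
  also have "\<dots> = a * cnj a + b * cnj b" unfolding u by simp
  finally have "(of_real ((cmod (p * a + q * b))\<^sup>2 + (cmod (r * a + t * b))\<^sup>2) :: complex) =
      of_real ((cmod a)\<^sup>2 + (cmod b)\<^sup>2)"
    unfolding of_real_add complex_norm_square .
  then show ?thesis unfolding of_real_eq_iff pqrt .
qed

lemma block_diag_op_isometry:
  assumes "\<And>k. unitary_mat (B k)" "\<psi> \<in> ell2"
  shows "block_diag_op s B \<psi> \<in> ell2" "ell2_norm (block_diag_op s B \<psi>) = ell2_norm \<psi>"
proof -
  have *: "((\<lambda>n. (cmod (block_diag_op s B \<psi> n))\<^sup>2) has_sum c) UNIV \<longleftrightarrow>
      ((\<lambda>n. (cmod (\<psi> n))\<^sup>2) has_sum c) UNIV" for c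
    by (subst (1 2) has_sum_split_int[where s = s])
       (simp_all add: block_diag_op_fst block_diag_op_snd unitary_mat_norm assms(1))
  obtain c where c: "((\<lambda>n. (cmod (\<psi> n))\<^sup>2) has_sum c) UNIV"
    using assms(2) unfolding ell2_def summable_on_def by blast
  then have c': "((\<lambda>n. (cmod (block_diag_op s B \<psi> n))\<^sup>2) has_sum c) UNIV"
    by (simp only: *)
  show "block_diag_op s B \<psi> \<in> ell2"
    using has_sum_imp_summable[OF c'] by (simp add: ell2_def)
  show "ell2_norm (block_diag_op s B \<psi>) = ell2_norm \<psi>"
    using infsumI[OF c] infsumI[OF c'] by (simp add: ell2_norm_def)
qed

definition cmv_L ::
    "('a \<Rightarrow> 'a) \<Rightarrow> ('a \<Rightarrow> complex^2^2) \<Rightarrow> 'a \<Rightarrow> (int \<Rightarrow> complex) \<Rightarrow> int \<Rightarrow> complex" where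
  "cmv_L T f x = block_diag_op (-1) (\<lambda>k. f (iter_int T k x))"

definition cmv_M ::
    "('a \<Rightarrow> 'a) \<Rightarrow> ('a \<Rightarrow> complex^2^2) \<Rightarrow> 'a \<Rightarrow> (int \<Rightarrow> complex) \<Rightarrow> int \<Rightarrow> complex" where
  "cmv_M T g x = block_diag_op (-2) (\<lambda>k. g (iter_int T k x))"

definition gcmv ::
    "('a \<Rightarrow> 'a) \<Rightarrow> ('a \<Rightarrow> complex^2^2) \<Rightarrow> ('a \<Rightarrow> complex^2^2) \<Rightarrow> 'a \<Rightarrow>
     (int \<Rightarrow> complex) \<Rightarrow> int \<Rightarrow> complex" where
  "gcmv T f g x = cmv_L T f x \<circ> cmv_M T g x"

lemma gcmv_isometry:
  assumes "\<And>y. f y \<in> iSU2" "\<And>y. g y \<in> iSU2" "\<psi> \<in> ell2"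
  shows "gcmv T f g x \<psi> \<in> ell2" "ell2_norm (gcmv T f g x \<psi>) = ell2_norm \<psi>"
  using assms by (auto simp: gcmv_def cmv_L_def cmv_M_def iSU2_def block_diag_op_isometry)

section \<open>Transfer cocycles and dominated splitting\<close>

definition transfer_f :: "complex \<Rightarrow> ('a \<Rightarrow> complex^2^2) \<Rightarrow> 'a \<Rightarrow> complex^2^2" where
  "transfer_f z f x =
     vector [vector [- alpha (f x), 1],
             vector [1, - cnj (alpha (f x))]]"

definition transfer_g :: "complex \<Rightarrow> ('a \<Rightarrow> complex^2^2) \<Rightarrow> 'a \<Rightarrow> complex^2^2" where
  "transfer_g z g x =
     vector [vector [- cnj (alpha (g x)), z],
             vector [1 / z, - alpha (g x)]]"

primrec cocycle :: "('a \<Rightarrow> 'a) \<Rightarrow> ('a \<Rightarrow> complex^2^2) \<Rightarrow> nat \<Rightarrow> 'a \<Rightarrow> complex^2^2" where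
  "cocycle T A 0 x = mat 1"
| "cocycle T A (Suc n) x = A ((T ^^ n) x) ** cocycle T A n x"

text \<open>
  The complex projective line: its points are the one-dimensional complex subspaces, and its
  topology is the quotient of the nonzero vectors under \<open>v \<mapsto> span {v}\<close>. Here \<open>vec.subspace\<close>,
  \<open>vec.dim\<close> and \<open>vec.span\<close> are complex-linear (they refer to the scaling \<open>*s\<close>), unlike
  \<open>subspace\<close>, \<open>dim\<close> and \<open>span\<close>, which are real-linear.
\<close>

definition complex_lines :: "(complex^2) set set" where
  "complex_lines = {L. vec.subspace L \<and> vec.dim L = 1}"

definition projective_line :: "(complex^2) set topology" where
  "projective_line =
     topology (\<lambda>\<U>. \<U> \<subseteq> complex_lines \<and> open {v. v \<noteq> 0 \<and> vec.span {v} \<in> \<U>})"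

lemma span_in_complex_lines:
  fixes v :: "complex^2" assumes "v \<noteq> 0" shows "vec.span {v} \<in> complex_lines"
  using assms by (simp add: complex_lines_def vec.dim_eq_card_independent)

lemma openin_projective_line:
  "openin projective_line \<U> \<longleftrightarrow>
     \<U> \<subseteq> complex_lines \<and> open {v. v \<noteq> 0 \<and> vec.span {v} \<in> \<U>}"
proof -
  let ?P = "\<lambda>\<U>. \<U> \<subseteq> complex_lines \<and> open {v. v \<noteq> 0 \<and> vec.span {v} \<in> \<U>}"
  have "istopology ?P"
    unfolding istopology_def
  proof (intro conjI allI impI)
    fix \<U> \<V> assume U: "?P \<U>" and V: "?P \<V>"
    show "\<U> \<inter> \<V> \<subseteq> complex_lines" using U by blast
    have "{v. v \<noteq> 0 \<and> vec.span {v} \<in> \<U> \<inter> \<V>} =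
        {v. v \<noteq> 0 \<and> vec.span {v} \<in> \<U>} \<inter> {v. v \<noteq> 0 \<and> vec.span {v} \<in> \<V>}" by blast
    then show "open {v. v \<noteq> 0 \<and> vec.span {v} \<in> \<U> \<inter> \<V>}" using U V by auto
  next
    fix \<K> assume K: "\<forall>\<U>\<in>\<K>. ?P \<U>"
    then show "\<Union>\<K> \<subseteq> complex_lines" by blast
    have "{v. v \<noteq> 0 \<and> vec.span {v} \<in> \<Union>\<K>} = (\<Union>\<U>\<in>\<K>. {v. v \<noteq> 0 \<and> vec.span {v} \<in> \<U>})" by blast
    then show "open {v. v \<noteq> 0 \<and> vec.span {v} \<in> \<Union>\<K>}" using K by auto
  qed
  then show ?thesis
    unfolding projective_line_def by (simp add: topology_inverse')
qed

lemma quotient_map_projective_line: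
  "quotient_map (top_of_set (- {0})) projective_line (\<lambda>v. vec.span {v})"
proof -
  have onto: "(\<lambda>v. vec.span {v}) ` (- {0}) = complex_lines"
  proof
    show "(\<lambda>v. vec.span {v}) ` (- {0}) \<subseteq> complex_lines"
      using span_in_complex_lines by blast
    show "complex_lines \<subseteq> (\<lambda>v. vec.span {v}) ` (- {0})"
    proof
      fix L :: "(complex^2) set" assume L: "L \<in> complex_lines"
      obtain B where B: "B \<subseteq> L" "vec.independent B" "L \<subseteq> vec.span B" "card B = vec.dim L"
        using vec.basis_exists by blast
      then obtain v where v: "B = {v}"
        using L by (auto simp: complex_lines_def card_1_singleton_iff)
      have "vec.span B \<subseteq> L"
        using L B(1) by (simp add: complex_lines_def vec.span_minimal)
      then have "L = vec.span {v}" using B(3) v by blast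
      moreover have "v \<noteq> 0" using B(2) v by simp
      ultimately show "L \<in> (\<lambda>v. vec.span {v}) ` (- {0})" by blast
    qed
  qed
  have "{v. v \<noteq> 0 \<and> vec.span {v} \<in> complex_lines} = - {0}"
    using span_in_complex_lines by blast
  then have "openin projective_line complex_lines"
    by (simp add: openin_projective_line open_Compl)
  then have top: "topspace projective_line = complex_lines"
    unfolding topspace_def by (auto simp: openin_projective_line)
  have "{v \<in> - {0}. vec.span {v} \<in> \<U>} = {v. v \<noteq> 0 \<and> vec.span {v} \<in> \<U>}" for \<U> :: "(complex^2) set set"
    by blast
  then show ?thesis
    unfolding quotient_map_def top
    using onto by (auto simp: openin_projective_line openin_open_eq open_Compl)
qed

definition dominated_splitting ::
    "('a::topological_space \<Rightarrow> 'a) \<Rightarrow> ('a \<Rightarrow> complex^2^2) \<Rightarrow> bool" where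
  "dominated_splitting T A \<longleftrightarrow>
     (\<exists>Ep Em.
        continuous_map euclidean projective_line Ep \<and>
        continuous_map euclidean projective_line Em \<and>
        (\<forall>x. Ep x \<inter> Em x = {0} \<and> {u + v |u v. u \<in> Ep x \<and> v \<in> Em x} = UNIV) \<and>
        (\<forall>x. (*v) (A x) ` Ep x \<subseteq> Ep (T x) \<and> (*v) (A x) ` Em x \<subseteq> Em (T x)) \<and>
        (\<exists>N\<ge>1. \<forall>x. \<forall>u\<in>Ep x. \<forall>v\<in>Em x. norm u = 1 \<longrightarrow> norm v = 1 \<longrightarrow>
           norm (cocycle T A N x *v u) > norm (cocycle T A N x *v v)))"

end

theory Submission
  imports Defs
begin

text \<open>
  Let \<open>|z| = 1\<close> and put \<open>v\<^sub>k = (z \<psi>(2k), \<phi>(2k))\<close> with \<open>\<phi> = M \<psi>\<close>. A solution of \<open>E \<psi> = z \<psi>\<close> satisfies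
  \<open>\<rho>\<^sub>f \<rho>\<^sub>g v\<^sub>k = A v\<^sub>k\<^sub>-\<^sub>1\<close>, where \<open>\<rho>\<^sub>f \<rho>\<^sub>g\<close> may vanish, and \<open>A\<close> preserves the form \<open>|v\<^sub>1|\<^sup>2 - |v\<^sub>2|\<^sup>2\<close> up to the factor
  \<open>|\<rho>\<^sub>f \<rho>\<^sub>g|\<^sup>2 = det A\<close>. To cover the zeros of \<open>\<rho>\<^sub>f \<rho>\<^sub>g\<close>, one works with the two-dimensional relation between
  \<open>v\<^sub>k\<^sub>-\<^sub>1\<close> and \<open>v\<^sub>k\<close> instead of a matrix.

  If \<open>E\<^sub>x - z\<close> is invertible for one \<open>x\<close>, then by minimality and because \<open>T\<close> is an isometry it is so for
  all \<open>x\<close> with a uniform bound. The boundary values of the square-summable solutions on the right and on the left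
  half line are isotropic, meet only in 0, and span the plane, since any jump of \<open>v\<close> is realised by the resolvent
  applied to a suitable finitely supported sequence; this also gives their continuity. Uniform decay of these
  solutions is the domination. Conversely, a dominated splitting turns the inhomogeneous equation
  \<open>(E\<^sub>x - z) \<psi> = h\<close> into two scalar recursions that contract in opposite directions, with the factors
  \<open>|\<rho>\<^sub>f \<rho>\<^sub>g| / \<parallel>A u\<parallel>\<close>, \<open>u\<close> a unit vector of the dominating line; hence \<open>E\<^sub>x - z\<close> is bounded below.
\<close>

section \<open>Square-summable sequences and boundedly invertible operators\<close>

text \<open>Two obstacles shape the argument. The first is to pass from one fibre to all. Since
  \<open>T\<close> keeps two orbits at constant distance, all blocks of \<open>E x\<close> and
  \<open>E y\<close> are close at once, and \<open>E x\<close> depends on \<open>x\<close> in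
  operator norm; on a single orbit the operators are translates of each other. Perturbation then
  spreads one bound from a dense orbit to the whole space. The second is \<open>tr = 0\<close>. A
  left solution may then have no continuation to the right, but its multiple by \<open>tr\<close>
  has one. Over \<open>n\<close> steps the same product of values of \<open>tr\<close> therefore
  appears for both lines: relative to it, one line shrinks and the other grows. When the product is
  0, strict domination rests on \<open>A\<close> having no kernel on the left line. For the
  converse, \<open>det A = |tr|^2\<close> expresses \<open>(|tr| / |a|)^2\<close> through
  \<open>|b| / |a|\<close> and a quotient of angles, where \<open>a\<close> and \<open>b\<close> are
  the multipliers of \<open>A\<close> on the dominating and the dominated line. These quotients
  telescope along orbits, so domination, a statement on \<open>|b| / |a|\<close>, makes long
  products of \<open>|tr| / |a|\<close> small.\<close>

lemma ell2_normI:
  assumes "\<And>F. finite F \<Longrightarrow> L2_set (\<lambda>n. cmod (\<psi> n)) F \<le> C"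
  shows "\<psi> \<in> ell2" "ell2_norm \<psi> \<le> C"
proof -
  have C: "0 \<le> C" using assms[of "{}"] by simp
  have s: "(\<Sum>n\<in>F. (cmod (\<psi> n))\<^sup>2) \<le> C\<^sup>2" if "finite F" for F
  proof -
    have "sqrt (\<Sum>n\<in>F. (cmod (\<psi> n))\<^sup>2) \<le> C"
      using assms[OF that] by (simp add: L2_set_def)
    then show ?thesis by (simp add: sqrt_le_D)
  qed
  have "(\<lambda>n. (cmod (\<psi> n))\<^sup>2) summable_on UNIV"
    by (rule nonneg_bdd_above_summable_on) (auto intro!: bdd_aboveI2[where M = "C\<^sup>2"] s)
  then show "\<psi> \<in> ell2" by (simp add: ell2_def)
  have "(\<Sum>\<^sub>\<infinity>n. (cmod (\<psi> n))\<^sup>2) \<le> C\<^sup>2"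
    by (rule infsum_le_finite_sums) (use s \<open>\<psi> \<in> ell2\<close> in \<open>auto simp: ell2_def\<close>)
  then show "ell2_norm \<psi> \<le> C"
    using C by (simp add: ell2_norm_def real_le_lsqrt infsum_nonneg)
qed

lemma L2_set_le_ell2_norm:
  assumes "\<psi> \<in> ell2"
  shows "L2_set (\<lambda>n. cmod (\<psi> n)) F \<le> ell2_norm \<psi>"
proof (cases "finite F")
  case True
  have "(\<Sum>n\<in>F. (cmod (\<psi> n))\<^sup>2) \<le> (\<Sum>\<^sub>\<infinity>n. (cmod (\<psi> n))\<^sup>2)"
    by (rule finite_sum_le_infsum) (use assms True in \<open>auto simp: ell2_def\<close>)
  then show ?thesis by (simp add: L2_set_def ell2_norm_def)
qed (simp add: ell2_norm_def infsum_nonneg)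

lemma ell2_norm_nonneg [simp]: "0 \<le> ell2_norm \<psi>"
  by (simp add: ell2_norm_def infsum_nonneg)

lemma cmod_le_ell2_norm:
  assumes "\<psi> \<in> ell2" shows "cmod (\<psi> n) \<le> ell2_norm \<psi>"
  using L2_set_le_ell2_norm[OF assms, of "{n}"] by (simp add: L2_set_def)

lemma ell2_dominated2:
  assumes "\<phi> \<in> ell2" "\<psi> \<in> ell2" "\<And>n. cmod (\<eta> n) \<le> cmod (\<phi> n) + cmod (\<psi> n)"
  shows "\<eta> \<in> ell2" "ell2_norm \<eta> \<le> ell2_norm \<phi> + ell2_norm \<psi>"
proof -
  have *: "L2_set (\<lambda>n. cmod (\<eta> n)) F \<le> ell2_norm \<phi> + ell2_norm \<psi>" for F
  proof -
    have "L2_set (\<lambda>n. cmod (\<eta> n)) F \<le> L2_set (\<lambda>n. cmod (\<phi> n) + cmod (\<psi> n)) F"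
      by (rule L2_set_mono) (use assms in auto)
    also have "\<dots> \<le> L2_set (\<lambda>n. cmod (\<phi> n)) F + L2_set (\<lambda>n. cmod (\<psi> n)) F"
      by (rule L2_set_triangle_ineq)
    also have "\<dots> \<le> ell2_norm \<phi> + ell2_norm \<psi>"
      by (intro add_mono L2_set_le_ell2_norm assms)
    finally show ?thesis .
  qed
  show "\<eta> \<in> ell2" "ell2_norm \<eta> \<le> ell2_norm \<phi> + ell2_norm \<psi>" using ell2_normI[OF *] .
qed

lemma ell2_zero [simp]: "(\<lambda>n. 0) \<in> ell2" "ell2_norm (\<lambda>n. 0) = 0"
  by (simp_all add: ell2_def ell2_norm_def)

lemma ell2_dominated:
  assumes "\<psi> \<in> ell2" "\<And>n. cmod (\<eta> n) \<le> cmod (\<psi> n)"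
  shows "\<eta> \<in> ell2" "ell2_norm \<eta> \<le> ell2_norm \<psi>"
  using ell2_dominated2[of \<psi> "\<lambda>n. 0" \<eta>] assms by auto

lemma ell2_scale:
  assumes "\<psi> \<in> ell2"
  shows "(\<lambda>n. c * \<psi> n) \<in> ell2" "ell2_norm (\<lambda>n. c * \<psi> n) = cmod c * ell2_norm \<psi>"
proof -
  show "(\<lambda>n. c * \<psi> n) \<in> ell2"
    using assms by (simp add: ell2_def norm_mult power_mult_distrib summable_on_cmult_right)
  show "ell2_norm (\<lambda>n. c * \<psi> n) = cmod c * ell2_norm \<psi>"
    by (simp add: ell2_norm_def norm_mult power_mult_distrib infsum_cmult_right' real_sqrt_mult)
qed

lemma ell2_add:
  assumes "\<phi> \<in> ell2" "\<psi> \<in> ell2"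
  shows "(\<lambda>n. \<phi> n + \<psi> n) \<in> ell2" "ell2_norm (\<lambda>n. \<phi> n + \<psi> n) \<le> ell2_norm \<phi> + ell2_norm \<psi>"
  by (rule ell2_dominated2[OF assms norm_triangle_ineq])+

lemma ell2_diff:
  assumes "\<phi> \<in> ell2" "\<psi> \<in> ell2"
  shows "(\<lambda>n. \<phi> n - \<psi> n) \<in> ell2" "ell2_norm (\<lambda>n. \<phi> n - \<psi> n) \<le> ell2_norm \<phi> + ell2_norm \<psi>"
  by (rule ell2_dominated2[OF assms norm_triangle_ineq4])+

lemma ell2_norm_eq_0: "\<psi> \<in> ell2 \<Longrightarrow> ell2_norm \<psi> = 0 \<Longrightarrow> \<psi> = (\<lambda>n. 0)"
  using cmod_le_ell2_norm by (metis norm_le_zero_iff)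

lemma ell2_reindex:
  assumes "\<psi> \<in> ell2" "inj s"
  shows "(\<lambda>n. \<psi> (s n)) \<in> ell2" "ell2_norm (\<lambda>n. \<psi> (s n)) \<le> ell2_norm \<psi>"
proof -
  have *: "L2_set (\<lambda>n. cmod (\<psi> (s n))) F \<le> ell2_norm \<psi>" for F
  proof -
    have "L2_set (\<lambda>n. cmod (\<psi> (s n))) F = L2_set (\<lambda>n. cmod (\<psi> n)) (s ` F)"
      using assms(2) by (simp add: L2_set_def sum.reindex inj_on_subset[of s UNIV])
    then show ?thesis using L2_set_le_ell2_norm[OF assms(1)] by simp
  qed
  show "(\<lambda>n. \<psi> (s n)) \<in> ell2" "ell2_norm (\<lambda>n. \<psi> (s n)) \<le> ell2_norm \<psi>"
    using ell2_normI[OF *] .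
qed

lemma ell2_finite_support:
  assumes "finite {n. \<psi> n \<noteq> 0}"
  shows "\<psi> \<in> ell2" "ell2_norm \<psi> \<le> (\<Sum>n | \<psi> n \<noteq> 0. cmod (\<psi> n))"
proof -
  let ?S = "{n. \<psi> n \<noteq> 0}"
  have *: "L2_set (\<lambda>n. cmod (\<psi> n)) F \<le> (\<Sum>n\<in>?S. cmod (\<psi> n))" if "finite F" for F
  proof -
    have "L2_set (\<lambda>n. cmod (\<psi> n)) F \<le> (\<Sum>n\<in>F. cmod (\<psi> n))"
      by (rule L2_set_le_sum) auto
    also have "\<dots> = (\<Sum>n\<in>F \<inter> ?S. cmod (\<psi> n))"
      by (rule sum.mono_neutral_right) (use that in auto)
    also have "\<dots> \<le> (\<Sum>n\<in>?S. cmod (\<psi> n))"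
      by (rule sum_mono2) (use assms in auto)
    finally show ?thesis .
  qed
  show "\<psi> \<in> ell2" "ell2_norm \<psi> \<le> (\<Sum>n\<in>?S. cmod (\<psi> n))" using ell2_normI[OF *] by auto
qed

section \<open>Completeness of the sequence space\<close>

interpretation ell2: Metric_space ell2 "\<lambda>\<phi> \<psi>. ell2_norm (\<lambda>n. \<phi> n - \<psi> n)"
proof
  fix \<phi> \<psi> \<eta> :: "int \<Rightarrow> complex"
  show "ell2_norm (\<lambda>n. \<phi> n - \<psi> n) = ell2_norm (\<lambda>n. \<psi> n - \<phi> n)"
    by (simp add: ell2_norm_def norm_minus_commute)
  show "(ell2_norm (\<lambda>n. \<phi> n - \<psi> n) = 0) = (\<phi> = \<psi>)" if "\<phi> \<in> ell2" "\<psi> \<in> ell2"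
    using ell2_norm_eq_0[OF ell2_diff(1)[OF that]] by (auto simp: fun_eq_iff)
  show "ell2_norm (\<lambda>n. \<phi> n - \<eta> n) \<le> ell2_norm (\<lambda>n. \<phi> n - \<psi> n) + ell2_norm (\<lambda>n. \<psi> n - \<eta> n)"
    if "\<phi> \<in> ell2" "\<psi> \<in> ell2" "\<eta> \<in> ell2"
    using ell2_add(2)[OF ell2_diff(1)[OF that(1,2)] ell2_diff(1)[OF that(2,3)]] by simp
qed simp

text \<open>Needed for the fixed point argument in \<open>inv_bound_perturb\<close>.\<close>

lemma ell2_mcomplete: "ell2.mcomplete"
  unfolding ell2.mcomplete_def
proof (intro allI impI)
  fix \<sigma> :: "nat \<Rightarrow> int \<Rightarrow> complex" assume "ell2.MCauchy \<sigma>"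
  then have mem: "\<And>m. \<sigma> m \<in> ell2"
    and cau: "\<And>e. e > 0 \<Longrightarrow> \<exists>N. \<forall>m m'. N \<le> m \<longrightarrow> N \<le> m' \<longrightarrow> ell2_norm (\<lambda>n. \<sigma> m n - \<sigma> m' n) < e"
    unfolding ell2.MCauchy_def by auto
  have "Cauchy (\<lambda>m. \<sigma> m n)" for n
  proof (rule metric_CauchyI)
    fix e :: real assume "e > 0"
    then obtain N where N: "\<And>m m'. N \<le> m \<Longrightarrow> N \<le> m' \<Longrightarrow> ell2_norm (\<lambda>n. \<sigma> m n - \<sigma> m' n) < e"
      using cau by blast
    have "dist (\<sigma> m n) (\<sigma> m' n) < e" if "m \<ge> N" "m' \<ge> N" for m m' :: nat
      using cmod_le_ell2_norm[OF ell2_diff(1)[OF mem[of m] mem[of m']], of n] N[OF that]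
      by (simp add: dist_norm)
    then show "\<exists>M. \<forall>m\<ge>M. \<forall>m'\<ge>M. dist (\<sigma> m n) (\<sigma> m' n) < e" by blast
  qed
  then have "\<exists>l. (\<lambda>m. \<sigma> m n) \<longlonglongrightarrow> l" for n
    by (simp add: Cauchy_convergent_iff convergent_def)
  then obtain l where l: "\<And>n. (\<lambda>m. \<sigma> m n) \<longlonglongrightarrow> l n" by metis
  have close: "(\<lambda>n. \<sigma> m n - l n) \<in> ell2 \<and> ell2_norm (\<lambda>n. \<sigma> m n - l n) \<le> e"
    if N: "\<And>m m'. N \<le> m \<Longrightarrow> N \<le> m' \<Longrightarrow> ell2_norm (\<lambda>n. \<sigma> m n - \<sigma> m' n) < e" and "m \<ge> N" for m N e
  proof -
    \<comment> \<open>Pointwise convergence suffices on a window \<open>F\<close>, and the bound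
      \<open>e\<close> does not depend on the window.\<close>
    have *: "L2_set (\<lambda>n. cmod (\<sigma> m n - l n)) F \<le> e" for F
    proof (rule LIMSEQ_le_const2)
      show "(\<lambda>m'. L2_set (\<lambda>n. cmod (\<sigma> m n - \<sigma> m' n)) F) \<longlonglongrightarrow> L2_set (\<lambda>n. cmod (\<sigma> m n - l n)) F"
        unfolding L2_set_def by (intro tendsto_intros l)
      have "L2_set (\<lambda>n. cmod (\<sigma> m n - \<sigma> m' n)) F \<le> e" if "m' \<ge> N" for m'
        using L2_set_le_ell2_norm[OF ell2_diff(1)[OF mem[of m] mem[of m']], of F] N[OF \<open>m \<ge> N\<close> that] by simp
      then show "\<exists>N. \<forall>m'\<ge>N. L2_set (\<lambda>n. cmod (\<sigma> m n - \<sigma> m' n)) F \<le> e" by blast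
    qed
    show ?thesis using ell2_normI[OF *] by blast
  qed
  obtain N where "\<And>m m'. N \<le> m \<Longrightarrow> N \<le> m' \<Longrightarrow> ell2_norm (\<lambda>n. \<sigma> m n - \<sigma> m' n) < 1"
    using cau[of 1] by auto
  then have "(\<lambda>n. \<sigma> N n - l n) \<in> ell2" using close by blast
  then have "(\<lambda>n. \<sigma> N n - (\<sigma> N n - l n)) \<in> ell2" using ell2_diff mem by blast
  then have "l \<in> ell2" by simp
  moreover have "\<exists>N. \<forall>m\<ge>N. ell2_norm (\<lambda>n. \<sigma> m n - l n) < e" if "e > 0" for e
  proof -
    obtain N where N: "\<And>m m'. N \<le> m \<Longrightarrow> N \<le> m' \<Longrightarrow> ell2_norm (\<lambda>n. \<sigma> m n - \<sigma> m' n) < e / 2"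
      using cau[of "e/2"] \<open>e > 0\<close> by auto
    have "ell2_norm (\<lambda>n. \<sigma> m n - l n) \<le> e / 2" if "m \<ge> N" for m
      using close[OF N that] by blast
    then show ?thesis using \<open>e > 0\<close> by (intro exI[of _ N]) force
  qed
  ultimately have "limitin ell2.mtopology \<sigma> l sequentially"
    using mem by (simp add: ell2.limit_metric_sequentially)
  then show "\<exists>l. limitin ell2.mtopology \<sigma> l sequentially"
    by (rule exI[of _ l])
qed

text \<open>Linearity is asked on all sequences: an entry of the image under a block operator
  depends on two entries only. This keeps algebraic rewriting free of membership conditions.\<close>

definition lin_op :: "((int \<Rightarrow> complex) \<Rightarrow> int \<Rightarrow> complex) \<Rightarrow> bool" where
  "lin_op P \<longleftrightarrow> (\<forall>\<phi> \<psi> a b. P (\<lambda>n. a * \<phi> n + b * \<psi> n) = (\<lambda>n. a * P \<phi> n + b * P \<psi> n))"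

lemma lin_op_comb: "lin_op P \<Longrightarrow> P (\<lambda>n. a * \<phi> n + b * \<psi> n) = (\<lambda>n. a * P \<phi> n + b * P \<psi> n)"
  by (simp add: lin_op_def)

lemma lin_op_diff: "lin_op P \<Longrightarrow> P (\<lambda>n. \<phi> n - \<psi> n) = (\<lambda>n. P \<phi> n - P \<psi> n)"
  using lin_op_comb[of P 1 \<phi> "-1" \<psi>] by simp

lemma lin_op_scale: "lin_op P \<Longrightarrow> P (\<lambda>n. a * \<phi> n) = (\<lambda>n. a * P \<phi> n)"
  using lin_op_comb[of P a \<phi> "0" \<phi>] by simp

lemma lin_op_zero: "lin_op P \<Longrightarrow> P (\<lambda>n. 0) = (\<lambda>n. 0)"
  using lin_op_scale[of P 0 "\<lambda>n. 0"] by simp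

lemma lin_op_minus_scaled: "lin_op P \<Longrightarrow> lin_op (\<lambda>\<psi> n. P \<psi> n - z * \<psi> n)"
  by (subst lin_op_def) (simp add: lin_op_comb fun_eq_iff algebra_simps)

text \<open>\<open>K\<close> bounds the norm of the inverse without an inverse being named, so that
  the constant can be followed through shifts and perturbations.\<close>

definition inv_bound :: "real \<Rightarrow> ((int \<Rightarrow> complex) \<Rightarrow> int \<Rightarrow> complex) \<Rightarrow> bool" where
  "inv_bound K P \<longleftrightarrow> (\<forall>\<psi>\<in>ell2. P \<psi> \<in> ell2 \<and> ell2_norm \<psi> \<le> K * ell2_norm (P \<psi>)) \<and>
     (\<forall>h\<in>ell2. \<exists>\<psi>\<in>ell2. P \<psi> = h)"

lemma inv_bound_inj:
  assumes "inv_bound K P" "lin_op P" "\<phi> \<in> ell2" "\<psi> \<in> ell2" "P \<phi> = P \<psi>"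
  shows "\<phi> = \<psi>"
proof -
  have "P (\<lambda>n. \<phi> n - \<psi> n) = (\<lambda>n. 0)" using assms by (simp add: lin_op_diff)
  moreover have "(\<lambda>n. \<phi> n - \<psi> n) \<in> ell2" using assms ell2_diff by blast
  ultimately have "ell2_norm (\<lambda>n. \<phi> n - \<psi> n) \<le> K * ell2_norm (\<lambda>n. 0::complex)"
    using assms(1) unfolding inv_bound_def by metis
  then have "ell2_norm (\<lambda>n. \<phi> n - \<psi> n) = 0" by (simp add: order_antisym)
  then show ?thesis using assms(3,4) ell2.zero by blast
qed

text \<open>The Neumann series as a fixed point: \<open>Q \<psi> = h\<close> means
  \<open>P \<psi> = h - (Q \<psi> - P \<psi>)\<close>, and solving the left side by a right inverse
  of \<open>P\<close> gives a contraction with factor \<open>K * e\<close>.\<close>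

lemma inv_bound_perturb:
  assumes P: "inv_bound K P" "lin_op P" and Q: "lin_op Q"
    and close: "\<And>\<psi>. \<psi> \<in> ell2 \<Longrightarrow> (\<lambda>n. Q \<psi> n - P \<psi> n) \<in> ell2 \<and>
        ell2_norm (\<lambda>n. Q \<psi> n - P \<psi> n) \<le> e * ell2_norm \<psi>"
    and K: "0 \<le> K" "0 \<le> e" "K * e < 1"
  shows "inv_bound (K / (1 - K * e)) Q"
proof -
  have Qmem: "Q \<psi> \<in> ell2" if "\<psi> \<in> ell2" for \<psi>
  proof -
    have "P \<psi> \<in> ell2" using P that by (simp add: inv_bound_def)
    then show ?thesis using ell2_add(1)[of "\<lambda>n. Q \<psi> n - P \<psi> n" "P \<psi>"] close[OF that] by simp
  qed
  have below: "ell2_norm \<psi> \<le> K / (1 - K * e) * ell2_norm (Q \<psi>)" if "\<psi> \<in> ell2" for \<psi>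
  proof -
    have "ell2_norm (P \<psi>) \<le> ell2_norm (Q \<psi>) + ell2_norm (\<lambda>n. Q \<psi> n - P \<psi> n)"
      using ell2_diff(2)[OF Qmem[OF that], of "\<lambda>n. Q \<psi> n - P \<psi> n"] close[OF that] by simp
    also have "\<dots> \<le> ell2_norm (Q \<psi>) + e * ell2_norm \<psi>" using close[OF that] by simp
    finally have "K * ell2_norm (P \<psi>) \<le> K * (ell2_norm (Q \<psi>) + e * ell2_norm \<psi>)"
      using K(1) mult_left_mono by blast
    moreover have "ell2_norm \<psi> \<le> K * ell2_norm (P \<psi>)" using P that by (simp add: inv_bound_def)
    ultimately have "ell2_norm \<psi> * (1 - K * e) \<le> K * ell2_norm (Q \<psi>)" by (simp add: algebra_simps)
    then show ?thesis using K(3) by (simp add: field_simps)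
  qed
  have surj: "\<exists>\<psi>\<in>ell2. Q \<psi> = h" if h: "h \<in> ell2" for h
  proof -
    have "\<exists>R. \<forall>g\<in>ell2. R g \<in> ell2 \<and> P (R g) = g"
      using P(1) unfolding inv_bound_def by metis
    then obtain R where R: "\<And>g. g \<in> ell2 \<Longrightarrow> R g \<in> ell2" "\<And>g. g \<in> ell2 \<Longrightarrow> P (R g) = g" by blast
    define G where "G \<psi> = (\<lambda>n. h n - (Q \<psi> n - P \<psi> n))" for \<psi>
    have G: "G \<psi> \<in> ell2" if "\<psi> \<in> ell2" for \<psi>
      unfolding G_def using ell2_diff(1)[OF h] close[OF that] by blast
    have contr: "ell2_norm (\<lambda>n. R (G \<phi>) n - R (G \<psi>) n) \<le> (K * e) * ell2_norm (\<lambda>n. \<phi> n - \<psi> n)"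
      if m: "\<phi> \<in> ell2" "\<psi> \<in> ell2" for \<phi> \<psi>
    proof -
      have d: "(\<lambda>n. R (G \<phi>) n - R (G \<psi>) n) \<in> ell2" "(\<lambda>n. \<phi> n - \<psi> n) \<in> ell2"
        using m by (auto intro!: ell2_diff R G)
      have "P (\<lambda>n. R (G \<phi>) n - R (G \<psi>) n) = (\<lambda>n. G \<phi> n - G \<psi> n)"
        using m G R by (simp add: lin_op_diff[OF P(2)])
      also have "\<dots> = (\<lambda>n. - 1 * (Q (\<lambda>n. \<phi> n - \<psi> n) n - P (\<lambda>n. \<phi> n - \<psi> n) n))"
        by (simp add: G_def lin_op_diff[OF P(2)] lin_op_diff[OF Q] algebra_simps)
      finally have "ell2_norm (P (\<lambda>n. R (G \<phi>) n - R (G \<psi>) n)) \<le> e * ell2_norm (\<lambda>n. \<phi> n - \<psi> n)"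
        using close[OF d(2)] ell2_scale(2)[of "\<lambda>n. Q (\<lambda>n. \<phi> n - \<psi> n) n - P (\<lambda>n. \<phi> n - \<psi> n) n" "-1"]
        by simp
      then have "K * ell2_norm (P (\<lambda>n. R (G \<phi>) n - R (G \<psi>) n)) \<le> K * (e * ell2_norm (\<lambda>n. \<phi> n - \<psi> n))"
        using K mult_left_mono by blast
      moreover have "ell2_norm (\<lambda>n. R (G \<phi>) n - R (G \<psi>) n) \<le> K * ell2_norm (P (\<lambda>n. R (G \<phi>) n - R (G \<psi>) n))"
        using P d by (simp add: inv_bound_def)
      ultimately show ?thesis by (simp add: algebra_simps)
    qed
    have "(\<lambda>\<psi>. R (G \<psi>)) \<in> ell2 \<rightarrow> ell2" "ell2 \<noteq> {}" using R G ell2_zero(1) by blast+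
    then obtain \<psi> where "\<psi> \<in> ell2" "R (G \<psi>) = \<psi>"
      using ell2.Banach_fixedpoint_thm[OF ell2_mcomplete _ _ K(3) contr] by blast
    then have "P \<psi> = G \<psi>" using R(2) G by metis
    then have "Q \<psi> = h" by (simp add: G_def fun_eq_iff)
    then show ?thesis using \<open>\<psi> \<in> ell2\<close> by blast
  qed
  show ?thesis unfolding inv_bound_def using Qmem below surj by blast
qed

text \<open>In the direction from a bound to an inverse, preimages are picked by choice; their
  uniqueness makes the resulting map linear.\<close>

lemma not_in_spectrum_iff:
  assumes A: "lin_op A" "\<And>\<psi>. \<psi> \<in> ell2 \<Longrightarrow> A \<psi> \<in> ell2"
  shows "z \<notin> spectrum A \<longleftrightarrow> (\<exists>K. inv_bound K (\<lambda>\<psi> n. A \<psi> n - z * \<psi> n))"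
proof -
  define P where "P = (\<lambda>\<psi> n. A \<psi> n - z * \<psi> n)"
  have P: "lin_op P" unfolding P_def by (rule lin_op_minus_scaled[OF A(1)])
  have Pmem: "P \<psi> \<in> ell2" if "\<psi> \<in> ell2" for \<psi>
    unfolding P_def using that A(2) ell2_diff ell2_scale by blast
  have "z \<notin> spectrum A \<longleftrightarrow> (\<exists>R. bounded_op R \<and> (\<forall>\<psi>\<in>ell2. R (P \<psi>) = \<psi> \<and> P (R \<psi>) = \<psi>))"
    by (simp add: spectrum_def P_def)
  also have "\<dots> \<longleftrightarrow> (\<exists>K. inv_bound K P)"
  proof
    assume "\<exists>R. bounded_op R \<and> (\<forall>\<psi>\<in>ell2. R (P \<psi>) = \<psi> \<and> P (R \<psi>) = \<psi>)"
    then obtain R K where R: "\<And>\<psi>. \<psi> \<in> ell2 \<Longrightarrow> R \<psi> \<in> ell2"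
        "\<And>\<psi>. \<psi> \<in> ell2 \<Longrightarrow> ell2_norm (R \<psi>) \<le> K * ell2_norm \<psi>"
        "\<And>\<psi>. \<psi> \<in> ell2 \<Longrightarrow> R (P \<psi>) = \<psi>" "\<And>\<psi>. \<psi> \<in> ell2 \<Longrightarrow> P (R \<psi>) = \<psi>"
      unfolding bounded_op_def by blast
    then have "inv_bound K P" unfolding inv_bound_def using Pmem by metis
    then show "\<exists>K. inv_bound K P" ..
  next
    assume "\<exists>K. inv_bound K P"
    then obtain K where K: "inv_bound K P" ..
    then have "\<exists>R. \<forall>g\<in>ell2. R g \<in> ell2 \<and> P (R g) = g"
      unfolding inv_bound_def by metis
    then obtain R where R: "\<And>g. g \<in> ell2 \<Longrightarrow> R g \<in> ell2" "\<And>g. g \<in> ell2 \<Longrightarrow> P (R g) = g" by blast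
    note inj = inv_bound_inj[OF K P]
    have RP: "R (P \<psi>) = \<psi>" if "\<psi> \<in> ell2" for \<psi> using that R Pmem inj by metis
    have lin: "R (\<lambda>n. a * \<phi> n + b * \<psi> n) = (\<lambda>n. a * R \<phi> n + b * R \<psi> n)"
      if "\<phi> \<in> ell2" "\<psi> \<in> ell2" for \<phi> \<psi> a b
    proof -
      have 1: "(\<lambda>n. a * \<phi> n + b * \<psi> n) \<in> ell2" "(\<lambda>n. a * R \<phi> n + b * R \<psi> n) \<in> ell2"
        using that R ell2_add ell2_scale by simp_all
      have "P (\<lambda>n. a * R \<phi> n + b * R \<psi> n) = (\<lambda>n. a * \<phi> n + b * \<psi> n)"
        using that R by (simp add: lin_op_comb[OF P])
      then show ?thesis using RP[OF 1(2)] by simp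
    qed
    have "ell2_norm (R \<psi>) \<le> K * ell2_norm \<psi>" if "\<psi> \<in> ell2" for \<psi>
      using K R that unfolding inv_bound_def by metis
    then have "bounded_op R" unfolding bounded_op_def using R(1) lin by blast
    then show "\<exists>R. bounded_op R \<and> (\<forall>\<psi>\<in>ell2. R (P \<psi>) = \<psi> \<and> P (R \<psi>) = \<psi>)"
      using R RP by blast
  qed
  finally show ?thesis unfolding P_def .
qed

lemma inv_bound_mono:
  assumes "inv_bound K P" "K \<le> K'" shows "inv_bound K' P"
proof -
  have "ell2_norm \<psi> \<le> K' * ell2_norm (P \<psi>)" if "\<psi> \<in> ell2" for \<psi>
    using assms that mult_right_mono[OF assms(2), of "ell2_norm (P \<psi>)"]
    unfolding inv_bound_def by (meson ell2_norm_nonneg order_trans)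
  then show ?thesis using assms(1) by (auto simp: inv_bound_def)
qed

lemma inv_bound_scaled_identity:
  assumes "z \<noteq> 0" shows "inv_bound (1 / cmod z) (\<lambda>\<psi> n. z * \<psi> n)"
  unfolding inv_bound_def
proof (intro conjI ballI)
  fix \<psi> assume \<psi>: "\<psi> \<in> ell2"
  show "(\<lambda>n. z * \<psi> n) \<in> ell2" using \<psi> by (rule ell2_scale)
  show "ell2_norm \<psi> \<le> 1 / cmod z * ell2_norm (\<lambda>n. z * \<psi> n)"
    using \<psi> assms by (simp add: ell2_scale)
  show "\<exists>\<phi>\<in>ell2. (\<lambda>n. z * \<phi> n) = \<psi>"
    using \<psi> assms by (intro bexI[of _ "\<lambda>n. inverse z * \<psi> n"]) (auto intro: ell2_scale)
qed

text \<open>Inside the disc \<open>- z\<close> is a perturbation of the isometry of relative size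
  below 1; outside, the isometry is such a perturbation of \<open>- z\<close>.\<close>

lemma isometry_minus_scaled_inv_bound:
  assumes E: "lin_op E" "\<And>\<psi>. \<psi> \<in> ell2 \<Longrightarrow> E \<psi> \<in> ell2 \<and> ell2_norm (E \<psi>) = ell2_norm \<psi>"
    "\<And>h. h \<in> ell2 \<Longrightarrow> \<exists>\<psi>\<in>ell2. E \<psi> = h"
    and z: "cmod z \<noteq> 1"
  shows "\<exists>K. inv_bound K (\<lambda>\<psi> n. E \<psi> n - z * \<psi> n)"
proof (cases "cmod z < 1")
  case True
  have "inv_bound 1 E" using E by (simp add: inv_bound_def)
  moreover have "(\<lambda>n. (E \<psi> n - z * \<psi> n) - E \<psi> n) \<in> ell2 \<and>
     ell2_norm (\<lambda>n. (E \<psi> n - z * \<psi> n) - E \<psi> n) \<le> cmod z * ell2_norm \<psi>" if "\<psi> \<in> ell2" for \<psi>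
    using ell2_scale[OF that, of "-z"] by simp
  ultimately show ?thesis
    using inv_bound_perturb[OF _ E(1) lin_op_minus_scaled[OF E(1)]] True by fastforce
next
  case False
  then have "cmod z > 1" using z by simp
  then have 1: "inv_bound (1 / cmod z) (\<lambda>\<psi> n. - z * \<psi> n)"
    using inv_bound_scaled_identity[of "- z"] by (cases "z = 0") auto
  have 2: "lin_op (\<lambda>\<psi> n. - z * \<psi> n)" by (simp add: lin_op_def algebra_simps)
  have 3: "(\<lambda>n. (E \<psi> n - z * \<psi> n) - (- z * \<psi> n)) \<in> ell2 \<and>
     ell2_norm (\<lambda>n. (E \<psi> n - z * \<psi> n) - (- z * \<psi> n)) \<le> 1 * ell2_norm \<psi>" if "\<psi> \<in> ell2" for \<psi>
    using E(2)[OF that] by simp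
  have 4: "1 / cmod z * 1 < 1" using \<open>cmod z > 1\<close> by (subst mult_1_right, subst divide_less_eq_1_pos) auto
  have "inv_bound (1 / cmod z / (1 - 1 / cmod z * 1)) (\<lambda>\<psi> n. E \<psi> n - z * \<psi> n)"
    by (rule inv_bound_perturb[OF 1 2 lin_op_minus_scaled[OF E(1)] 3 _ _ 4]) simp_all
  then show ?thesis by blast
qed

text \<open>For \<open>\<bar>z\<bar> = 1\<close> surjectivity of \<open>E - z\<close> is inherited from \<open>E - w\<close> with \<open>w = (1 - d) z\<close>,
  whose inverse is bounded uniformly as \<open>d\<close> tends to 0.\<close>

lemma isometry_minus_unit_inv_bound:
  assumes E: "lin_op E" "\<And>\<psi>. \<psi> \<in> ell2 \<Longrightarrow> E \<psi> \<in> ell2 \<and> ell2_norm (E \<psi>) = ell2_norm \<psi>"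
    "\<And>h. h \<in> ell2 \<Longrightarrow> \<exists>\<psi>\<in>ell2. E \<psi> = h"
    and z: "cmod z = 1"
    and below: "\<And>\<psi>. \<psi> \<in> ell2 \<Longrightarrow> ell2_norm \<psi> \<le> K * ell2_norm (\<lambda>n. E \<psi> n - z * \<psi> n)"
    and K: "K > 0"
  shows "\<exists>K. inv_bound K (\<lambda>\<psi> n. E \<psi> n - z * \<psi> n)"
proof -
  \<comment> \<open>\<open>K * d \<le> 1/4\<close> is used twice: the term
    \<open>K * d * ell2_norm \<psi>\<close> can be absorbed, which bounds the inverse at
    \<open>w\<close> by \<open>2 * K\<close>, and the way back from \<open>w\<close> to
    \<open>z\<close> has relative size \<open>2 * K * d \<le> 1/2\<close>.\<close>
  define d where "d = min (1/2) (1 / (4 * K))"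
  have d: "0 < d" "d \<le> 1/2" "K * d \<le> 1/4" using K by (auto simp: d_def min_def field_simps)
  define w where "w = complex_of_real (1 - d) * z"
  have zw: "z - w = of_real d * z" by (simp add: w_def algebra_simps)
  have "cmod w = 1 - d" using d z by (simp add: w_def norm_mult del: of_real_diff)
  then obtain K0 where K0: "inv_bound K0 (\<lambda>\<psi> n. E \<psi> n - w * \<psi> n)"
    using isometry_minus_scaled_inv_bound[OF E, of w] d by auto
  have diff: "ell2_norm (\<lambda>n. (E \<psi> n - z * \<psi> n) - (E \<psi> n - w * \<psi> n)) = d * ell2_norm \<psi> \<and>
      (\<lambda>n. (E \<psi> n - z * \<psi> n) - (E \<psi> n - w * \<psi> n)) \<in> ell2" if "\<psi> \<in> ell2" for \<psi>
  proof -
    have "(\<lambda>n. (E \<psi> n - z * \<psi> n) - (E \<psi> n - w * \<psi> n)) = (\<lambda>n. - (of_real d * z) * \<psi> n)"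
      unfolding zw[symmetric] by (simp add: fun_eq_iff algebra_simps)
    then show ?thesis using ell2_scale[OF that, of "- (of_real d * z)"] z d by (simp add: norm_mult)
  qed
  have "ell2_norm \<psi> \<le> 2 * K * ell2_norm (\<lambda>n. E \<psi> n - w * \<psi> n)" if \<psi>: "\<psi> \<in> ell2" for \<psi>
  proof -
    have "(\<lambda>n. E \<psi> n - w * \<psi> n) \<in> ell2" using ell2_diff(1) ell2_scale(1) E(2) \<psi> by blast
    then have "ell2_norm (\<lambda>n. E \<psi> n - z * \<psi> n) \<le> ell2_norm (\<lambda>n. E \<psi> n - w * \<psi> n) + d * ell2_norm \<psi>"
      using ell2_add(2)[of "\<lambda>n. E \<psi> n - w * \<psi> n" "\<lambda>n. (E \<psi> n - z * \<psi> n) - (E \<psi> n - w * \<psi> n)"] diff[OF \<psi>]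
      by simp
    then have "K * ell2_norm (\<lambda>n. E \<psi> n - z * \<psi> n) \<le> K * (ell2_norm (\<lambda>n. E \<psi> n - w * \<psi> n) + d * ell2_norm \<psi>)"
      using K mult_left_mono by (metis less_imp_le)
    then have "ell2_norm \<psi> \<le> K * ell2_norm (\<lambda>n. E \<psi> n - w * \<psi> n) + (K * d) * ell2_norm \<psi>"
      using below[OF \<psi>] by (simp add: algebra_simps)
    moreover have "(K * d) * ell2_norm \<psi> \<le> 1/4 * ell2_norm \<psi>" using d by (intro mult_right_mono) auto
    ultimately show ?thesis using ell2_norm_nonneg[of \<psi>] by linarith
  qed
  \<comment> \<open>Membership and surjectivity come from \<open>K0\<close>; its constant, which
    might deteriorate near the circle, is replaced by the one just proved.\<close>
  then have "inv_bound (2 * K) (\<lambda>\<psi> n. E \<psi> n - w * \<psi> n)" using K0 by (auto simp: inv_bound_def)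
  then have "inv_bound (2 * K / (1 - 2 * K * d)) (\<lambda>\<psi> n. E \<psi> n - z * \<psi> n)"
    using inv_bound_perturb[OF _ lin_op_minus_scaled[OF E(1)] lin_op_minus_scaled[OF E(1)], of "2 * K" w z d]
      diff K d by (simp add: mult.assoc)
  then show ?thesis ..
qed

section \<open>The operator family\<close>

lemma lin_op_block_diag: "lin_op (block_diag_op s B)"
  unfolding lin_op_def
  by (simp add: fun_eq_iff block_diag_op_def Let_def matrix_vector_mult_def sum_2 algebra_simps)

lemma lin_op_comp:
  assumes "lin_op P" "lin_op Q" shows "lin_op (P \<circ> Q)"
  by (subst lin_op_def) (simp add: lin_op_comb[OF assms(1)] lin_op_comb[OF assms(2)])

lemma lin_op_gcmv: "lin_op (gcmv T f g x)"
  by (simp add: gcmv_def cmv_L_def cmv_M_def lin_op_comp lin_op_block_diag)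

lemma int_block_cases:
  obtains k where "(n::int) = 2 * k + s" | k where "n = 2 * k + s + 1"
proof (cases "even (n - s)")
  case True
  then obtain k where "n - s = 2 * k" by blast
  then show ?thesis using that(1)[of k] by simp
next
  case False
  then obtain k where "n - s = 2 * k + 1" by (elim oddE)
  then show ?thesis using that(2)[of k] by simp
qed

lemma block_diag_op_surj:
  assumes "\<And>k. unitary_mat (B k)" "h \<in> ell2"
  shows "\<exists>\<psi>\<in>ell2. block_diag_op s B \<psi> = h"
proof -
  define B' where "B' k = adjoint_mat (B k)" for k
  have inv: "B k ** B' k = mat 1" "B' k ** B k = mat 1" for k
    using assms(1)[of k] by (simp_all add: unitary_mat_def B'_def)
  have "adjoint_mat (B' k) = B k" for k
    by (simp add: B'_def adjoint_mat_def vec_eq_iff)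
  then have "unitary_mat (B' k)" for k using inv by (simp add: unitary_mat_def)
  then have mem: "block_diag_op s B' h \<in> ell2" using assms(2) block_diag_op_isometry by blast
  have e: "B k $ 1 $ 1 * B' k $ 1 $ 1 + B k $ 1 $ 2 * B' k $ 2 $ 1 = 1"
    "B k $ 1 $ 1 * B' k $ 1 $ 2 + B k $ 1 $ 2 * B' k $ 2 $ 2 = 0"
    "B k $ 2 $ 1 * B' k $ 1 $ 1 + B k $ 2 $ 2 * B' k $ 2 $ 1 = 0"
    "B k $ 2 $ 1 * B' k $ 1 $ 2 + B k $ 2 $ 2 * B' k $ 2 $ 2 = 1" for k
    using inv(1)[of k] by (auto simp: vec_eq_iff forall_2 matrix_matrix_mult_def sum_2 mat_def)
  have "block_diag_op s B (block_diag_op s B' h) n = h n" for n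
  proof (cases rule: int_block_cases[of n s])
    case (1 k)
    have "block_diag_op s B (block_diag_op s B' h) n =
      (B k $ 1 $ 1 * B' k $ 1 $ 1 + B k $ 1 $ 2 * B' k $ 2 $ 1) * h (2 * k + s) +
      (B k $ 1 $ 1 * B' k $ 1 $ 2 + B k $ 1 $ 2 * B' k $ 2 $ 2) * h (2 * k + s + 1)"
      unfolding 1 by (simp only: block_diag_op_fst block_diag_op_snd) (simp add: algebra_simps)
    then show ?thesis using 1 by (simp add: e)
  next
    case (2 k)
    have "block_diag_op s B (block_diag_op s B' h) n =
      (B k $ 2 $ 1 * B' k $ 1 $ 1 + B k $ 2 $ 2 * B' k $ 2 $ 1) * h (2 * k + s) +
      (B k $ 2 $ 1 * B' k $ 1 $ 2 + B k $ 2 $ 2 * B' k $ 2 $ 2) * h (2 * k + s + 1)"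
      unfolding 2 by (simp only: block_diag_op_fst block_diag_op_snd) (simp add: algebra_simps)
    then show ?thesis using 2 by (simp add: e)
  qed
  then show ?thesis using mem by blast
qed

text \<open>Blocks act on disjoint pairs of indices, so a common bound on them bounds the operator.
  It serves for differences of blocks, which are no longer unitary.\<close>

lemma block_diag_op_bound:
  assumes e: "0 \<le> e" and \<psi>: "\<psi> \<in> ell2"
    and B: "\<And>k a b. (cmod (B k $ 1 $ 1 * a + B k $ 1 $ 2 * b))\<^sup>2 + (cmod (B k $ 2 $ 1 * a + B k $ 2 $ 2 * b))\<^sup>2
      \<le> e\<^sup>2 * ((cmod a)\<^sup>2 + (cmod b)\<^sup>2)"
  shows "block_diag_op s B \<psi> \<in> ell2" "ell2_norm (block_diag_op s B \<psi>) \<le> e * ell2_norm \<psi>"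
proof -
  let ?u = "\<lambda>n. (cmod (\<psi> n))\<^sup>2" and ?v = "\<lambda>n. (cmod (block_diag_op s B \<psi> n))\<^sup>2"
  let ?pu = "\<lambda>k. ?u (2 * k + s) + ?u (2 * k + s + 1)" and ?pv = "\<lambda>k. ?v (2 * k + s) + ?v (2 * k + s + 1)"
  have le: "?pv k \<le> e\<^sup>2 * ?pu k" for k
    unfolding block_diag_op_fst block_diag_op_snd by (rule B)
  obtain c where c: "(?u has_sum c) UNIV" using \<psi> unfolding ell2_def summable_on_def by blast
  then have "(?pu has_sum c) UNIV" by (subst (asm) has_sum_split_int[where s = s]) auto
  then have pu: "((\<lambda>k. e\<^sup>2 * ?pu k) has_sum (e\<^sup>2 * c)) UNIV" by (rule has_sum_cmult_right)
  have "?pv summable_on UNIV"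
    by (rule summable_on_comparison_test[OF has_sum_imp_summable[OF pu]]) (use le in auto)
  then obtain d where d: "(?pv has_sum d) UNIV" unfolding summable_on_def by blast
  have dc: "d \<le> e\<^sup>2 * c" by (rule has_sum_mono[OF d pu]) (use le in auto)
  have v: "(?v has_sum d) UNIV" using d by (subst has_sum_split_int[where s = s]) auto
  show "block_diag_op s B \<psi> \<in> ell2" using has_sum_imp_summable[OF v] by (simp add: ell2_def)
  have "ell2_norm (block_diag_op s B \<psi>) = sqrt d" "ell2_norm \<psi> = sqrt c"
    using infsumI[OF v] infsumI[OF c] by (simp_all add: ell2_norm_def)
  then show "ell2_norm (block_diag_op s B \<psi>) \<le> e * ell2_norm \<psi>"
    using real_sqrt_le_mono[OF dc] e by (simp add: real_sqrt_mult)
qed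

lemma matrix_entries_bound:
  fixes B :: "complex^2^2"
  assumes "norm B \<le> d"
  shows "(cmod (B $ 1 $ 1 * a + B $ 1 $ 2 * b))\<^sup>2 + (cmod (B $ 2 $ 1 * a + B $ 2 $ 2 * b))\<^sup>2
      \<le> (2 * d)\<^sup>2 * ((cmod a)\<^sup>2 + (cmod b)\<^sup>2)"
proof -
  have ent: "cmod (B $ i $ j) \<le> d" for i j
    using order_trans[OF Finite_Cartesian_Product.norm_nth_le[of "B $ i" j] Finite_Cartesian_Product.norm_nth_le[of B i]] assms by simp
  have row: "(cmod (B $ i $ 1 * a + B $ i $ 2 * b))\<^sup>2 \<le> 2 * d\<^sup>2 * ((cmod a)\<^sup>2 + (cmod b)\<^sup>2)" for i
  proof -
    have "cmod (B $ i $ 1 * a + B $ i $ 2 * b) \<le> cmod (B $ i $ 1 * a) + cmod (B $ i $ 2 * b)"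
      by (rule norm_triangle_ineq)
    also have "\<dots> \<le> d * cmod a + d * cmod b"
      using ent by (auto simp: norm_mult intro!: add_mono mult_right_mono)
    finally have "(cmod (B $ i $ 1 * a + B $ i $ 2 * b))\<^sup>2 \<le> (d * cmod a + d * cmod b)\<^sup>2"
      by (rule power_mono) simp
    also have "\<dots> \<le> 2 * (d * cmod a)\<^sup>2 + 2 * (d * cmod b)\<^sup>2"
      using sum_squares_bound[of "d * cmod a" "d * cmod b"] by (simp add: power2_sum)
    finally show ?thesis by (simp add: power_mult_distrib algebra_simps)
  qed
  show ?thesis using add_mono[OF row[of 1] row[of 2]] by (simp add: power_mult_distrib)
qed

lemma block_diag_op_shift:
  "block_diag_op s (\<lambda>k. B (k + j)) \<psi> n = block_diag_op s B (\<lambda>m. \<psi> (m - 2 * j)) (n + 2 * j)"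
proof (cases rule: int_block_cases[of n s])
  case (1 k)
  then have "n + 2 * j = 2 * (k + j) + s" by simp
  then show ?thesis unfolding 1 by (simp only: block_diag_op_fst) (simp add: algebra_simps)
next
  case (2 k)
  then have "n + 2 * j = 2 * (k + j) + s + 1" by simp
  then show ?thesis unfolding 2 by (simp only: block_diag_op_snd) (simp add: algebra_simps)
qed

lemma inv_bound_shift:
  assumes P: "inv_bound K P" and Q: "\<And>\<psi> n. Q \<psi> n = P (\<lambda>m. \<psi> (m - c)) (n + c)"
  shows "inv_bound K Q"
proof -
  have inj: "inj (\<lambda>n::int. n + c)" "inj (\<lambda>n::int. n - c)" by (auto simp: inj_on_def)
  have Q': "Q \<psi> = (\<lambda>n. P (\<lambda>m. \<psi> (m - c)) (n + c))" for \<psi> by (simp add: Q fun_eq_iff)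
  have Qmem: "Q \<psi> \<in> ell2 \<and> ell2_norm \<psi> \<le> K * ell2_norm (Q \<psi>)" if \<psi>: "\<psi> \<in> ell2" for \<psi>
  proof -
    let ?s = "\<lambda>m. \<psi> (m - c)"
    have s: "?s \<in> ell2" by (rule ell2_reindex[OF \<psi> inj(2)])
    then have Ps: "P ?s \<in> ell2" "ell2_norm ?s \<le> K * ell2_norm (P ?s)" using P by (auto simp: inv_bound_def)
    have Qm: "Q \<psi> \<in> ell2" "ell2_norm (Q \<psi>) \<le> ell2_norm (P ?s)"
      unfolding Q' by (rule ell2_reindex[OF Ps(1) inj(1)])+
    \<comment> \<open>\<open>ell2_reindex\<close> gives inequalities only; equality of norms comes
      from shifting there and back.\<close>
    have "ell2_norm (P ?s) = ell2_norm (\<lambda>m. Q \<psi> (m - c))" by (simp add: Q)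
    also have "\<dots> \<le> ell2_norm (Q \<psi>)" by (rule ell2_reindex[OF Qm(1) inj(2)])
    finally have "ell2_norm (Q \<psi>) = ell2_norm (P ?s)" using Qm by simp
    moreover have "ell2_norm \<psi> \<le> ell2_norm ?s" using ell2_reindex(2)[OF s inj(1)] by simp
    ultimately show ?thesis using Qm Ps by simp
  qed
  moreover have "\<exists>\<psi>\<in>ell2. Q \<psi> = h" if h: "h \<in> ell2" for h
  proof -
    have "(\<lambda>m. h (m - c)) \<in> ell2" by (rule ell2_reindex[OF h inj(2)])
    then obtain \<phi> where \<phi>: "\<phi> \<in> ell2" "P \<phi> = (\<lambda>m. h (m - c))" using P by (auto simp: inv_bound_def)
    have "Q (\<lambda>m. \<phi> (m + c)) = h" by (simp add: Q fun_eq_iff \<phi>)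
    then show ?thesis using ell2_reindex(1)[OF \<phi>(1) inj(1)] by blast
  qed
  ultimately show ?thesis unfolding inv_bound_def by blast
qed

section \<open>Integer iterates and the operators over a compact base\<close>

lemma iter_int_succ:
  assumes "bij T" shows "iter_int T (k + 1) x = T (iter_int T k x)"
proof (cases "0 \<le> k")
  case True
  then show ?thesis by (simp add: iter_int_def nat_add_distrib)
next
  case False
  then obtain m where m: "k = - int (Suc m)" by (metis negD not_le)
  have "iter_int T (k + 1) x = (inv T ^^ m) x" by (auto simp: iter_int_def m)
  moreover have "iter_int T k x = inv T ((inv T ^^ m) x)" by (simp add: iter_int_def m nat_add_distrib)
  ultimately show ?thesis using assms by (simp add: bij_is_surj surj_f_inv_f)
qed

lemma iter_int_0 [simp]: "iter_int T 0 x = x"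
  by (simp add: iter_int_def)

lemma iter_int_of_nat: "iter_int T (int n) x = (T ^^ n) x"
  by (simp add: iter_int_def)

lemma iter_int_add:
  assumes "bij T" shows "iter_int T (k + j) x = iter_int T k (iter_int T j x)"
proof (induction k rule: int_induct[where k = 0])
  case (step1 i)
  have "iter_int T (i + 1 + j) x = T (iter_int T (i + j) x)"
    using iter_int_succ[OF assms, of "i + j"] by (simp add: algebra_simps)
  then show ?case using step1 by (simp add: iter_int_succ[OF assms])
next
  case (step2 i)
  have "T (iter_int T (i - 1 + j) x) = iter_int T (i + j) x"
    using iter_int_succ[OF assms, of "i - 1 + j"] by (simp add: algebra_simps)
  also have "\<dots> = T (iter_int T (i - 1) (iter_int T j x))"
    using step2 iter_int_succ[OF assms, of "i - 1" "iter_int T j x"] by simp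
  finally show ?case using assms by (simp add: bij_is_inj inj_eq)
qed simp

lemma iter_int_isometry:
  fixes T :: "'a::metric_space \<Rightarrow> 'a"
  assumes "bij T" "\<And>x y. dist (T x) (T y) = dist x y"
  shows "dist (iter_int T k x) (iter_int T k y) = dist x y"
proof (induction k rule: int_induct[where k = 0])
  case (step1 i)
  then show ?case using assms by (simp add: iter_int_succ)
next
  case (step2 i)
  then show ?case using iter_int_succ[OF assms(1), of "i - 1"] assms(2) by simp
qed simp

locale cmv_family =
  fixes T :: "'a::metric_space \<Rightarrow> 'a" and f g :: "'a \<Rightarrow> complex^2^2"
  assumes compact_space: "compact (UNIV :: 'a set)"
    and bij: "bij T"
    and isom: "\<And>x y. dist (T x) (T y) = dist x y"
    and cont: "continuous_on UNIV f" "continuous_on UNIV g"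
    and iSU2: "\<And>x. f x \<in> iSU2" "\<And>x. g x \<in> iSU2"
begin

abbreviation "pt x k \<equiv> iter_int T k x"
abbreviation "L \<equiv> cmv_L T f"
abbreviation "M \<equiv> cmv_M T g"
abbreviation "E \<equiv> gcmv T f g"

lemma lin_L: "lin_op (L x)" and lin_M: "lin_op (M x)"
  by (simp_all add: cmv_L_def cmv_M_def lin_op_block_diag)

lemma lin_E: "lin_op (E x)"
  by (rule lin_op_gcmv)

lemma unitary: "unitary_mat (f x)" "unitary_mat (g x)"
  using iSU2 by (auto simp: iSU2_def)

lemma L_isometry: "\<psi> \<in> ell2 \<Longrightarrow> L x \<psi> \<in> ell2 \<and> ell2_norm (L x \<psi>) = ell2_norm \<psi>"
  and M_isometry: "\<psi> \<in> ell2 \<Longrightarrow> M x \<psi> \<in> ell2 \<and> ell2_norm (M x \<psi>) = ell2_norm \<psi>"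
  by (simp_all add: cmv_L_def cmv_M_def block_diag_op_isometry unitary)

lemma E_eq: "E x \<psi> = L x (M x \<psi>)"
  by (simp add: gcmv_def)

lemma E_isometry: "\<psi> \<in> ell2 \<Longrightarrow> E x \<psi> \<in> ell2 \<and> ell2_norm (E x \<psi>) = ell2_norm \<psi>"
  using gcmv_isometry[of f g] iSU2 by blast

lemma E_surj: "h \<in> ell2 \<Longrightarrow> \<exists>\<psi>\<in>ell2. E x \<psi> = h"
  unfolding E_eq cmv_L_def cmv_M_def
  using block_diag_op_surj[of "\<lambda>k. f (pt x k)"] block_diag_op_surj[of "\<lambda>k. g (pt x k)"] unitary
  by metis

text \<open>Covariance: moving the base point by \<open>j\<close> steps amounts to conjugation with
  a translation by \<open>2 * j\<close>, a block being two indices long.\<close>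

lemma E_shift: "E (pt x j) \<psi> n = E x (\<lambda>m. \<psi> (m - 2 * j)) (n + 2 * j)"
proof -
  have "M (pt x j) \<psi> = (\<lambda>n. M x (\<lambda>m. \<psi> (m - 2 * j)) (n + 2 * j))"
    unfolding cmv_M_def fun_eq_iff
    using block_diag_op_shift[of "-2" "\<lambda>k. g (pt x k)" j \<psi>] by (simp add: iter_int_add[OF bij])
  moreover have "L (pt x j) \<phi> n = L x (\<lambda>m. \<phi> (m - 2 * j)) (n + 2 * j)" for \<phi>
    unfolding cmv_L_def
    using block_diag_op_shift[of "-1" "\<lambda>k. f (pt x k)" j \<phi>] by (simp add: iter_int_add[OF bij])
  ultimately show ?thesis unfolding E_eq by simp
qed

lemma block_diag_op_uniformly_continuous:
  assumes "continuous_on UNIV F" "e > 0"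
  shows "\<exists>d>0. \<forall>x y \<psi>. dist x y < d \<longrightarrow> \<psi> \<in> ell2 \<longrightarrow>
    (\<lambda>n. block_diag_op s (\<lambda>k. F (pt x k)) \<psi> n - block_diag_op s (\<lambda>k. F (pt y k)) \<psi> n) \<in> ell2 \<and>
    ell2_norm (\<lambda>n. block_diag_op s (\<lambda>k. F (pt x k)) \<psi> n - block_diag_op s (\<lambda>k. F (pt y k)) \<psi> n)
      \<le> e * ell2_norm \<psi>"
proof -
  have "uniformly_continuous_on UNIV F"
    using compact_uniformly_continuous[OF assms(1) compact_space] .
  \<comment> \<open>\<open>e / 2\<close>, because \<open>matrix_entries_bound\<close> loses a factor
    2 between the norm of a block and its action.\<close>
  then obtain d where d: "d > 0" "\<And>x y. dist y x < d \<Longrightarrow> dist (F y) (F x) < e / 2"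
    using assms(2) unfolding uniformly_continuous_on_def by (metis UNIV_I half_gt_zero)
  have "(\<lambda>n. block_diag_op s (\<lambda>k. F (pt x k)) \<psi> n - block_diag_op s (\<lambda>k. F (pt y k)) \<psi> n) \<in> ell2 \<and>
    ell2_norm (\<lambda>n. block_diag_op s (\<lambda>k. F (pt x k)) \<psi> n - block_diag_op s (\<lambda>k. F (pt y k)) \<psi> n)
      \<le> e * ell2_norm \<psi>" if xy: "dist x y < d" and \<psi>: "\<psi> \<in> ell2" for x y \<psi>
  proof -
    define B where "B k = F (pt x k) - F (pt y k)" for k
    have "norm (B k) \<le> e / 2" for k
      using d(2)[of "pt x k" "pt y k"] xy by (simp add: B_def dist_norm[symmetric] iter_int_isometry[OF bij isom])
    note bd = matrix_entries_bound[OF this]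
    have eq: "(\<lambda>n. block_diag_op s (\<lambda>k. F (pt x k)) \<psi> n - block_diag_op s (\<lambda>k. F (pt y k)) \<psi> n) =
        block_diag_op s B \<psi>"
      by (simp add: fun_eq_iff block_diag_op_def Let_def B_def matrix_vector_mult_def sum_2 algebra_simps)
    show ?thesis unfolding eq
      using block_diag_op_bound[OF _ \<psi>, of e B s] bd assms(2) by simp
  qed
  then show ?thesis using d(1) by blast
qed

lemma M_uniformly_continuous:
  assumes "e > 0"
  shows "\<exists>d>0. \<forall>x y \<psi>. dist x y < d \<longrightarrow> \<psi> \<in> ell2 \<longrightarrow>
    (\<lambda>n. M x \<psi> n - M y \<psi> n) \<in> ell2 \<and> ell2_norm (\<lambda>n. M x \<psi> n - M y \<psi> n) \<le> e * ell2_norm \<psi>"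
  unfolding cmv_M_def by (rule block_diag_op_uniformly_continuous[OF cont(2) assms])

lemma L_uniformly_continuous:
  assumes "e > 0"
  shows "\<exists>d>0. \<forall>x y \<psi>. dist x y < d \<longrightarrow> \<psi> \<in> ell2 \<longrightarrow>
    (\<lambda>n. L x \<psi> n - L y \<psi> n) \<in> ell2 \<and> ell2_norm (\<lambda>n. L x \<psi> n - L y \<psi> n) \<le> e * ell2_norm \<psi>"
  unfolding cmv_L_def by (rule block_diag_op_uniformly_continuous[OF cont(1) assms])

lemma E_uniformly_continuous:
  assumes "e > 0"
  shows "\<exists>d>0. \<forall>x y \<psi>. dist x y < d \<longrightarrow> \<psi> \<in> ell2 \<longrightarrow>
    (\<lambda>n. E x \<psi> n - E y \<psi> n) \<in> ell2 \<and> ell2_norm (\<lambda>n. E x \<psi> n - E y \<psi> n) \<le> e * ell2_norm \<psi>"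
proof -
  obtain d1 where d1: "d1 > 0" "\<And>x y \<psi>. dist x y < d1 \<Longrightarrow> \<psi> \<in> ell2 \<Longrightarrow>
      ell2_norm (\<lambda>n. M x \<psi> n - M y \<psi> n) \<le> e / 2 * ell2_norm \<psi>"
    using M_uniformly_continuous[of "e / 2"] assms by auto
  obtain d2 where d2: "d2 > 0" "\<And>x y \<psi>. dist x y < d2 \<Longrightarrow> \<psi> \<in> ell2 \<Longrightarrow>
      ell2_norm (\<lambda>n. L x \<psi> n - L y \<psi> n) \<le> e / 2 * ell2_norm \<psi>"
    using L_uniformly_continuous[of "e / 2"] assms by auto
  have "(\<lambda>n. E x \<psi> n - E y \<psi> n) \<in> ell2 \<and> ell2_norm (\<lambda>n. E x \<psi> n - E y \<psi> n) \<le> e * ell2_norm \<psi>"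
    if xy: "dist x y < min d1 d2" and \<psi>: "\<psi> \<in> ell2" for x y \<psi>
  proof
    show mem: "(\<lambda>n. E x \<psi> n - E y \<psi> n) \<in> ell2" using E_isometry \<psi> by (intro ell2_diff) auto
    \<comment> \<open>\<open>L x (M x) - L y (M y)\<close> is split as
      \<open>L x (M x - M y) + (L x - L y) (M y)\<close>; as \<open>L x\<close> and
      \<open>M y\<close> are isometric, the two errors simply add.\<close>
    let ?a = "L x (\<lambda>n. M x \<psi> n - M y \<psi> n)" and ?b = "\<lambda>n. L x (M y \<psi>) n - L y (M y \<psi>) n"
    have m: "(\<lambda>n. M x \<psi> n - M y \<psi> n) \<in> ell2" "M y \<psi> \<in> ell2"
      using M_isometry[OF \<psi>] by (auto intro!: ell2_diff)
    have "?b \<in> ell2" using L_isometry m by (intro ell2_diff) auto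
    have "(\<lambda>n. E x \<psi> n - E y \<psi> n) = (\<lambda>n. ?a n + ?b n)"
      by (simp add: E_eq lin_op_diff[OF lin_L])
    then have "ell2_norm (\<lambda>n. E x \<psi> n - E y \<psi> n) \<le> ell2_norm ?a + ell2_norm ?b"
      using ell2_add(2)[OF _ \<open>?b \<in> ell2\<close>, of ?a] L_isometry[OF m(1)] by simp
    also have "ell2_norm ?a \<le> e / 2 * ell2_norm \<psi>" using d1(2)[of x y] xy \<psi> L_isometry[OF m(1)] by simp
    also have "ell2_norm ?b \<le> e / 2 * ell2_norm \<psi>" using d2(2)[of x y "M y \<psi>"] xy m M_isometry[OF \<psi>] by simp
    finally show "ell2_norm (\<lambda>n. E x \<psi> n - E y \<psi> n) \<le> e * ell2_norm \<psi>" by simp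
  qed
  then show ?thesis using d1(1) d2(1) by (intro exI[of _ "min d1 d2"]) auto
qed

lemma not_in_spectrum_E_iff:
  "z \<notin> spectrum (E x) \<longleftrightarrow> (\<exists>K. inv_bound K (\<lambda>\<psi> n. E x \<psi> n - z * \<psi> n))"
  using not_in_spectrum_iff[OF lin_E] E_isometry by blast

lemma spectrum_subset_circle: "z \<in> spectrum (E x) \<Longrightarrow> cmod z = 1"
  using isometry_minus_scaled_inv_bound[OF lin_E E_isometry E_surj] not_in_spectrum_E_iff by blast

text \<open>By covariance the bound at \<open>x\<close> holds on the whole orbit of
  \<open>x\<close>. Every \<open>y\<close> is close to that orbit, and a perturbation of size
  \<open>1 / (2 * K)\<close> at most doubles \<open>K\<close>.\<close>

lemma uniform_inv_bound:
  assumes "minimal T" "z \<notin> spectrum (E x)"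
  obtains K where "K > 0" "\<And>y. inv_bound K (\<lambda>\<psi> n. E y \<psi> n - z * \<psi> n)"
proof -
  obtain K0 where "inv_bound K0 (\<lambda>\<psi> n. E x \<psi> n - z * \<psi> n)"
    using assms(2) not_in_spectrum_E_iff by blast
  then obtain K where K: "K > 0" "inv_bound K (\<lambda>\<psi> n. E x \<psi> n - z * \<psi> n)"
    using inv_bound_mono[of K0 _ "max 1 K0"] by (metis less_max_iff_disj max.cobounded2 zero_less_one)
  have orbit: "inv_bound K (\<lambda>\<psi> n. E (pt x j) \<psi> n - z * \<psi> n)" for j
    using inv_bound_shift[OF K(2), of "\<lambda>\<psi> n. E (pt x j) \<psi> n - z * \<psi> n" "2 * j"] by (simp add: E_shift)
  obtain d where d: "d > 0" "\<And>y y' \<psi>. dist y y' < d \<Longrightarrow> \<psi> \<in> ell2 \<Longrightarrow>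
      (\<lambda>n. E y \<psi> n - E y' \<psi> n) \<in> ell2 \<and> ell2_norm (\<lambda>n. E y \<psi> n - E y' \<psi> n) \<le> 1 / (2 * K) * ell2_norm \<psi>"
    using E_uniformly_continuous[of "1 / (2 * K)"] K(1) by auto
  have "inv_bound (2 * K) (\<lambda>\<psi> n. E y \<psi> n - z * \<psi> n)" for y
  proof -
    have "y \<in> closure (range (\<lambda>j. pt x j))" using assms(1) by (simp add: minimal_def)
    then obtain j where "dist (pt x j) y < d" using d(1) by (auto simp: closure_approachable)
    then have "dist y (pt x j) < d" by (simp add: dist_commute)
    then have "inv_bound (K / (1 - K * (1 / (2 * K)))) (\<lambda>\<psi> n. E y \<psi> n - z * \<psi> n)"
      using d(2)[of y "pt x j"] K(1)
      by (intro inv_bound_perturb[OF orbit[of j] lin_op_minus_scaled[OF lin_E] lin_op_minus_scaled[OF lin_E]])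
         auto
    then show ?thesis using K(1) by (simp add: mult.commute)
  qed
  then show ?thesis using that[of "2 * K"] K(1) by simp
qed

end

section \<open>Transfer relations and half-line solutions\<close>

lemma ell2_two_points:
  assumes "\<And>n. n \<noteq> a \<Longrightarrow> n \<noteq> b \<Longrightarrow> h n = 0"
  shows "h \<in> ell2" "ell2_norm h \<le> cmod (h a) + cmod (h b)"
proof -
  have sub: "{n. h n \<noteq> 0} \<subseteq> {a, b}" using assms by blast
  then have fin: "finite {n. h n \<noteq> 0}" using finite_subset by blast
  show "h \<in> ell2" by (rule ell2_finite_support[OF fin])
  have "ell2_norm h \<le> (\<Sum>n | h n \<noteq> 0. cmod (h n))" by (rule ell2_finite_support[OF fin])
  also have "\<dots> \<le> (\<Sum>n\<in>{a, b}. cmod (h n))" using sub by (intro sum_mono2) auto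
  also have "\<dots> \<le> cmod (h a) + cmod (h b)" by (cases "a = b") auto
  finally show "ell2_norm h \<le> cmod (h a) + cmod (h b)" .
qed

lemma norm_complex_2: "(norm (v :: complex^2))\<^sup>2 = (cmod (v $ 1))\<^sup>2 + (cmod (v $ 2))\<^sup>2"
  by (simp add: norm_vec_def L2_set_def sum_2)

lemma norm_complex_2_le: "norm (v :: complex^2) \<le> cmod (v $ 1) + cmod (v $ 2)"
  using L2_set_le_sum_abs[of "\<lambda>i. norm (v $ i)" UNIV]
  by (simp add: norm_vec_def sum_2)

lemma norm_scalar_vec: "norm (c *s (v :: complex^2)) = cmod c * norm v"
proof -
  have "(norm (c *s v))\<^sup>2 = (cmod c * norm v)\<^sup>2"
    by (simp add: norm_complex_2 power_mult_distrib norm_mult algebra_simps)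
  then show ?thesis by simp
qed

lemma topspace_projective_line: "topspace projective_line = complex_lines"
proof -
  have "open {v :: complex^2. v \<noteq> 0 \<and> vec.span {v} \<in> complex_lines}"
  proof -
    have "{v :: complex^2. v \<noteq> 0 \<and> vec.span {v} \<in> complex_lines} = - {0}"
      using span_in_complex_lines by blast
    then show ?thesis by (simp add: open_Compl)
  qed
  then show ?thesis unfolding topspace_def by (auto simp: openin_projective_line)
qed

lemma complex_line_eq_span:
  assumes "l \<in> complex_lines" "v \<in> l" "v \<noteq> 0" shows "l = vec.span {v}"
proof
  have l: "vec.subspace l" "vec.dim l = 1" using assms(1) by (auto simp: complex_lines_def)
  show "l \<subseteq> vec.span {v}"
    by (rule vec.card_ge_dim_independent) (use assms l in auto)
  show "vec.span {v} \<subseteq> l" using l assms by (simp add: vec.span_minimal)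
qed

lemma complex_line_nonzero:
  assumes "l \<in> complex_lines" obtains v where "v \<in> l" "v \<noteq> 0"
proof -
  have "l \<noteq> {0}" using assms by (auto simp: complex_lines_def)
  moreover have "0 \<in> l" using assms by (simp add: complex_lines_def vec.subspace_0)
  ultimately show ?thesis using that by blast
qed

text \<open>An isotropic vector whose first coordinate is 0 vanishes. Clearing the first coordinate
  of a member by means of one fixed nonzero member thus leaves 0, and that one vector spans.\<close>

lemma isotropic_subspace_line:
  fixes S :: "(complex^2) set"
  assumes S: "vec.subspace S" "S \<noteq> {0}" and iso: "\<And>v. v \<in> S \<Longrightarrow> cmod (v $ 1) = cmod (v $ 2)"
  shows "S \<in> complex_lines"
proof -
  obtain e where e: "e \<in> S" "e \<noteq> 0" using S vec.subspace_0 by blast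
  then have e1: "e $ 1 \<noteq> 0" using iso[of e] by (auto simp: vec_eq_iff forall_2)
  have "v \<in> vec.span {e}" if v: "v \<in> S" for v
  proof -
    let ?d = "v - (v $ 1 / e $ 1) *s e"
    have "?d \<in> S" using S(1) e v by (simp add: vec.subspace_diff vec.subspace_scale)
    moreover have "?d $ 1 = 0" using e1 by simp
    ultimately have "?d = 0" using iso[of ?d] by (simp add: vec_eq_iff forall_2)
    then have "v = (v $ 1 / e $ 1) *s e" by simp
    then show ?thesis by (metis vec.span_base vec.span_scale singletonI)
  qed
  moreover have "vec.span {e} \<subseteq> S" using S e by (simp add: vec.span_minimal)
  ultimately have "S = vec.span {e}" by blast
  then show ?thesis using span_in_complex_lines e by simp
qed

text \<open>The lines carry a quotient topology, so a section through a nonzero vector of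
  \<open>F y\<close>, continuous at the single point \<open>y\<close>, pulls an open set of lines
  back to a neighbourhood of \<open>y\<close>. Nearby values stay nonzero because \<open>V\<close>
  is open and omits 0.\<close>

lemma continuous_line_fieldI:
  fixes F :: "'a::t2_space \<Rightarrow> (complex^2) set"
  assumes line: "\<And>y. F y \<in> complex_lines"
    and sel: "\<And>y u. u \<in> F y \<Longrightarrow> \<exists>p. (\<forall>y'. p y' \<in> F y') \<and> p y = u \<and> isCont p y"
  shows "continuous_map euclidean projective_line F"
proof -
  have "open {y. F y \<in> \<U>}" if "openin projective_line \<U>" for \<U>
  proof (subst open_subopen, intro ballI)
    fix y assume y: "y \<in> {y. F y \<in> \<U>}"
    define V where "V = {v. v \<noteq> 0 \<and> vec.span {v} \<in> \<U>}"
    have V: "open V" using that by (simp add: openin_projective_line V_def)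
    obtain u where u: "u \<in> F y" "u \<noteq> 0" using complex_line_nonzero line by blast
    obtain p where p: "\<And>y'. p y' \<in> F y'" "p y = u" "isCont p y" using sel u by blast
    have "p y \<in> V" using u p(2) y complex_line_eq_span[OF line u] by (simp add: V_def)
    then obtain S where S: "open S" "y \<in> S" "\<And>y'. y' \<in> S \<Longrightarrow> p y' \<in> V"
      using p(3) V unfolding continuous_at_open by metis
    have "F y' \<in> \<U>" if "y' \<in> S" for y'
    proof -
      have p0: "p y' \<noteq> 0" and pU: "vec.span {p y'} \<in> \<U>"
        using S(3)[OF that] by (simp_all add: V_def)
      have "F y' = vec.span {p y'}" by (rule complex_line_eq_span[OF line p(1) p0])
      then show ?thesis using pU by (rule ssubst)
    qed
    then have "S \<subseteq> {y. F y \<in> \<U>}" by (simp add: subset_iff)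
    with S(1,2) show "\<exists>S. open S \<and> y \<in> S \<and> S \<subseteq> {y. F y \<in> \<U>}"
      by (intro exI[of _ S] conjI)
  qed
  then show ?thesis using line unfolding continuous_map_def topspace_projective_line by simp
qed

text \<open>Each tail of the sequence is square-summable with a bound proportional to its first term;
  averaging these bounds over the first \<open>n + 1\<close> tails forces decay.\<close>

lemma decay_from_tail_sums:
  fixes w :: "nat \<Rightarrow> real"
  assumes tail: "\<And>i m. (\<Sum>l\<le>m. (w (i + l))\<^sup>2) \<le> C * (w i)\<^sup>2" and C: "0 \<le> C"
  shows "(w n)\<^sup>2 \<le> C\<^sup>2 / real (n + 1) * (w 0)\<^sup>2"
proof -
  have "(w n)\<^sup>2 \<le> C * (w i)\<^sup>2" if "i \<le> n" for i
  proof -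
    have "(w (i + (n - i)))\<^sup>2 \<le> (\<Sum>l\<le>n - i. (w (i + l))\<^sup>2)"
      by (rule member_le_sum) auto
    then show ?thesis using tail[of i "n - i"] that by simp
  qed
  then have "(\<Sum>i\<le>n. (w n)\<^sup>2) \<le> (\<Sum>i\<le>n. C * (w i)\<^sup>2)" by (intro sum_mono) auto
  also have "\<dots> = C * (\<Sum>i\<le>n. (w (0 + i))\<^sup>2)" by (simp add: sum_distrib_left)
  also have "\<dots> \<le> C * (C * (w 0)\<^sup>2)" by (rule mult_left_mono[OF tail C])
  finally have "real (n + 1) * (w n)\<^sup>2 \<le> C\<^sup>2 * (w 0)\<^sup>2" by (simp add: power2_eq_square algebra_simps)
  then show ?thesis by (simp add: field_simps)
qed

locale cmv_energy = cmv_family +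
  fixes z :: complex
  assumes zn: "cmod z = 1"
begin

abbreviation "af y \<equiv> alpha (f y)"
abbreviation "rf y \<equiv> rho (f y)"
abbreviation "ag y \<equiv> alpha (g y)"
abbreviation "rg y \<equiv> rho (g y)"

text \<open>\<open>A\<close> is the transfer matrix freed of its denominator \<open>tr\<close>. As
  \<open>1 / z = cnj z\<close> on the circle, its rows are \<open>(cnj D, W)\<close> and
  \<open>(cnj W, D)\<close>; off the zeros of \<open>tr\<close>, its quotient by \<open>|tr|\<close>
  lies in SU(1,1).\<close>

definition "A y = transfer_f z f y ** transfer_g z g y"
definition "D y = z + cnj (af y) * ag y"
definition "W y = - z * af y - ag y"
definition "tr y = rf y * rg y"

lemma z_cnj: "z * cnj z = 1" "cnj z * z = 1"
  using zn complex_norm_square[of z] by (auto simp: mult.commute)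

lemma z0: "z \<noteq> 0"
  using zn by auto

lemma inverse_z: "1 / z = cnj z"
  using z_cnj z0 by (simp add: field_simps)

lemma f_entries: "f y $ 1 $ 1 = cnj (af y)" "f y $ 1 $ 2 = rf y" "f y $ 2 $ 1 = cnj (rf y)" "f y $ 2 $ 2 = - af y"
  and g_entries: "g y $ 1 $ 1 = cnj (ag y)" "g y $ 1 $ 2 = rg y" "g y $ 2 $ 1 = cnj (rg y)" "g y $ 2 $ 2 = - ag y"
proof -
  have *: "U $ 1 $ 1 = cnj (alpha U)" "U $ 1 $ 2 = rho U" "U $ 2 $ 1 = cnj (rho U)" "U $ 2 $ 2 = - alpha U"
    if "U \<in> iSU2" for U
  proof -
    have eq: "U = vector [vector [cnj (alpha U), rho U], vector [cnj (rho U), - alpha U]]"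
      using that iSU2_iff by blast
    show "U $ 1 $ 1 = cnj (alpha U)" "U $ 2 $ 1 = cnj (rho U)"
      using arg_cong[OF eq, of "\<lambda>V. V $ 1 $ 1"] arg_cong[OF eq, of "\<lambda>V. V $ 2 $ 1"] by simp_all
    show "U $ 1 $ 2 = rho U" "U $ 2 $ 2 = - alpha U" by (simp_all add: rho_def alpha_def)
  qed
  show "f y $ 1 $ 1 = cnj (af y)" "f y $ 1 $ 2 = rf y" "f y $ 2 $ 1 = cnj (rf y)" "f y $ 2 $ 2 = - af y"
    "g y $ 1 $ 1 = cnj (ag y)" "g y $ 1 $ 2 = rg y" "g y $ 2 $ 1 = cnj (rg y)" "g y $ 2 $ 2 = - ag y"
    by (simp_all add: * iSU2)
qed

lemma coeff_norm: "(cmod (af y))\<^sup>2 + (cmod (rf y))\<^sup>2 = 1" "(cmod (ag y))\<^sup>2 + (cmod (rg y))\<^sup>2 = 1"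
  using iSU2[of y] iSU2_iff by blast+

lemma coeff_norm_cnj: "af y * cnj (af y) + rf y * cnj (rf y) = 1" "ag y * cnj (ag y) + rg y * cnj (rg y) = 1"
  using coeff_norm[of y, THEN arg_cong[where f = complex_of_real]]
  unfolding of_real_add complex_norm_square of_real_1 .

lemma coeff_le_1: "cmod (af y) \<le> 1" "cmod (rf y) \<le> 1" "cmod (ag y) \<le> 1" "cmod (rg y) \<le> 1"
proof -
  have "a \<le> 1 \<and> b \<le> 1" if "a\<^sup>2 + b\<^sup>2 = 1" for a b :: real
  proof -
    have "a\<^sup>2 \<le> 1" "b\<^sup>2 \<le> 1" using that zero_le_power2[of a] zero_le_power2[of b] by linarith+
    then show ?thesis by (simp add: abs_square_le_1 abs_le_iff)
  qed
  then show "cmod (af y) \<le> 1" "cmod (rf y) \<le> 1" "cmod (ag y) \<le> 1" "cmod (rg y) \<le> 1"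
    using coeff_norm[of y] by blast+
qed

lemma A_entries: "A y $ 1 $ 1 = cnj (D y)" "A y $ 1 $ 2 = W y" "A y $ 2 $ 1 = cnj (W y)" "A y $ 2 $ 2 = D y"
  by (simp_all add: A_def transfer_f_def transfer_g_def matrix_matrix_mult_def sum_2 inverse_z
      D_def W_def algebra_simps)

lemma A_mult: "(A y *v v) $ 1 = cnj (D y) * v $ 1 + W y * v $ 2" "(A y *v v) $ 2 = cnj (W y) * v $ 1 + D y * v $ 2"
  by (simp_all add: matrix_vector_mult_def sum_2 A_entries)

lemma D_W: "D y * cnj (D y) - W y * cnj (W y) = tr y * cnj (tr y)"
proof -
  \<comment> \<open>Conjugates are renamed as independent variables: modulo the three relations
    \<open>e\<close> the claim is a polynomial identity, within reach of \<open>algebra\<close>. The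
    link lemmas below use the same device.\<close>
  define a b c d a' b' c' d' z' where v: "a = af y" "b = rf y" "c = ag y" "d = rg y"
    "a' = cnj (af y)" "b' = cnj (rf y)" "c' = cnj (ag y)" "d' = cnj (rg y)" "z' = cnj z"
  have e: "z * z' = 1" "a * a' + b * b' = 1" "c * c' + d * d' = 1"
    using z_cnj(1) coeff_norm_cnj[of y] by (simp_all add: v)
  have "(z + a' * c) * (z' + a * c') - (- z * a - c) * (- z' * a' - c') = (b * d) * (b' * d')"
    using e by algebra
  then show ?thesis by (simp add: D_def W_def tr_def v)
qed

text \<open>Here \<open>(a, b, c)\<close> and \<open>(p, q, r)\<close> stand for \<open>\<psi>\<close> and \<open>M \<psi>\<close> at the indices \<open>2k-2, 2k-1, 2k\<close>, and \<open>(h1, h2)\<close> for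
  \<open>(E - z) \<psi>\<close> at \<open>2k-1, 2k\<close>.\<close>

definition link where
  "link y h1 h2 a b c p q r \<longleftrightarrow>
     p = cnj (ag y) * a + rg y * b \<and> q = cnj (rg y) * a - ag y * b \<and>
     z * b + h1 = cnj (af y) * q + rf y * r \<and> z * c + h2 = cnj (rf y) * q - af y * r"

text \<open>Solving for the new pair would divide by \<open>rg y\<close> to get \<open>b\<close> and
  \<open>q\<close>, then by \<open>rf y\<close> to get \<open>c\<close> and \<open>r\<close>.
  Multiplying by these coefficients instead keeps the identities valid where they vanish.\<close>

lemma link_forward:
  assumes "link y h1 h2 a b c p q r"
  shows "tr y * (z * c) = cnj (D y) * (z * a) + W y * p - rg y * (af y * h1 + rf y * h2)"
    "tr y * r = cnj (W y) * (z * a) + D y * p + rg y * h1"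
proof -
  define \<alpha> \<beta> \<gamma> \<delta> \<alpha>' \<beta>' \<gamma>' \<delta>' z' where v: "\<alpha> = af y" "\<beta> = rf y" "\<gamma> = ag y" "\<delta> = rg y"
    "\<alpha>' = cnj (af y)" "\<beta>' = cnj (rf y)" "\<gamma>' = cnj (ag y)" "\<delta>' = cnj (rg y)" "z' = cnj z"
  have e: "z * z' = 1" "\<alpha> * \<alpha>' + \<beta> * \<beta>' = 1" "\<gamma> * \<gamma>' + \<delta> * \<delta>' = 1"
    using z_cnj(1) coeff_norm_cnj[of y] by (simp_all add: v)
  have l: "p = \<gamma>' * a + \<delta> * b" "q = \<delta>' * a - \<gamma> * b" "z * b + h1 = \<alpha>' * q + \<beta> * r"
    "z * c + h2 = \<beta>' * q - \<alpha> * r"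
    using assms by (simp_all add: link_def v)
  have b: "\<delta> * b = p - \<gamma>' * a" using l by simp
  have q: "\<delta> * q = a - \<gamma> * p" using l e by algebra
  have r: "\<beta> * r = z * b + h1 - \<alpha>' * q" using l by simp
  have c: "\<beta> * (z * c) = q - \<alpha> * (z * b) - \<alpha> * h1 - \<beta> * h2" using l e by algebra
  have "\<beta> * \<delta> * (z * c) = \<delta> * q - \<alpha> * z * (\<delta> * b) - \<delta> * (\<alpha> * h1 + \<beta> * h2)"
    using c by algebra
  also have "\<dots> = (z' + \<alpha> * \<gamma>') * (z * a) + (- z * \<alpha> - \<gamma>) * p - \<delta> * (\<alpha> * h1 + \<beta> * h2)"
    unfolding b q using e(1) by algebra
  finally show "tr y * (z * c) = cnj (D y) * (z * a) + W y * p - rg y * (af y * h1 + rf y * h2)"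
    by (simp add: D_def W_def tr_def v)
  have "\<beta> * \<delta> * r = z * (\<delta> * b) + \<delta> * h1 - \<alpha>' * (\<delta> * q)" using r by algebra
  also have "\<dots> = (- z' * \<alpha>' - \<gamma>') * (z * a) + (z + \<alpha>' * \<gamma>) * p + \<delta> * h1"
    unfolding b q using e(1) by algebra
  finally show "tr y * r = cnj (W y) * (z * a) + D y * p + rg y * h1"
    by (simp add: D_def W_def tr_def v)
qed

text \<open>Both blocks preserve norms of pairs: \<open>g\<close> gives
  \<open>|p|^2 + |q|^2 = |a|^2 + |b|^2\<close>, \<open>f\<close> gives
  \<open>|b|^2 + |c|^2 = |q|^2 + |r|^2\<close>, and the middle entries cancel. Arguing with the
  blocks instead of \<open>A\<close> covers \<open>tr y = 0\<close>.\<close>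

lemma link_conserves:
  assumes "link y 0 0 a b c p q r"
  shows "(cmod c)\<^sup>2 - (cmod r)\<^sup>2 = (cmod a)\<^sup>2 - (cmod p)\<^sup>2"
proof -
  have "(cmod p)\<^sup>2 + (cmod q)\<^sup>2 = (cmod a)\<^sup>2 + (cmod b)\<^sup>2"
    using unitary_mat_norm[OF unitary(2), of y a b] assms by (simp add: g_entries link_def)
  moreover have "(cmod (z * b))\<^sup>2 + (cmod (z * c))\<^sup>2 = (cmod q)\<^sup>2 + (cmod r)\<^sup>2"
    using unitary_mat_norm[OF unitary(1), of y q r] assms by (simp add: f_entries link_def)
  ultimately show ?thesis by (simp add: norm_mult zn)
qed

lemma link_scale_add:
  assumes "link y 0 0 a b c p q r" "link y 0 0 a' b' c' p' q' r'"
  shows "link y 0 0 (s * a + t * a') (s * b + t * b') (s * c + t * c')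
    (s * p + t * p') (s * q + t * q') (s * r + t * r')"
  using assms unfolding link_def by (simp only: add_0_right) algebra

text \<open>A pair \<open>(a, p)\<close> need not continue to the right when
  \<open>tr y = 0\<close>, but its multiple by \<open>tr y\<close> does. The middle entries are
  those suggested by the relations for \<open>b\<close> and \<open>q\<close> in the proof of
  \<open>link_forward\<close>, after cancelling \<open>rg y\<close>.\<close>

lemma link_scaled_in:
  fixes a p :: complex and y :: 'a
  defines "v \<equiv> A y *v vector [z * a, p]"
  obtains b q where "link y 0 0 (tr y * a) b (cnj z * v $ 1) (tr y * p) q (v $ 2)"
proof -
  define \<alpha> \<beta> \<gamma> \<delta> \<alpha>' \<beta>' \<gamma>' \<delta>' z' where d: "\<alpha> = af y" "\<beta> = rf y" "\<gamma> = ag y" "\<delta> = rg y"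
    "\<alpha>' = cnj (af y)" "\<beta>' = cnj (rf y)" "\<gamma>' = cnj (ag y)" "\<delta>' = cnj (rg y)" "z' = cnj z"
  have e: "z * z' = 1" "\<alpha> * \<alpha>' + \<beta> * \<beta>' = 1" "\<gamma> * \<gamma>' + \<delta> * \<delta>' = 1"
    using z_cnj(1) coeff_norm_cnj[of y] by (simp_all add: d)
  have v1: "v $ 1 = (z' + \<alpha> * \<gamma>') * (z * a) + (- z * \<alpha> - \<gamma>) * p"
    and v2: "v $ 2 = (- z' * \<alpha>' - \<gamma>') * (z * a) + (z + \<alpha>' * \<gamma>) * p"
    by (simp_all add: v_def A_mult D_def W_def d)
  have "\<beta> * \<delta> * p = \<gamma>' * (\<beta> * \<delta> * a) + \<delta> * (\<beta> * (p - \<gamma>' * a))"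
    by algebra
  moreover have "\<beta> * (a - \<gamma> * p) = \<delta>' * (\<beta> * \<delta> * a) - \<gamma> * (\<beta> * (p - \<gamma>' * a))"
    using e(3) by algebra
  moreover have "z * (\<beta> * (p - \<gamma>' * a)) = \<alpha>' * (\<beta> * (a - \<gamma> * p)) + \<beta> * v $ 2"
    unfolding v2 using e(1) by algebra
  moreover have "z * (z' * v $ 1) = \<beta>' * (\<beta> * (a - \<gamma> * p)) - \<alpha> * v $ 2"
    unfolding v1 v2 using e by algebra
  ultimately have "link y 0 0 (tr y * a) (\<beta> * (p - \<gamma>' * a)) (cnj z * v $ 1) (tr y * p) (\<beta> * (a - \<gamma> * p)) (v $ 2)"
    by (simp add: link_def tr_def d)
  then show ?thesis using that by blast
qed

text \<open>A kernel vector of \<open>A\<close> continues to the right by zero, which will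
  contradict the transversality of the two boundary lines. The middle entry is read off from
  \<open>D b = cnj af * cnj rg * a\<close>, which every such link satisfies.\<close>

lemma link_annihilated_in:
  assumes D: "D y \<noteq> 0" and ker: "A y *v vector [z * a, p] = 0"
  obtains b q where "link y 0 0 a b 0 p q 0"
proof -
  define \<alpha> \<beta> \<gamma> \<delta> \<alpha>' \<beta>' \<gamma>' \<delta>' z' where d: "\<alpha> = af y" "\<beta> = rf y" "\<gamma> = ag y" "\<delta> = rg y"
    "\<alpha>' = cnj (af y)" "\<beta>' = cnj (rf y)" "\<gamma>' = cnj (ag y)" "\<delta>' = cnj (rg y)" "z' = cnj z"
  have e: "z * z' = 1" "\<alpha> * \<alpha>' + \<beta> * \<beta>' = 1" "\<gamma> * \<gamma>' + \<delta> * \<delta>' = 1"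
    using z_cnj(1) coeff_norm_cnj[of y] by (simp_all add: d)
  have k1: "cnj (D y) * (z * a) + W y * p = 0" and k2: "cnj (W y) * (z * a) + D y * p = 0"
    using ker A_mult[of y "vector [z * a, p]"] by (simp_all add: vec_eq_iff forall_2)
  \<comment> \<open>The adjugate of \<open>A\<close>, applied to the kernel equation, isolates the
    first coordinate.\<close>
  have "(tr y * cnj (tr y)) * (z * a) = D y * (cnj (D y) * (z * a) + W y * p) - W y * (cnj (W y) * (z * a) + D y * p)"
    unfolding D_W[symmetric] by (simp add: algebra_simps)
  then have "tr y = 0 \<or> a = 0" using k1 k2 z0 by simp
  then have ra: "\<beta>' * \<delta>' * a = 0" by (auto simp: tr_def d)
  define b where "b = \<alpha>' * \<delta>' * a / D y"
  have Dd: "D y = z + \<alpha>' * \<gamma>" by (simp add: D_def d)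
  have b: "(z + \<alpha>' * \<gamma>) * b = \<alpha>' * \<delta>' * a" using D by (simp add: b_def Dd)
  have k2': "(- z' * \<alpha>' - \<gamma>') * (z * a) + (z + \<alpha>' * \<gamma>) * p = 0" using k2 by (simp add: D_def W_def d)
  have "(z + \<alpha>' * \<gamma>) * p = (z + \<alpha>' * \<gamma>) * (\<gamma>' * a + \<delta> * b)"
    using b k2' e by algebra
  then have p: "p = \<gamma>' * a + \<delta> * b" using D Dd by simp
  have "(z + \<alpha>' * \<gamma>) * (\<beta>' * (\<delta>' * a - \<gamma> * b)) = z * (\<beta>' * \<delta>' * a)" using b by algebra
  then have "\<beta>' * (\<delta>' * a - \<gamma> * b) = 0" using D Dd ra by simp
  moreover have "z * b = \<alpha>' * (\<delta>' * a - \<gamma> * b)" using b by algebra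
  ultimately have "link y 0 0 a b 0 p (\<delta>' * a - \<gamma> * b) 0"
    using p by (simp add: link_def d)
  then show ?thesis using that by blast
qed

text \<open>\<open>D = 0\<close> needs \<open>|af| * |ag| = 1\<close>, and both factors are at most
  1.\<close>

lemma D_zero:
  assumes "D y = 0" shows "rf y = 0" "rg y = 0"
proof -
  have "z = - (cnj (af y) * ag y)" using assms by (simp add: D_def add_eq_0_iff)
  then have "cmod (af y) * cmod (ag y) = 1" using zn by (simp add: norm_mult)
  then have "cmod (af y) = 1" "cmod (ag y) = 1"
    using coeff_le_1[of y] by (smt (verit) mult_left_le mult_left_le_one_le norm_ge_zero)+
  then show "rf y = 0" "rg y = 0" using coeff_norm[of y] by auto
qed

section \<open>The eigenvalue equation as a chain of links; half-line solutions\<close>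

lemma M_even: "M x \<psi> (2 * k - 2) = cnj (ag (pt x k)) * \<psi> (2 * k - 2) + rg (pt x k) * \<psi> (2 * k - 1)"
  and M_odd: "M x \<psi> (2 * k - 1) = cnj (rg (pt x k)) * \<psi> (2 * k - 2) - ag (pt x k) * \<psi> (2 * k - 1)"
  using block_diag_op_fst[of "-2" "\<lambda>k. g (pt x k)" \<psi> k] block_diag_op_snd[of "-2" "\<lambda>k. g (pt x k)" \<psi> k]
  by (simp_all add: cmv_M_def g_entries)

lemma L_odd: "L x \<phi> (2 * k - 1) = cnj (af (pt x k)) * \<phi> (2 * k - 1) + rf (pt x k) * \<phi> (2 * k)"
  and L_even: "L x \<phi> (2 * k) = cnj (rf (pt x k)) * \<phi> (2 * k - 1) - af (pt x k) * \<phi> (2 * k)"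
  using block_diag_op_fst[of "-1" "\<lambda>k. f (pt x k)" \<phi> k] block_diag_op_snd[of "-1" "\<lambda>k. f (pt x k)" \<phi> k]
  by (simp_all add: cmv_L_def f_entries)

lemma link_at:
  "link (pt x k) (E x \<psi> (2 * k - 1) - z * \<psi> (2 * k - 1)) (E x \<psi> (2 * k) - z * \<psi> (2 * k))
    (\<psi> (2 * k - 2)) (\<psi> (2 * k - 1)) (\<psi> (2 * k)) (M x \<psi> (2 * k - 2)) (M x \<psi> (2 * k - 1)) (M x \<psi> (2 * k))"
  unfolding link_def E_eq by (simp add: L_odd L_even M_odd[symmetric] M_even[symmetric])

definition solves where
  "solves x k \<psi> \<phi> \<longleftrightarrow> link (pt x k) 0 0
    (\<psi> (2 * k - 2)) (\<psi> (2 * k - 1)) (\<psi> (2 * k)) (\<phi> (2 * k - 2)) (\<phi> (2 * k - 1)) (\<phi> (2 * k))"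

lemma M_eqI:
  assumes "\<And>k. \<phi> (2 * k - 2) = cnj (ag (pt x k)) * \<psi> (2 * k - 2) + rg (pt x k) * \<psi> (2 * k - 1)"
    "\<And>k. \<phi> (2 * k - 1) = cnj (rg (pt x k)) * \<psi> (2 * k - 2) - ag (pt x k) * \<psi> (2 * k - 1)"
  shows "M x \<psi> = \<phi>"
proof
  fix n show "M x \<psi> n = \<phi> n"
  proof (cases rule: int_block_cases[of n "-2"])
    case (1 k) then show ?thesis using assms(1)[of k] M_even[of x \<psi> k] by simp
  next
    case (2 k) then show ?thesis using assms(2)[of k] M_odd[of x \<psi> k] by simp
  qed
qed

lemma solves_everywhere:
  assumes "\<And>k. solves x k \<psi> \<phi>"
  shows "\<phi> = M x \<psi>" "(\<lambda>n. E x \<psi> n - z * \<psi> n) = (\<lambda>n. 0)"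
proof -
  have M: "M x \<psi> = \<phi>" using assms by (intro M_eqI) (auto simp: solves_def link_def)
  then show "\<phi> = M x \<psi>" by simp
  show "(\<lambda>n. E x \<psi> n - z * \<psi> n) = (\<lambda>n. 0)"
  proof
    fix n show "E x \<psi> n - z * \<psi> n = 0"
    proof (cases rule: int_block_cases[of n "-1"])
      case (1 k) then show ?thesis using assms[of k] by (simp add: E_eq M L_odd solves_def link_def)
    next
      case (2 k) then show ?thesis using assms[of k] by (simp add: E_eq M L_even solves_def link_def)
    qed
  qed
qed

text \<open>Solutions on a half line are whole sequences constrained by the links of that half only.
  Link \<open>j\<close> involves the indices from \<open>2 * j - 2\<close> to \<open>2 * j\<close>,
  so left and right solutions at \<open>k\<close> meet in the index \<open>2 * k\<close> alone.
  \<open>\<phi>\<close> is kept separate because at \<open>2 * k\<close> a left solution need not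
  satisfy \<open>\<phi> = M x \<psi>\<close>.\<close>

definition right_sol where
  "right_sol x k \<psi> \<phi> \<longleftrightarrow> \<psi> \<in> ell2 \<and> \<phi> \<in> ell2 \<and> (\<forall>j>k. solves x j \<psi> \<phi>)"

definition left_sol where
  "left_sol x k \<psi> \<phi> \<longleftrightarrow> \<psi> \<in> ell2 \<and> \<phi> \<in> ell2 \<and> (\<forall>j\<le>k. solves x j \<psi> \<phi>)"

definition vt :: "(int \<Rightarrow> complex) \<Rightarrow> (int \<Rightarrow> complex) \<Rightarrow> int \<Rightarrow> complex^2" where
  "vt \<psi> \<phi> k = vector [z * \<psi> (2 * k), \<phi> (2 * k)]"

lemma vt_nth [simp]: "vt \<psi> \<phi> k $ 1 = z * \<psi> (2 * k)" "vt \<psi> \<phi> k $ 2 = \<phi> (2 * k)"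
  by (simp_all add: vt_def)

lemma norm_vt: "(norm (vt \<psi> \<phi> k))\<^sup>2 = (cmod (\<psi> (2 * k)))\<^sup>2 + (cmod (\<phi> (2 * k)))\<^sup>2"
  by (simp add: norm_complex_2 norm_mult zn)

lemma cmod_le_norm_vt: "cmod (\<psi> (2 * k)) \<le> norm (vt \<psi> \<phi> k)" "cmod (\<phi> (2 * k)) \<le> norm (vt \<psi> \<phi> k)"
  using Finite_Cartesian_Product.norm_nth_le[of "vt \<psi> \<phi> k" 1] Finite_Cartesian_Product.norm_nth_le[of "vt \<psi> \<phi> k" 2]
  by (simp_all add: norm_mult zn)

lemma solves_forward: "solves x k \<psi> \<phi> \<Longrightarrow> A (pt x k) *v vt \<psi> \<phi> (k - 1) = tr (pt x k) *s vt \<psi> \<phi> k"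
  using link_forward[of "pt x k" 0 0 "\<psi> (2 * k - 2)" "\<psi> (2 * k - 1)" "\<psi> (2 * k)" "\<phi> (2 * k - 2)"]
  by (simp add: vec_eq_iff forall_2 A_mult solves_def)

lemma solves_conserves:
  assumes "solves x k \<psi> \<phi>"
  shows "(cmod (\<psi> (2 * k)))\<^sup>2 - (cmod (\<phi> (2 * k)))\<^sup>2 =
    (cmod (\<psi> (2 * (k - 1))))\<^sup>2 - (cmod (\<phi> (2 * (k - 1))))\<^sup>2"
  using link_conserves[of "pt x k"] assms by (simp add: solves_def)

text \<open>These are subspaces of the fibre over \<open>T\<^sup>k\<^sup>+\<^sup>1 x\<close>; the splitting at \<open>x\<close> is therefore the one for \<open>k = -1\<close>.\<close>

definition EM where "EM x k = {vt \<psi> \<phi> k | \<psi> \<phi>. right_sol x k \<psi> \<phi>}"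
definition EP where "EP x k = {vt \<psi> \<phi> k | \<psi> \<phi>. left_sol x k \<psi> \<phi>}"

lemma solves_comb:
  assumes "solves x k \<psi> \<phi>" "solves x k \<psi>' \<phi>'"
  shows "solves x k (\<lambda>n. s * \<psi> n + t * \<psi>' n) (\<lambda>n. s * \<phi> n + t * \<phi>' n)"
  using assms link_scale_add unfolding solves_def by blast

lemma vt_comb: "vt (\<lambda>n. s * \<psi> n + t * \<psi>' n) (\<lambda>n. s * \<phi> n + t * \<phi>' n) k = s *s vt \<psi> \<phi> k + t *s vt \<psi>' \<phi>' k"
  by (simp add: vec_eq_iff forall_2 algebra_simps)

lemma ell2_comb: "\<phi> \<in> ell2 \<Longrightarrow> \<psi> \<in> ell2 \<Longrightarrow> (\<lambda>n. s * \<phi> n + t * \<psi> n) \<in> ell2"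
  by (intro ell2_add ell2_scale)

lemma subspace_closedI:
  fixes S :: "(complex^2) set"
  assumes "S \<noteq> {}" "\<And>u v s t. u \<in> S \<Longrightarrow> v \<in> S \<Longrightarrow> s *s u + t *s v \<in> S"
  shows "vec.subspace S"
proof -
  obtain u where u: "u \<in> S" using assms(1) by blast
  show ?thesis
    using assms(2)[OF u u, of 0 0] assms(2)[of _ _ 1 1] assms(2)[of _ _ _ 0]
    by (auto simp: vec.subspace_def)
qed

lemma solves_zero: "solves x k (\<lambda>n. 0) (\<lambda>n. 0)"
  by (simp add: solves_def link_def)

lemma subspace_EM: "vec.subspace (EM x k)"
proof (rule subspace_closedI)
  have "right_sol x k (\<lambda>n. 0) (\<lambda>n. 0)" by (simp add: right_sol_def solves_zero)
  then show "EM x k \<noteq> {}" by (auto simp: EM_def)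
  fix u v s t assume "u \<in> EM x k" "v \<in> EM x k"
  then obtain \<psi> \<phi> \<psi>' \<phi>' where *: "u = vt \<psi> \<phi> k" "right_sol x k \<psi> \<phi>" "v = vt \<psi>' \<phi>' k" "right_sol x k \<psi>' \<phi>'"
    unfolding EM_def by blast
  then have "right_sol x k (\<lambda>n. s * \<psi> n + t * \<psi>' n) (\<lambda>n. s * \<phi> n + t * \<phi>' n)"
    by (simp add: right_sol_def ell2_comb solves_comb)
  then have "vt (\<lambda>n. s * \<psi> n + t * \<psi>' n) (\<lambda>n. s * \<phi> n + t * \<phi>' n) k \<in> EM x k" unfolding EM_def by blast
  then show "s *s u + t *s v \<in> EM x k" unfolding vt_comb * .
qed

lemma subspace_EP: "vec.subspace (EP x k)"
proof (rule subspace_closedI)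
  have "left_sol x k (\<lambda>n. 0) (\<lambda>n. 0)" by (simp add: left_sol_def solves_zero)
  then show "EP x k \<noteq> {}" by (auto simp: EP_def)
  fix u v s t assume "u \<in> EP x k" "v \<in> EP x k"
  then obtain \<psi> \<phi> \<psi>' \<phi>' where *: "u = vt \<psi> \<phi> k" "left_sol x k \<psi> \<phi>" "v = vt \<psi>' \<phi>' k" "left_sol x k \<psi>' \<phi>'"
    unfolding EP_def by blast
  then have "left_sol x k (\<lambda>n. s * \<psi> n + t * \<psi>' n) (\<lambda>n. s * \<phi> n + t * \<phi>' n)"
    by (simp add: left_sol_def ell2_comb solves_comb)
  then have "vt (\<lambda>n. s * \<psi> n + t * \<psi>' n) (\<lambda>n. s * \<phi> n + t * \<phi>' n) k \<in> EP x k" unfolding EP_def by blast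
  then show "s *s u + t *s v \<in> EP x k" unfolding vt_comb * .
qed

lemma solves_shift:
  "solves (pt x j) k \<psi> \<phi> \<longleftrightarrow> solves x (k + j) (\<lambda>n. \<psi> (n - 2 * j)) (\<lambda>n. \<phi> (n - 2 * j))"
proof -
  have "2 * (k + j) - 2 - 2 * j = 2 * k - 2" "2 * (k + j) - 1 - 2 * j = 2 * k - 1" "2 * (k + j) - 2 * j = 2 * k"
    by simp_all
  then show ?thesis by (simp only: solves_def iter_int_add[OF bij])
qed

lemma ell2_shift_iff: "(\<lambda>n. \<psi> (n - c)) \<in> ell2 \<longleftrightarrow> \<psi> \<in> ell2"
proof -
  have "inj (\<lambda>n::int. n + c)" "inj (\<lambda>n::int. n - c)" by (auto simp: inj_on_def)
  then show ?thesis
    using ell2_reindex(1)[of \<psi> "\<lambda>n. n - c"] ell2_reindex(1)[of "\<lambda>n. \<psi> (n - c)" "\<lambda>n. n + c"] by auto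
qed

lemma right_sol_shift: "right_sol (pt x j) k \<psi> \<phi> \<longleftrightarrow> right_sol x (k + j) (\<lambda>n. \<psi> (n - 2 * j)) (\<lambda>n. \<phi> (n - 2 * j))"
proof -
  have *: "(\<forall>i>k. P (i + j)) \<longleftrightarrow> (\<forall>i>k + j. P i)" for P :: "int \<Rightarrow> bool"
    by (metis add_less_cancel_right diff_add_cancel)
  show ?thesis unfolding right_sol_def solves_shift ell2_shift_iff
    using *[of "\<lambda>i. solves x i (\<lambda>n. \<psi> (n - 2 * j)) (\<lambda>n. \<phi> (n - 2 * j))"] by simp
qed

lemma left_sol_shift: "left_sol (pt x j) k \<psi> \<phi> \<longleftrightarrow> left_sol x (k + j) (\<lambda>n. \<psi> (n - 2 * j)) (\<lambda>n. \<phi> (n - 2 * j))"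
proof -
  have *: "(\<forall>i\<le>k. P (i + j)) \<longleftrightarrow> (\<forall>i\<le>k + j. P i)" for P :: "int \<Rightarrow> bool"
    by (metis add_le_cancel_right diff_add_cancel)
  show ?thesis unfolding left_sol_def solves_shift ell2_shift_iff
    using *[of "\<lambda>i. solves x i (\<lambda>n. \<psi> (n - 2 * j)) (\<lambda>n. \<phi> (n - 2 * j))"] by simp
qed

lemma vt_shift: "vt (\<lambda>n. \<psi> (n - 2 * j)) (\<lambda>n. \<phi> (n - 2 * j)) (k + j) = vt \<psi> \<phi> k"
  by (simp add: vt_def algebra_simps)

lemma EM_shift: "EM (pt x j) k = EM x (k + j)"
proof -
  have *: "EM (pt x j) k \<subseteq> EM x (k + j)" for x j k
  proof -
    have "v \<in> EM x (k + j)" if "v \<in> EM (pt x j) k" for v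
    proof -
    from that obtain \<psi> \<phi> where *: "v = vt \<psi> \<phi> k" "right_sol (pt x j) k \<psi> \<phi>" unfolding EM_def by blast
    have "vt (\<lambda>n. \<psi> (n - 2 * j)) (\<lambda>n. \<phi> (n - 2 * j)) (k + j) \<in> EM x (k + j)"
      using *(2) unfolding EM_def right_sol_shift by blast
    then show ?thesis unfolding vt_shift * .
    qed
    then show ?thesis by blast
  qed
  have "EM x (k + j) = EM (pt (pt x j) (- j)) (k + j)"
    by (simp add: iter_int_add[OF bij, symmetric])
  also have "\<dots> \<subseteq> EM (pt x j) (k + j + - j)" by (rule *)
  finally show ?thesis using *[of j x k] by simp
qed

lemma EP_shift: "EP (pt x j) k = EP x (k + j)"
proof -
  have *: "EP (pt x j) k \<subseteq> EP x (k + j)" for x j k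
  proof -
    have "v \<in> EP x (k + j)" if "v \<in> EP (pt x j) k" for v
    proof -
    from that obtain \<psi> \<phi> where *: "v = vt \<psi> \<phi> k" "left_sol (pt x j) k \<psi> \<phi>" unfolding EP_def by blast
    have "vt (\<lambda>n. \<psi> (n - 2 * j)) (\<lambda>n. \<phi> (n - 2 * j)) (k + j) \<in> EP x (k + j)"
      using *(2) unfolding EP_def left_sol_shift by blast
    then show ?thesis unfolding vt_shift * .
    qed
    then show ?thesis by blast
  qed
  have "EP x (k + j) = EP (pt (pt x j) (- j)) (k + j)"
    by (simp add: iter_int_add[OF bij, symmetric])
  also have "\<dots> \<subseteq> EP (pt x j) (k + j + - j)" by (rule *)
  finally show ?thesis using *[of j x k] by simp
qed

end

section \<open>From the resolvent to a dominated splitting\<close>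

locale cmv_resolvent = cmv_energy +
  fixes K :: real
  assumes K: "K > 0" and inv: "\<And>y. inv_bound K (\<lambda>\<psi> n. E y \<psi> n - z * \<psi> n)"
begin

lemma below: "\<psi> \<in> ell2 \<Longrightarrow> ell2_norm \<psi> \<le> K * ell2_norm (\<lambda>n. E y \<psi> n - z * \<psi> n)"
  using inv by (simp add: inv_bound_def)

lemma no_global_solution:
  assumes "\<psi> \<in> ell2" "\<And>k. solves x k \<psi> \<phi>"
  shows "\<psi> = (\<lambda>n. 0)" "\<phi> = (\<lambda>n. 0)"
proof -
  have "(\<lambda>n. E x \<psi> n - z * \<psi> n) = (\<lambda>n. 0)" "\<phi> = M x \<psi>"
    using solves_everywhere assms(2) by blast+
  then have "ell2_norm \<psi> \<le> 0" using below[OF assms(1), of x] by simp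
  then show "\<psi> = (\<lambda>n. 0)" using ell2_norm_eq_0 assms(1) by (simp add: order_antisym)
  then show "\<phi> = (\<lambda>n. 0)" using \<open>\<phi> = M x \<psi>\<close> lin_op_zero[OF lin_M] by simp
qed

text \<open>If \<open>D y = 0\<close>, then \<open>f y\<close> and \<open>g y\<close> are diagonal,
  the index \<open>-1\<close> decouples, and the unit vector there is an eigenvector of
  \<open>E y\<close> for \<open>z\<close>.\<close>

lemma D_nonzero: "D y \<noteq> 0"
proof
  assume D0: "D y = 0"
  define \<psi> where "\<psi> = (\<lambda>n::int. if n = -1 then 1 else 0 :: complex)"
  define \<phi> where "\<phi> = (\<lambda>n::int. if n = -1 then - ag y else 0)"
  have "solves y k \<psi> \<phi>" for k
  proof -
    have "2 * k - 1 = -1 \<longleftrightarrow> k = 0" "2 * k \<noteq> -1" "2 * k - 2 \<noteq> -1" by presburger+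
    then show ?thesis using D0 D_zero[OF D0]
      by (cases "k = 0") (auto simp: solves_def link_def \<psi>_def \<phi>_def D_def add_eq_0_iff)
  qed
  moreover have "\<psi> \<in> ell2" by (rule ell2_two_points[of "-1" "-1"]) (simp add: \<psi>_def)
  ultimately have "\<psi> = (\<lambda>n. 0)" by (rule no_global_solution(1)[rotated])
  from fun_cong[OF this, of "-1"] show False by (simp add: \<psi>_def)
qed

lemma EP_EM_inter: "EP x k \<inter> EM x k = {0}"
proof -
  have "v = 0" if vP: "v \<in> EP x k" and vM: "v \<in> EM x k" for v
  proof -
    obtain \<psi> \<phi> where 1: "v = vt \<psi> \<phi> k" "left_sol x k \<psi> \<phi>" using vP unfolding EP_def by blast
    obtain \<psi>' \<phi>' where 2: "v = vt \<psi>' \<phi>' k" "right_sol x k \<psi>' \<phi>'" using vM unfolding EM_def by blast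
    have eq: "\<psi> (2 * k) = \<psi>' (2 * k)" "\<phi> (2 * k) = \<phi>' (2 * k)"
      using 1(1) 2(1) z0 by (auto simp: vt_def vec_eq_iff forall_2)
    \<comment> \<open>The two solutions agree at the one index they share, so their splice satisfies
      every link; by invertibility it is 0.\<close>
    define \<psi>0 where "\<psi>0 n = (if n \<le> 2 * k then \<psi> n else \<psi>' n)" for n
    define \<phi>0 where "\<phi>0 n = (if n \<le> 2 * k then \<phi> n else \<phi>' n)" for n
    have "solves x j \<psi>0 \<phi>0" for j
    proof (cases "j \<le> k")
      case True
      then show ?thesis using 1(2) by (simp add: left_sol_def solves_def \<psi>0_def \<phi>0_def)
    next
      case False
      then have "\<psi>0 n = \<psi>' n" "\<phi>0 n = \<phi>' n" if "n \<in> {2 * j - 2, 2 * j - 1, 2 * j}" for n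
        using that eq by (cases "n = 2 * k"; force simp: \<psi>0_def \<phi>0_def)+
      then show ?thesis using 2(2) False by (simp add: right_sol_def solves_def)
    qed
    moreover have "\<psi>0 \<in> ell2"
      by (rule ell2_dominated2[of \<psi> \<psi>']) (use 1 2 in \<open>auto simp: left_sol_def right_sol_def \<psi>0_def\<close>)
    ultimately have "\<psi>0 = (\<lambda>n. 0)" "\<phi>0 = (\<lambda>n. 0)" using no_global_solution by blast+
    then have "\<psi>0 (2 * k) = 0" "\<phi>0 (2 * k) = 0" by simp_all
    then show "v = 0" unfolding 1(1) by (simp add: \<psi>0_def \<phi>0_def vec_eq_iff forall_2)
  qed
  then show ?thesis using vec.subspace_0 subspace_EM subspace_EP by blast
qed

text \<open>A half-line solution cut at \<open>2 * k\<close> fails the equation at two neighbouring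
  sites only, with errors controlled by the boundary vector. Invertibility then bounds the entire
  sequence by that vector.\<close>

lemma truncation_bound:
  assumes \<psi>: "\<psi> \<in> ell2"
    and h: "\<And>n. n \<noteq> 2 * k - 1 \<Longrightarrow> n \<noteq> 2 * k \<Longrightarrow> E x \<psi> n - z * \<psi> n = 0"
      "cmod (E x \<psi> (2 * k - 1) - z * \<psi> (2 * k - 1)) \<le> B"
      "cmod (E x \<psi> (2 * k) - z * \<psi> (2 * k)) \<le> 2 * B"
  shows "ell2_norm \<psi> \<le> 3 * K * B"
proof -
  have "ell2_norm (\<lambda>n. E x \<psi> n - z * \<psi> n) \<le> 3 * B"
    using ell2_two_points(2)[of "2 * k - 1" "2 * k" "\<lambda>n. E x \<psi> n - z * \<psi> n"] h by simp
  then have "K * ell2_norm (\<lambda>n. E x \<psi> n - z * \<psi> n) \<le> K * (3 * B)"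
    using K by (intro mult_left_mono) auto
  then show ?thesis using below[OF \<psi>, of x] by simp
qed

text \<open>The cut lies between two blocks of \<open>M\<close> and splits only the block of
  \<open>L\<close> on \<open>{2 * k - 1, 2 * k}\<close>; hence \<open>M\<close> respects the cut and
  the errors sit in that block.\<close>

lemma right_truncation:
  assumes "right_sol x k \<psi> \<phi>"
  defines "\<psi>' \<equiv> \<lambda>n. if n < 2 * k then 0 else \<psi> n"
  shows "\<psi>' \<in> ell2" "M x \<psi>' = (\<lambda>n. if n < 2 * k then 0 else \<phi> n)"
    "ell2_norm \<psi>' \<le> 3 * K * norm (vt \<psi> \<phi> k)"
proof -
  have sol: "solves x j \<psi> \<phi>" if "j > k" for j using assms that by (simp add: right_sol_def)
  show mem: "\<psi>' \<in> ell2"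
    by (rule ell2_dominated[of \<psi>]) (use assms in \<open>auto simp: right_sol_def\<close>)
  show M: "M x \<psi>' = (\<lambda>n. if n < 2 * k then 0 else \<phi> n)"
  proof (rule M_eqI)
    fix j
    show "(if 2 * j - 2 < 2 * k then 0 else \<phi> (2 * j - 2)) =
        cnj (ag (pt x j)) * \<psi>' (2 * j - 2) + rg (pt x j) * \<psi>' (2 * j - 1)"
      "(if 2 * j - 1 < 2 * k then 0 else \<phi> (2 * j - 1)) =
        cnj (rg (pt x j)) * \<psi>' (2 * j - 2) - ag (pt x j) * \<psi>' (2 * j - 1)"
      using sol[of j] by (cases "j > k"; auto simp: \<psi>'_def solves_def link_def)+
  qed
  have h_odd: "E x \<psi>' (2 * j - 1) - z * \<psi>' (2 * j - 1) = (if j = k then rf (pt x k) * \<phi> (2 * k) else 0)" for j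
    unfolding E_eq M L_odd
    using sol[of j] by (cases "j > k"; cases "j = k") (auto simp: \<psi>'_def solves_def link_def)
  have h_even: "E x \<psi>' (2 * j) - z * \<psi>' (2 * j) = (if j = k then - af (pt x k) * \<phi> (2 * k) - z * \<psi> (2 * k) else 0)" for j
    unfolding E_eq M L_even
    using sol[of j] by (cases "j > k"; cases "j = k") (auto simp: \<psi>'_def solves_def link_def)
  show "ell2_norm \<psi>' \<le> 3 * K * norm (vt \<psi> \<phi> k)"
  proof (rule truncation_bound[OF mem, where x = x and k = k])
    fix n assume n: "n \<noteq> 2 * k - 1" "n \<noteq> 2 * k"
    show "E x \<psi>' n - z * \<psi>' n = 0"
    proof (cases rule: int_block_cases[of n "-1"])
      case (1 j)
      then have "n = 2 * j - 1" "j \<noteq> k" using n by auto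
      then show ?thesis using h_odd[of j] by simp
    next
      case (2 j)
      then have "n = 2 * j" "j \<noteq> k" using n by auto
      then show ?thesis using h_even[of j] by simp
    qed
  next
    have "cmod (rf (pt x k)) * cmod (\<phi> (2 * k)) \<le> 1 * norm (vt \<psi> \<phi> k)"
      by (intro mult_mono coeff_le_1 cmod_le_norm_vt) auto
    then show "cmod (E x \<psi>' (2 * k - 1) - z * \<psi>' (2 * k - 1)) \<le> norm (vt \<psi> \<phi> k)"
      by (simp add: h_odd norm_mult)
    have "cmod (af (pt x k)) * cmod (\<phi> (2 * k)) \<le> 1 * norm (vt \<psi> \<phi> k)"
      by (intro mult_mono coeff_le_1 cmod_le_norm_vt) auto
    then show "cmod (E x \<psi>' (2 * k) - z * \<psi>' (2 * k)) \<le> 2 * norm (vt \<psi> \<phi> k)"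
      using cmod_le_norm_vt(1)[of \<psi> k \<phi>] norm_triangle_ineq4[of "- af (pt x k) * \<phi> (2 * k)" "z * \<psi> (2 * k)"]
      by (simp add: h_even norm_mult zn)
  qed
qed

text \<open>The same cut as in \<open>right_truncation\<close>, hence errors of opposite sign. It
  removes the boundary index \<open>2 * k\<close>, which is why the sum in \<open>left_sum\<close>
  starts at \<open>k - 1\<close>.\<close>

lemma left_truncation:
  assumes "left_sol x k \<psi> \<phi>"
  defines "\<psi>' \<equiv> \<lambda>n. if n < 2 * k then \<psi> n else 0"
  shows "\<psi>' \<in> ell2" "M x \<psi>' = (\<lambda>n. if n < 2 * k then \<phi> n else 0)"
    "ell2_norm \<psi>' \<le> 3 * K * norm (vt \<psi> \<phi> k)"
proof -
  have sol: "solves x j \<psi> \<phi>" if "j \<le> k" for j using assms that by (simp add: left_sol_def)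
  show mem: "\<psi>' \<in> ell2"
    by (rule ell2_dominated[of \<psi>]) (use assms in \<open>auto simp: left_sol_def\<close>)
  show M: "M x \<psi>' = (\<lambda>n. if n < 2 * k then \<phi> n else 0)"
  proof (rule M_eqI)
    fix j
    show "(if 2 * j - 2 < 2 * k then \<phi> (2 * j - 2) else 0) =
        cnj (ag (pt x j)) * \<psi>' (2 * j - 2) + rg (pt x j) * \<psi>' (2 * j - 1)"
      "(if 2 * j - 1 < 2 * k then \<phi> (2 * j - 1) else 0) =
        cnj (rg (pt x j)) * \<psi>' (2 * j - 2) - ag (pt x j) * \<psi>' (2 * j - 1)"
      using sol[of j] by (cases "j > k"; auto simp: \<psi>'_def solves_def link_def)+
  qed
  have h_odd: "E x \<psi>' (2 * j - 1) - z * \<psi>' (2 * j - 1) = (if j = k then - (rf (pt x k) * \<phi> (2 * k)) else 0)" for j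
    unfolding E_eq M L_odd
    using sol[of j] by (cases "j > k"; cases "j = k") (auto simp: \<psi>'_def solves_def link_def)
  have h_even: "E x \<psi>' (2 * j) - z * \<psi>' (2 * j) = (if j = k then af (pt x k) * \<phi> (2 * k) + z * \<psi> (2 * k) else 0)" for j
    unfolding E_eq M L_even
    using sol[of j] by (cases "j > k"; cases "j = k") (auto simp: \<psi>'_def solves_def link_def)
  show "ell2_norm \<psi>' \<le> 3 * K * norm (vt \<psi> \<phi> k)"
  proof (rule truncation_bound[OF mem, where x = x and k = k])
    fix n assume n: "n \<noteq> 2 * k - 1" "n \<noteq> 2 * k"
    show "E x \<psi>' n - z * \<psi>' n = 0"
    proof (cases rule: int_block_cases[of n "-1"])
      case (1 j)
      then have "n = 2 * j - 1" "j \<noteq> k" using n by auto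
      then show ?thesis using h_odd[of j] by simp
    next
      case (2 j)
      then have "n = 2 * j" "j \<noteq> k" using n by auto
      then show ?thesis using h_even[of j] by simp
    qed
  next
    have "cmod (rf (pt x k)) * cmod (\<phi> (2 * k)) \<le> 1 * norm (vt \<psi> \<phi> k)"
      by (intro mult_mono coeff_le_1 cmod_le_norm_vt) auto
    then show "cmod (E x \<psi>' (2 * k - 1) - z * \<psi>' (2 * k - 1)) \<le> norm (vt \<psi> \<phi> k)"
      by (simp add: h_odd norm_mult)
    have "cmod (af (pt x k)) * cmod (\<phi> (2 * k)) \<le> 1 * norm (vt \<psi> \<phi> k)"
      by (intro mult_mono coeff_le_1 cmod_le_norm_vt) auto
    then show "cmod (E x \<psi>' (2 * k) - z * \<psi>' (2 * k)) \<le> 2 * norm (vt \<psi> \<phi> k)"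
      using cmod_le_norm_vt(1)[of \<psi> k \<phi>] norm_triangle_ineq[of "af (pt x k) * \<phi> (2 * k)" "z * \<psi> (2 * k)"]
      by (simp add: h_even norm_mult zn)
  qed
qed

text \<open>The sequences \<open>\<psi>\<close> and \<open>M x \<psi>\<close> contribute
  \<open>(3 * K)^2 = 9 * K^2\<close> each.\<close>

definition "C = 18 * K\<^sup>2"

lemma sum_vt_le:
  assumes "\<psi> \<in> ell2" "ell2_norm \<psi> \<le> 3 * K * B" "inj_on s F" "finite F"
  shows "(\<Sum>i\<in>F. (norm (vt \<psi> (M x \<psi>) (s i)))\<^sup>2) \<le> C * B\<^sup>2"
proof -
  have *: "(\<Sum>i\<in>F. (cmod (\<eta> (2 * s i)))\<^sup>2) \<le> (3 * K * B)\<^sup>2" if \<eta>: "\<eta> \<in> ell2" "ell2_norm \<eta> \<le> 3 * K * B" for \<eta>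
  proof -
    have "L2_set (\<lambda>n. cmod (\<eta> n)) ((\<lambda>i. 2 * s i) ` F) \<le> 3 * K * B"
      using L2_set_le_ell2_norm[OF \<eta>(1)] \<eta>(2) order_trans by blast
    moreover have "inj_on (\<lambda>i. 2 * s i) F" using assms(3) by (auto simp: inj_on_def)
    ultimately have "sqrt (\<Sum>i\<in>F. (cmod (\<eta> (2 * s i)))\<^sup>2) \<le> 3 * K * B" by (simp add: L2_set_def sum.reindex)
    then show ?thesis by (rule sqrt_le_D)
  qed
  have "(\<Sum>i\<in>F. (norm (vt \<psi> (M x \<psi>) (s i)))\<^sup>2) \<le> (3 * K * B)\<^sup>2 + (3 * K * B)\<^sup>2"
    unfolding norm_vt sum.distrib using * M_isometry assms by (intro add_mono) auto
  then show ?thesis by (simp add: C_def power_mult_distrib algebra_simps)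
qed

lemma right_sum:
  assumes "right_sol x k \<psi> \<phi>"
  shows "(\<Sum>l\<le>m. (norm (vt \<psi> \<phi> (k + int l)))\<^sup>2) \<le> C * (norm (vt \<psi> \<phi> k))\<^sup>2"
proof -
  define \<psi>' where "\<psi>' = (\<lambda>n. if n < 2 * k then 0 else \<psi> n)"
  note tr = right_truncation[OF assms, folded \<psi>'_def]
  have "vt \<psi> \<phi> (k + int l) = vt \<psi>' (M x \<psi>') (k + int l)" for l
    unfolding tr(2) by (simp add: vt_def \<psi>'_def)
  then show ?thesis using sum_vt_le[OF tr(1,3), of "\<lambda>l. k + int l" "{..m}" x] by (simp add: inj_on_def)
qed

lemma left_sum:
  assumes "left_sol x k \<psi> \<phi>"
  shows "(\<Sum>l\<le>m. (norm (vt \<psi> \<phi> (k - 1 - int l)))\<^sup>2) \<le> C * (norm (vt \<psi> \<phi> k))\<^sup>2"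
proof -
  define \<psi>' where "\<psi>' = (\<lambda>n. if n < 2 * k then \<psi> n else 0)"
  note tr = left_truncation[OF assms, folded \<psi>'_def]
  have "vt \<psi> \<phi> (k - 1 - int l) = vt \<psi>' (M x \<psi>') (k - 1 - int l)" for l
    unfolding tr(2) by (simp add: vt_def \<psi>'_def)
  then show ?thesis using sum_vt_le[OF tr(1,3), of "\<lambda>l. k - 1 - int l" "{..m}" x] by (simp add: inj_on_def)
qed

lemma C_nonneg: "0 \<le> C" by (simp add: C_def)

lemma right_decay:
  assumes "right_sol x k \<psi> \<phi>"
  shows "(norm (vt \<psi> \<phi> (k + int n)))\<^sup>2 \<le> (C + 1)\<^sup>2 / real (n + 1) * (norm (vt \<psi> \<phi> k))\<^sup>2"
proof -
  have "(\<Sum>l\<le>m. (norm (vt \<psi> \<phi> (k + int (i + l))))\<^sup>2) \<le> (C + 1) * (norm (vt \<psi> \<phi> (k + int i)))\<^sup>2" for i m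
  proof -
    have "right_sol x (k + int i) \<psi> \<phi>" using assms by (auto simp: right_sol_def)
    from right_sum[OF this, of m]
    have "(\<Sum>l\<le>m. (norm (vt \<psi> \<phi> (k + int (i + l))))\<^sup>2) \<le> C * (norm (vt \<psi> \<phi> (k + int i)))\<^sup>2"
      by (simp add: add.assoc)
    also have "\<dots> \<le> (C + 1) * (norm (vt \<psi> \<phi> (k + int i)))\<^sup>2" by (intro mult_right_mono) auto
    finally show ?thesis .
  qed
  from decay_from_tail_sums[of "\<lambda>i. norm (vt \<psi> \<phi> (k + int i))", OF this, of n] show ?thesis
    using C_nonneg by simp
qed

lemma left_decay:
  assumes "left_sol x k \<psi> \<phi>"
  shows "(norm (vt \<psi> \<phi> (k - int n)))\<^sup>2 \<le> (C + 1)\<^sup>2 / real (n + 1) * (norm (vt \<psi> \<phi> k))\<^sup>2"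
proof -
  have "(\<Sum>l\<le>m. (norm (vt \<psi> \<phi> (k - int (i + l))))\<^sup>2) \<le> (C + 1) * (norm (vt \<psi> \<phi> (k - int i)))\<^sup>2" for i m
  proof -
    have sol: "left_sol x (k - int i) \<psi> \<phi>" using assms by (auto simp: left_sol_def)
    \<comment> \<open>The boundary term that \<open>left_sum\<close> omits is added back, hence
      \<open>C + 1\<close>; \<open>right_decay\<close> is stated with the same constant.\<close>
    have "(\<Sum>l\<le>m. (norm (vt \<psi> \<phi> (k - int (i + l))))\<^sup>2) \<le> (\<Sum>l\<le>Suc m. (norm (vt \<psi> \<phi> (k - int (i + l))))\<^sup>2)"
      by simp
    also have "\<dots> = (norm (vt \<psi> \<phi> (k - int i)))\<^sup>2 + (\<Sum>l\<le>m. (norm (vt \<psi> \<phi> (k - int i - 1 - int l)))\<^sup>2)"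
      by (subst sum.atMost_Suc_shift) (simp add: algebra_simps)
    also have "\<dots> \<le> (norm (vt \<psi> \<phi> (k - int i)))\<^sup>2 + C * (norm (vt \<psi> \<phi> (k - int i)))\<^sup>2"
      using left_sum[OF sol, of m] by simp
    finally show ?thesis by (simp add: algebra_simps)
  qed
  from decay_from_tail_sums[of "\<lambda>i. norm (vt \<psi> \<phi> (k - int i))", OF this, of n] show ?thesis
    using C_nonneg by simp
qed

section \<open>Isotropy of the boundary values\<close>

lemma conserved_zero:
  fixes B :: real
  assumes "\<And>n. \<bar>x\<bar> \<le> B / real (n + 1)" shows "x = 0"
proof -
  have "(\<lambda>n. B / real (n + 1)) \<longlonglongrightarrow> 0"
    using LIMSEQ_Suc[OF lim_const_over_n[of B]] by simp
  then have "\<bar>x\<bar> \<le> 0" by (rule LIMSEQ_le_const) (use assms in blast)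
  then show ?thesis by simp
qed

lemma vt_difference: "\<bar>(cmod (\<psi> (2 * k)))\<^sup>2 - (cmod (\<phi> (2 * k)))\<^sup>2\<bar> \<le> (norm (vt \<psi> \<phi> k))\<^sup>2"
  unfolding norm_vt using zero_le_power2[of "cmod (\<psi> (2 * k))"] zero_le_power2[of "cmod (\<phi> (2 * k))"] by linarith

text \<open>The difference \<open>|\<psi>|^2 - |\<phi>|^2\<close> at even indices is conserved along
  a solution, yet dominated by the squared norms of the vectors \<open>vt\<close>, which tend to
  0.\<close>

lemma EM_isotropic:
  assumes "v \<in> EM x k" shows "cmod (v $ 1) = cmod (v $ 2)"
proof -
  obtain \<psi> \<phi> where v: "v = vt \<psi> \<phi> k" "right_sol x k \<psi> \<phi>" using assms unfolding EM_def by blast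
  let ?J = "\<lambda>k. (cmod (\<psi> (2 * k)))\<^sup>2 - (cmod (\<phi> (2 * k)))\<^sup>2"
  have "?J (k + int n) = ?J k" for n
  proof (induction n)
    case (Suc n)
    have "solves x (k + int (Suc n)) \<psi> \<phi>" using v(2) by (simp add: right_sol_def)
    from solves_conserves[OF this] Suc show ?case by (simp add: algebra_simps)
  qed simp
  then have "\<bar>?J k\<bar> \<le> (C + 1)\<^sup>2 * (norm v)\<^sup>2 / real (n + 1)" for n
    using order_trans[OF vt_difference right_decay[OF v(2), of n]] unfolding v(1) by simp
  then have "?J k = 0" by (rule conserved_zero)
  then show ?thesis by (simp add: v norm_mult zn)
qed

lemma EP_isotropic:
  assumes "v \<in> EP x k" shows "cmod (v $ 1) = cmod (v $ 2)"
proof -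
  obtain \<psi> \<phi> where v: "v = vt \<psi> \<phi> k" "left_sol x k \<psi> \<phi>" using assms unfolding EP_def by blast
  let ?J = "\<lambda>k. (cmod (\<psi> (2 * k)))\<^sup>2 - (cmod (\<phi> (2 * k)))\<^sup>2"
  have "?J (k - int n) = ?J k" for n
  proof (induction n)
    case (Suc n)
    have "solves x (k - int n) \<psi> \<phi>" using v(2) by (simp add: left_sol_def)
    moreover have "k - int (Suc n) = k - int n - 1" by simp
    ultimately show ?case using solves_conserves[of x "k - int n" \<psi> \<phi>] Suc by metis
  qed simp
  then have "\<bar>?J k\<bar> \<le> (C + 1)\<^sup>2 * (norm v)\<^sup>2 / real (n + 1)" for n
    using order_trans[OF vt_difference left_decay[OF v(2), of n]] unfolding v(1) by simp
  then have "?J k = 0" by (rule conserved_zero)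
  then show ?thesis by (simp add: v norm_mult zn)
qed

text \<open>Prescribing a jump \<open>w\<close> of the vector \<open>(z \<psi>(-2), \<phi>(-2))\<close> amounts to solving \<open>(E - z) \<psi> = h\<close> for this \<open>h\<close>.
  The vectors after and before the jump lie in \<open>EM\<close> and \<open>EP\<close>.\<close>

definition dlt :: "int \<Rightarrow> complex" where "dlt = (\<lambda>n. if n = -2 then 1 else 0)"

definition jump :: "'a \<Rightarrow> complex^2 \<Rightarrow> int \<Rightarrow> complex" where
  "jump y w = (\<lambda>n. w $ 1 * dlt n - w $ 2 * L y dlt n)"

lemma dlt_ell2: "dlt \<in> ell2" "ell2_norm dlt \<le> 1"
proof -
  have "L2_set (\<lambda>n. cmod (dlt n)) F \<le> 1" if "finite F" for F
  proof -
    have "(cmod (dlt n))\<^sup>2 = (if n = -2 then 1 else 0)" for n by (simp add: dlt_def)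
    then show ?thesis using that by (simp add: L2_set_def sum.delta)
  qed
  from ell2_normI[OF this] show "dlt \<in> ell2" "ell2_norm dlt \<le> 1" by blast+
qed

lemma jump_ell2: "jump y w \<in> ell2"
  unfolding jump_def by (intro ell2_diff ell2_scale dlt_ell2) (use L_isometry dlt_ell2 in auto)

definition sol :: "'a \<Rightarrow> complex^2 \<Rightarrow> int \<Rightarrow> complex" where
  "sol y w = (SOME \<psi>. \<psi> \<in> ell2 \<and> (\<lambda>n. E y \<psi> n - z * \<psi> n) = jump y w)"

lemma sol: "sol y w \<in> ell2" "(\<lambda>n. E y (sol y w) n - z * sol y w n) = jump y w"
proof -
  have "\<exists>\<psi>. \<psi> \<in> ell2 \<and> (\<lambda>n. E y \<psi> n - z * \<psi> n) = jump y w"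
    using inv[of y] jump_ell2 unfolding inv_bound_def by blast
  from someI_ex[OF this] show "sol y w \<in> ell2" "(\<lambda>n. E y (sol y w) n - z * sol y w n) = jump y w"
    by (auto simp: sol_def)
qed

definition after :: "'a \<Rightarrow> complex^2 \<Rightarrow> complex^2" where
  "after y w = vt (sol y w) (M y (sol y w)) (-1)"

lemma jump_odd: "jump y w (2 * k - 1) = (if k = -1 then - w $ 2 * rf (pt y k) else 0)"
  and jump_even: "jump y w (2 * k) = (if k = -1 then w $ 1 + w $ 2 * af (pt y k) else 0)"
proof -
  have "2 * k - 1 = -2 \<longleftrightarrow> False" "2 * k = -2 \<longleftrightarrow> k = -1" by presburger+
  then show "jump y w (2 * k - 1) = (if k = -1 then - w $ 2 * rf (pt y k) else 0)"
    "jump y w (2 * k) = (if k = -1 then w $ 1 + w $ 2 * af (pt y k) else 0)"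
    by (auto simp: jump_def L_odd L_even dlt_def)
qed

lemma link_sol:
  "link (pt y k) (jump y w (2 * k - 1)) (jump y w (2 * k))
    (sol y w (2 * k - 2)) (sol y w (2 * k - 1)) (sol y w (2 * k))
    (M y (sol y w) (2 * k - 2)) (M y (sol y w) (2 * k - 1)) (M y (sol y w) (2 * k))"
  using link_at[where x = y and k = k and \<psi> = "sol y w"] sol(2)[of y w] by (simp add: fun_eq_iff)

lemma after_EM: "after y w \<in> EM y (-1)"
proof -
  have "right_sol y (-1) (sol y w) (M y (sol y w))"
    unfolding right_sol_def
  proof (intro conjI allI impI)
    fix j :: int assume "j > -1"
    then show "solves y j (sol y w) (M y (sol y w))"
      using link_sol[where y = y and w = w and k = j] by (simp add: solves_def jump_odd jump_even)
  qed (use sol(1) M_isometry in auto)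
  then show ?thesis unfolding EM_def after_def by blast
qed

text \<open>Adding \<open>c0 * dlt\<close> to \<open>\<psi>\<close> and \<open>w $ 2 * dlt\<close>
  to \<open>\<phi>\<close> changes \<open>L y \<phi> - z \<psi>\<close> by
  \<open>w $ 2 * L y dlt - w $ 1 * dlt\<close>, which is \<open>- jump y w\<close>. The relation
  \<open>\<phi> = M y \<psi>\<close> can break only in the block \<open>{-2, -1}\<close>, which
  belongs to link 0 and does not concern the left half line.\<close>

lemma before_EP: "after y w + w \<in> EP y (-1)"
proof -
  define c0 where "c0 = cnj z * w $ 1"
  have c0: "z * c0 = w $ 1" using z_cnj by (simp add: c0_def mult.assoc[symmetric])
  define \<psi> where "\<psi> = (\<lambda>n. sol y w n + c0 * dlt n)"
  define \<phi> where "\<phi> = (\<lambda>n. M y (sol y w) n + w $ 2 * dlt n)"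
  have "solves y k \<psi> \<phi>" if "k \<le> -1" for k
  proof -
    have d: "dlt (2 * k - 2) = 0" "dlt (2 * k - 1) = 0" "dlt (2 * k) = (if k = -1 then 1 else 0)"
      using that by (auto simp: dlt_def)
    show ?thesis
    proof (cases "k = -1")
      case True
      then have dk: "dlt (2 * k) = 1" using d by simp
      have j: "jump y w (2 * k - 1) = - w $ 2 * rf (pt y k)" "jump y w (2 * k) = w $ 1 + w $ 2 * af (pt y k)"
        unfolding jump_odd jump_even using True by auto
      show ?thesis
        using link_sol[where y = y and w = w and k = k]
        unfolding j solves_def \<psi>_def \<phi>_def link_def d(1,2) dk distrib_left c0[symmetric]
        by (simp add: algebra_simps)
    next
      case False
      then show ?thesis
        using link_sol[where y = y and w = w and k = k] d by (simp add: solves_def \<psi>_def \<phi>_def jump_odd jump_even)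
    qed
  qed
  moreover have "\<psi> \<in> ell2" "\<phi> \<in> ell2"
    unfolding \<psi>_def \<phi>_def using sol(1) M_isometry dlt_ell2(1) by (auto intro!: ell2_add ell2_scale)
  ultimately have "left_sol y (-1) \<psi> \<phi>" by (simp add: left_sol_def)
  then have "vt \<psi> \<phi> (-1) \<in> EP y (-1)" unfolding EP_def by blast
  moreover have "vt \<psi> \<phi> (-1) = after y w + w"
    using c0 by (simp add: after_def vec_eq_iff forall_2 \<psi>_def \<phi>_def dlt_def distrib_left)
  ultimately show ?thesis by simp
qed

lemma after_continuous: "isCont (\<lambda>y. after y w) y0"
proof -
  define \<psi>0 where "\<psi>0 = sol y0 w"
  have \<psi>0: "\<psi>0 \<in> ell2" by (simp add: \<psi>0_def sol)
  \<comment> \<open>\<open>t * (B - 1)\<close> will bound the distance: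
    \<open>ell2_norm \<eta>\<close> once for each coordinate, plus the change of \<open>M\<close> on
    \<open>\<psi>0\<close>.\<close>
  define B where "B = 2 * K * (cmod (w $ 2) + ell2_norm \<psi>0) + ell2_norm \<psi>0 + 1"
  have B: "B > 0" using K by (simp add: B_def add_nonneg_pos)
  have "\<exists>d>0. \<forall>y. dist y y0 < d \<longrightarrow> dist (after y w) (after y0 w) < e" if e: "e > 0" for e
  proof -
    define t where "t = e / (2 * B)"
    have t: "t > 0" using e B by (simp add: t_def)
    obtain d1 where d1: "d1 > 0" "\<And>x y \<psi>. dist x y < d1 \<Longrightarrow> \<psi> \<in> ell2 \<Longrightarrow>
        (\<lambda>n. M x \<psi> n - M y \<psi> n) \<in> ell2 \<and> ell2_norm (\<lambda>n. M x \<psi> n - M y \<psi> n) \<le> t * ell2_norm \<psi>"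
      using M_uniformly_continuous[OF t] by blast
    obtain d2 where d2: "d2 > 0" "\<And>x y \<psi>. dist x y < d2 \<Longrightarrow> \<psi> \<in> ell2 \<Longrightarrow>
        (\<lambda>n. L x \<psi> n - L y \<psi> n) \<in> ell2 \<and> ell2_norm (\<lambda>n. L x \<psi> n - L y \<psi> n) \<le> t * ell2_norm \<psi>"
      using L_uniformly_continuous[OF t] by blast
    obtain d3 where d3: "d3 > 0" "\<And>x y \<psi>. dist x y < d3 \<Longrightarrow> \<psi> \<in> ell2 \<Longrightarrow>
        (\<lambda>n. E x \<psi> n - E y \<psi> n) \<in> ell2 \<and> ell2_norm (\<lambda>n. E x \<psi> n - E y \<psi> n) \<le> t * ell2_norm \<psi>"
      using E_uniformly_continuous[OF t] by blast
    have "dist (after y w) (after y0 w) < e" if y: "dist y y0 < min d1 (min d2 d3)" for y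
    proof -
      define \<psi> where "\<psi> = sol y w"
      define \<eta> where "\<eta> = (\<lambda>n. \<psi> n - \<psi>0 n)"
      have \<psi>: "\<psi> \<in> ell2" by (simp add: \<psi>_def sol)
      have \<eta>: "\<eta> \<in> ell2" unfolding \<eta>_def by (intro ell2_diff \<psi> \<psi>0)
      let ?l = "\<lambda>n. L y dlt n - L y0 dlt n" and ?m = "\<lambda>n. M y \<psi>0 n - M y0 \<psi>0 n"
        and ?e = "\<lambda>n. E y \<psi>0 n - E y0 \<psi>0 n"
      have l: "?l \<in> ell2" "ell2_norm ?l \<le> t * ell2_norm dlt" using d2(2)[of y y0 dlt] y dlt_ell2 by auto
      have m: "?m \<in> ell2" "ell2_norm ?m \<le> t * ell2_norm \<psi>0" using d1(2)[of y y0] y \<psi>0 by auto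
      have ee: "?e \<in> ell2" "ell2_norm ?e \<le> t * ell2_norm \<psi>0" using d3(2)[of y y0] y \<psi>0 by auto
      \<comment> \<open>The resolvent identity: \<open>E y - z\<close> maps the difference of the
        solutions to the difference of the data minus \<open>(E y - E y0) \<psi>0\<close>, and both
        are small in norm.\<close>
      have "E y \<eta> n - z * \<eta> n = (- w $ 2) * ?l n - ?e n" for n
        using fun_cong[OF sol(2)[of y w], of n] fun_cong[OF sol(2)[of y0 w], of n]
        unfolding \<eta>_def lin_op_diff[OF lin_E] by (simp add: \<psi>_def[symmetric] \<psi>0_def[symmetric] jump_def algebra_simps)
      then have "ell2_norm (\<lambda>n. E y \<eta> n - z * \<eta> n) = ell2_norm (\<lambda>n. (- w $ 2) * ?l n - ?e n)" by simp
      also have "\<dots> \<le> ell2_norm (\<lambda>n. (- w $ 2) * ?l n) + ell2_norm ?e"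
        by (rule ell2_diff(2)[OF ell2_scale(1)[OF l(1)] ee(1)])
      also have "ell2_norm (\<lambda>n. (- w $ 2) * ?l n) = cmod (w $ 2) * ell2_norm ?l"
        using ell2_scale(2)[OF l(1), of "- w $ 2"] by simp
      also have "cmod (w $ 2) * ell2_norm ?l \<le> cmod (w $ 2) * (t * 1)"
        using l(2) dlt_ell2(2) t by (intro mult_left_mono) (auto intro: order_trans mult_left_mono)
      finally have "ell2_norm (\<lambda>n. E y \<eta> n - z * \<eta> n) \<le> t * (cmod (w $ 2) + ell2_norm \<psi>0)"
        using ee(2) by (simp add: algebra_simps)
      then have "K * ell2_norm (\<lambda>n. E y \<eta> n - z * \<eta> n) \<le> K * (t * (cmod (w $ 2) + ell2_norm \<psi>0))"
        using K by (intro mult_left_mono) auto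
      then have n\<eta>: "ell2_norm \<eta> \<le> K * (t * (cmod (w $ 2) + ell2_norm \<psi>0))" using below[OF \<eta>, of y] by simp
      have a2: "(after y w - after y0 w) $ 2 = M y \<eta> (-2) + ?m (-2)"
        by (simp add: after_def \<eta>_def lin_op_diff[OF lin_M] \<psi>_def[symmetric] \<psi>0_def[symmetric])
      have "cmod (M y \<eta> (-2)) \<le> ell2_norm \<eta>"
        using cmod_le_ell2_norm[of "M y \<eta>"] M_isometry[OF \<eta>] by metis
      moreover have "cmod (?m (-2)) \<le> t * ell2_norm \<psi>0" using cmod_le_ell2_norm[OF m(1), of "-2"] m(2) by simp
      ultimately have c2: "cmod ((after y w - after y0 w) $ 2) \<le> ell2_norm \<eta> + t * ell2_norm \<psi>0"
        unfolding a2 using norm_triangle_ineq[of "M y \<eta> (-2)" "?m (-2)"] by linarith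
      have "(after y w - after y0 w) $ 1 = z * \<eta> (-2)"
        by (simp add: after_def \<eta>_def \<psi>_def[symmetric] \<psi>0_def[symmetric] algebra_simps)
      then have c1: "cmod ((after y w - after y0 w) $ 1) \<le> ell2_norm \<eta>"
        using cmod_le_ell2_norm[OF \<eta>, of "-2"] by (simp add: norm_mult zn)
      have "norm (after y w - after y0 w) \<le> 2 * ell2_norm \<eta> + t * ell2_norm \<psi>0"
        using norm_complex_2_le[of "after y w - after y0 w"] c1 c2 by linarith
      also have "\<dots> \<le> t * (B - 1)" using n\<eta> by (simp add: B_def algebra_simps)
      also have "\<dots> < 2 * (t * B)" unfolding right_diff_distrib using t mult_pos_pos[OF t B] by linarith
      also have "\<dots> = e" using B by (simp add: t_def)
      finally show ?thesis by (simp add: dist_norm)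
    qed
    then show ?thesis using d1(1) d2(1) d3(1) by (intro exI[of _ "min d1 (min d2 d3)"]) auto
  qed
  then show ?thesis unfolding continuous_at_eps_delta by blast
qed

text \<open>If one space were 0, \<open>after_EM\<close> and \<open>before_EP\<close> would put
  every \<open>w\<close>, up to sign, into the other; but \<open>vector [1, 0]\<close> is not
  isotropic.\<close>

lemma EM_ne: "EM y (-1) \<noteq> {0}" and EP_ne: "EP y (-1) \<noteq> {0}"
proof -
  define w :: "complex^2" where "w = vector [1, 0]"
  have w: "cmod (w $ 1) \<noteq> cmod (w $ 2)" by (simp add: w_def)
  show "EM y (-1) \<noteq> {0}"
  proof
    assume "EM y (-1) = {0}"
    then have "after y w = 0" using after_EM by blast
    then show False using before_EP[of y w] EP_isotropic w by fastforce
  qed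
  show "EP y (-1) \<noteq> {0}"
  proof
    assume "EP y (-1) = {0}"
    then have "after y w + w = 0" using before_EP by blast
    then have "after y w = - w" by (simp add: add_eq_0_iff2)
    then have "cmod ((- w) $ 1) = cmod ((- w) $ 2)" using EM_isotropic[OF after_EM, of y w] by metis
    then show False using w by simp
  qed
qed

lemma EM_line: "EM y (-1) \<in> complex_lines"
  by (rule isotropic_subspace_line[OF subspace_EM EM_ne EM_isotropic])

lemma EP_line: "EP y (-1) \<in> complex_lines"
  by (rule isotropic_subspace_line[OF subspace_EP EP_ne EP_isotropic])

text \<open>As the lines meet only in 0, \<open>after y (- w)\<close> is the projection of
  \<open>w\<close> onto \<open>EM\<close> along \<open>EP\<close>, and \<open>after y w + w\<close>
  is that onto \<open>EP\<close> along \<open>EM\<close>. Freezing \<open>w = u\<close> gives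
  sections through \<open>u\<close>, continuous in the base point.\<close>

lemma continuous_EM: "continuous_map euclidean projective_line (\<lambda>y. EM y (-1))"
proof (rule continuous_line_fieldI[OF EM_line])
  fix y u assume u: "u \<in> EM y (-1)"
  have "after y (- u) - u \<in> EP y (-1)" using before_EP[of y "- u"] by simp
  moreover have "after y (- u) - u \<in> EM y (-1)" using vec.subspace_diff[OF subspace_EM after_EM u] .
  ultimately have "after y (- u) - u \<in> {0}" unfolding EP_EM_inter[of y "-1", symmetric] by blast
  then have "after y (- u) = u" by simp
  then show "\<exists>p. (\<forall>y'. p y' \<in> EM y' (-1)) \<and> p y = u \<and> isCont p y"
    by (intro exI[of _ "\<lambda>y. after y (- u)"]) (simp add: after_EM after_continuous)
qed

lemma continuous_EP: "continuous_map euclidean projective_line (\<lambda>y. EP y (-1))"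
proof (rule continuous_line_fieldI[OF EP_line])
  fix y u assume u: "u \<in> EP y (-1)"
  have "(after y u + u) - u \<in> EP y (-1)" using vec.subspace_diff[OF subspace_EP before_EP u] .
  then have "after y u \<in> EP y (-1) \<inter> EM y (-1)" using after_EM by simp
  then have "after y u = 0" unfolding EP_EM_inter by simp
  then show "\<exists>p. (\<forall>y'. p y' \<in> EP y' (-1)) \<and> p y = u \<and> isCont p y"
    by (intro exI[of _ "\<lambda>y. after y u + u"]) (simp add: before_EP after_continuous)
qed

text \<open>Continuation over one more link costs a factor \<open>tr\<close> on all earlier values.
  Where \<open>tr\<close> is 0, the extended solution lives on the two new indices only.\<close>

lemma left_extend:
  assumes "left_sol x (k - 1) \<psi> \<phi>"
  obtains \<psi>' \<phi>' where "left_sol x k \<psi>' \<phi>'" "vt \<psi>' \<phi>' k = A (pt x k) *v vt \<psi> \<phi> (k - 1)"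
    "\<And>j. j \<le> k - 1 \<Longrightarrow> vt \<psi>' \<phi>' j = tr (pt x k) *s vt \<psi> \<phi> j"
proof -
  let ?v = "A (pt x k) *v vt \<psi> \<phi> (k - 1)" and ?t = "tr (pt x k)"
  have "vt \<psi> \<phi> (k - 1) = vector [z * \<psi> (2 * k - 2), \<phi> (2 * k - 2)]" by (simp add: vt_def)
  then obtain b q where l: "link (pt x k) 0 0 (?t * \<psi> (2 * k - 2)) b (cnj z * ?v $ 1) (?t * \<phi> (2 * k - 2)) q (?v $ 2)"
    using link_scaled_in by metis
  define \<psi>' where "\<psi>' = (\<lambda>n. if n \<le> 2 * k - 2 then ?t * \<psi> n else if n = 2 * k - 1 then b
    else if n = 2 * k then cnj z * ?v $ 1 else 0)"
  define \<phi>' where "\<phi>' = (\<lambda>n. if n \<le> 2 * k - 2 then ?t * \<phi> n else if n = 2 * k - 1 then q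
    else if n = 2 * k then ?v $ 2 else 0)"
  have "solves x j \<psi>' \<phi>'" if "j \<le> k" for j
  proof (cases "j = k")
    case True
    then show ?thesis using l by (simp add: solves_def \<psi>'_def \<phi>'_def)
  next
    case False
    then have "solves x j \<psi> \<phi>" using assms that by (simp add: left_sol_def)
    then have "solves x j (\<lambda>n. ?t * \<psi> n + 0 * \<psi> n) (\<lambda>n. ?t * \<phi> n + 0 * \<phi> n)" using solves_comb by blast
    then show ?thesis using that False by (simp add: solves_def \<psi>'_def \<phi>'_def)
  qed
  moreover have "\<psi>' \<in> ell2"
  proof (rule ell2_dominated2)
    show "(\<lambda>n. ?t * \<psi> n) \<in> ell2" using assms by (auto simp: left_sol_def intro: ell2_scale)
    show "(\<lambda>n. if n = 2 * k - 1 \<or> n = 2 * k then \<psi>' n else 0) \<in> ell2"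
      by (rule ell2_two_points[of "2 * k - 1" "2 * k"]) auto
  qed (auto simp: \<psi>'_def)
  moreover have "\<phi>' \<in> ell2"
  proof (rule ell2_dominated2)
    show "(\<lambda>n. ?t * \<phi> n) \<in> ell2" using assms by (auto simp: left_sol_def intro: ell2_scale)
    show "(\<lambda>n. if n = 2 * k - 1 \<or> n = 2 * k then \<phi>' n else 0) \<in> ell2"
      by (rule ell2_two_points[of "2 * k - 1" "2 * k"]) auto
  qed (auto simp: \<phi>'_def)
  ultimately have "left_sol x k \<psi>' \<phi>'" by (simp add: left_sol_def)
  moreover have "vt \<psi>' \<phi>' k = ?v"
    using z_cnj by (simp add: vec_eq_iff forall_2 \<psi>'_def \<phi>'_def mult.assoc[symmetric])
  moreover have "vt \<psi>' \<phi>' j = ?t *s vt \<psi> \<phi> j" if "j \<le> k - 1" for j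
    using that by (simp add: vec_eq_iff forall_2 \<psi>'_def \<phi>'_def)
  ultimately show ?thesis using that by blast
qed

text \<open>A kernel vector continues to the right by zero, so it would lie in \<open>EM\<close> as
  well as in \<open>EP\<close>.\<close>

lemma A_nonzero_on_EP:
  assumes "u \<in> EP x (k - 1)" "u \<noteq> 0" shows "A (pt x k) *v u \<noteq> 0"
proof
  assume ker: "A (pt x k) *v u = 0"
  have "u = vector [z * (cnj z * u $ 1), u $ 2]"
    using z_cnj by (simp add: vec_eq_iff forall_2 mult.assoc[symmetric])
  then obtain b q where l: "link (pt x k) 0 0 (cnj z * u $ 1) b 0 (u $ 2) q 0"
    using link_annihilated_in[OF D_nonzero] ker by metis
  define \<psi> where "\<psi> = (\<lambda>n. if n = 2 * k - 2 then cnj z * u $ 1 else if n = 2 * k - 1 then b else 0)"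
  define \<phi> where "\<phi> = (\<lambda>n. if n = 2 * k - 2 then u $ 2 else if n = 2 * k - 1 then q else 0)"
  have "solves x j \<psi> \<phi>" if "j > k - 1" for j
  proof (cases "j = k")
    case True
    then show ?thesis using l by (simp add: solves_def \<psi>_def \<phi>_def)
  next
    case False
    then show ?thesis using that by (simp add: solves_def \<psi>_def \<phi>_def link_def)
  qed
  moreover have "\<psi> \<in> ell2" "\<phi> \<in> ell2"
    by (rule ell2_two_points[of "2 * k - 2" "2 * k - 1"]; simp add: \<psi>_def \<phi>_def)+
  ultimately have "right_sol x (k - 1) \<psi> \<phi>" by (simp add: right_sol_def)
  then have "vt \<psi> \<phi> (k - 1) \<in> EM x (k - 1)" unfolding EM_def by blast
  moreover have "vt \<psi> \<phi> (k - 1) = u"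
    using z_cnj by (simp add: vec_eq_iff forall_2 \<psi>_def \<phi>_def mult.assoc[symmetric])
  ultimately show False using EP_EM_inter[of x "k - 1"] assms by auto
qed

section \<open>Action of the cocycle on the two boundary lines\<close>

definition "trn n y = (\<Prod>i<n. tr ((T ^^ i) y))"

lemma cocycle_right:
  assumes "right_sol y (-1) \<psi> \<phi>"
  shows "cocycle T A n y *v vt \<psi> \<phi> (-1) = trn n y *s vt \<psi> \<phi> (int n - 1)"
proof (induction n)
  case (Suc n)
  have "solves y (int n) \<psi> \<phi>" using assms by (simp add: right_sol_def)
  then have s: "A ((T ^^ n) y) *v vt \<psi> \<phi> (int n - 1) = tr ((T ^^ n) y) *s vt \<psi> \<phi> (int n)"
    using solves_forward[of y "int n"] by (simp add: iter_int_of_nat)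
  have "cocycle T A (Suc n) y *v vt \<psi> \<phi> (-1) = A ((T ^^ n) y) *v (trn n y *s vt \<psi> \<phi> (int n - 1))"
    using Suc by (simp add: matrix_vector_mul_assoc[symmetric])
  also have "\<dots> = trn n y *s (A ((T ^^ n) y) *v vt \<psi> \<phi> (int n - 1))"
    by (simp add: vec.scale)
  finally show ?case unfolding s by (simp add: trn_def vector_smult_assoc mult.commute)
qed (simp add: trn_def)

text \<open>Read leftwards, the extended solution starts with the image under the cocycle and
  arrives after \<open>n\<close> steps at \<open>trn n y\<close> times the given vector;
  \<open>left_decay\<close> compares the two.\<close>

lemma cocycle_left:
  assumes "left_sol y (-1) \<psi> \<phi>"
  shows "\<exists>\<psi>' \<phi>'. left_sol y (int n - 1) \<psi>' \<phi>' \<and> vt \<psi>' \<phi>' (int n - 1) = cocycle T A n y *v vt \<psi> \<phi> (-1) \<and>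
    vt \<psi>' \<phi>' (-1) = trn n y *s vt \<psi> \<phi> (-1)"
proof (induction n)
  case 0
  show ?case using assms by (intro exI[of _ \<psi>] exI[of _ \<phi>]) (simp add: trn_def)
next
  case (Suc n)
  then obtain \<psi>' \<phi>' where 1: "left_sol y (int n - 1) \<psi>' \<phi>'"
    "vt \<psi>' \<phi>' (int n - 1) = cocycle T A n y *v vt \<psi> \<phi> (-1)" "vt \<psi>' \<phi>' (-1) = trn n y *s vt \<psi> \<phi> (-1)" by blast
  obtain \<psi>2 \<phi>2 where 2: "left_sol y (int n) \<psi>2 \<phi>2"
    "vt \<psi>2 \<phi>2 (int n) = A ((T ^^ n) y) *v vt \<psi>' \<phi>' (int n - 1)"
    "\<And>j. j \<le> int n - 1 \<Longrightarrow> vt \<psi>2 \<phi>2 j = tr ((T ^^ n) y) *s vt \<psi>' \<phi>' j"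
    using left_extend[OF 1(1)] unfolding iter_int_of_nat by blast
  have "vt \<psi>2 \<phi>2 (-1) = trn (Suc n) y *s vt \<psi> \<phi> (-1)"
    using 2(3)[of "-1"] 1(3) by (simp add: trn_def vector_smult_assoc mult.commute)
  moreover have "vt \<psi>2 \<phi>2 (int n) = cocycle T A (Suc n) y *v vt \<psi> \<phi> (-1)"
    using 2(2) 1(2) by (simp add: matrix_vector_mul_assoc)
  ultimately show ?case using 2(1) by (intro exI[of _ \<psi>2] exI[of _ \<phi>2]) simp
qed

lemma cocycle_EP:
  assumes "u \<in> EP y (-1)" shows "cocycle T A n y *v u \<in> EP y (int n - 1)"
proof -
  obtain \<psi> \<phi> where "u = vt \<psi> \<phi> (-1)" "left_sol y (-1) \<psi> \<phi>" using assms unfolding EP_def by blast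
  then obtain \<psi>' \<phi>' where "left_sol y (int n - 1) \<psi>' \<phi>'" "vt \<psi>' \<phi>' (int n - 1) = cocycle T A n y *v u"
    using cocycle_left by metis
  moreover from this have "vt \<psi>' \<phi>' (int n - 1) \<in> EP y (int n - 1)" unfolding EP_def by blast
  ultimately show ?thesis by simp
qed

lemma cocycle_EM: 
  assumes "u \<in> EM y (-1)" shows "cocycle T A n y *v u \<in> EM y (int n - 1)"
proof -
  obtain \<psi> \<phi> where *: "u = vt \<psi> \<phi> (-1)" "right_sol y (-1) \<psi> \<phi>" using assms unfolding EM_def by blast
  then have "right_sol y (int n - 1) \<psi> \<phi>" by (auto simp: right_sol_def)
  then have "vt \<psi> \<phi> (int n - 1) \<in> EM y (int n - 1)" unfolding EM_def by blast
  then show ?thesis using cocycle_right[OF *(2), of n] * subspace_EM by (simp add: vec.subspace_scale)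
qed

lemma cocycle_EP_nonzero:
  assumes "u \<in> EP y (-1)" "u \<noteq> 0" shows "cocycle T A n y *v u \<noteq> 0"
proof (induction n)
  case 0 show ?case using assms by simp
next
  case (Suc n)
  have "A (pt y (int n)) *v (cocycle T A n y *v u) \<noteq> 0"
    by (rule A_nonzero_on_EP[OF cocycle_EP[OF assms(1)] Suc])
  then show ?case by (simp add: iter_int_of_nat matrix_vector_mul_assoc)
qed

lemma dominated: "dominated_splitting T A"
proof -
  \<comment> \<open>Chosen so that the decay factor \<open>s\<close> over \<open>N\<close> steps is
    below 1.\<close>
  define N where "N = nat \<lceil>(C + 1)\<^sup>2\<rceil> + 1"
  define s where "s = (C + 1)\<^sup>2 / real (N + 1)"
  have "(C + 1)\<^sup>2 < real (N + 1)" by (simp add: N_def) linarith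
  then have s: "0 \<le> s" "s < 1" by (auto simp: s_def)
  have dom: "norm (cocycle T A N y *v u) > norm (cocycle T A N y *v v)"
    if u: "u \<in> EP y (-1)" "norm u = 1" and v: "v \<in> EM y (-1)" "norm v = 1" for y u v
  proof -
    obtain \<psi> \<phi> where 1: "v = vt \<psi> \<phi> (-1)" "right_sol y (-1) \<psi> \<phi>" using v unfolding EM_def by blast
    have "(norm (vt \<psi> \<phi> (int N - 1)))\<^sup>2 \<le> s"
      using right_decay[OF 1(2), of N] v(2) by (simp add: 1(1)[symmetric] s_def algebra_simps)
    then have a: "(norm (cocycle T A N y *v v))\<^sup>2 \<le> (cmod (trn N y))\<^sup>2 * s"
      unfolding 1(1) cocycle_right[OF 1(2)] norm_scalar_vec power_mult_distrib by (intro mult_left_mono) auto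
    obtain \<psi>1 \<phi>1 where 2: "u = vt \<psi>1 \<phi>1 (-1)" "left_sol y (-1) \<psi>1 \<phi>1" using u unfolding EP_def by blast
    obtain \<psi>2 \<phi>2 where 3: "left_sol y (int N - 1) \<psi>2 \<phi>2" "vt \<psi>2 \<phi>2 (int N - 1) = cocycle T A N y *v u"
      "vt \<psi>2 \<phi>2 (-1) = trn N y *s u" using cocycle_left[OF 2(2), of N] 2(1) by blast
    have b: "(cmod (trn N y))\<^sup>2 \<le> s * (norm (cocycle T A N y *v u))\<^sup>2"
      using left_decay[OF 3(1), of N] u(2) by (simp add: 3(2,3) norm_scalar_vec s_def)
    \<comment> \<open>In squared norms, the image of \<open>v\<close> is at most
      \<open>s * |trn|^2\<close>, and \<open>|trn|^2\<close> is at most \<open>s\<close> times the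
      image of \<open>u\<close>. If \<open>trn N y = 0\<close>, the image of \<open>v\<close> is 0
      and strictness rests on the image of \<open>u\<close> being nonzero.\<close>
    have pos: "(norm (cocycle T A N y *v u))\<^sup>2 > 0" using cocycle_EP_nonzero[OF u(1), of N] u(2) by force
    have "(cmod (trn N y))\<^sup>2 * s \<le> s * (norm (cocycle T A N y *v u))\<^sup>2 * 1"
      using b s by (intro mult_mono) auto
    also have "\<dots> < 1 * (norm (cocycle T A N y *v u))\<^sup>2" using s pos by simp
    finally have "(norm (cocycle T A N y *v v))\<^sup>2 < (norm (cocycle T A N y *v u))\<^sup>2" using a by simp
    then show ?thesis by (simp add: power_less_imp_less_base)
  qed
  have inter: "EP y (-1) \<inter> EM y (-1) = {0}" for y by (rule EP_EM_inter)
  have sum: "{u + v |u v. u \<in> EP y (-1) \<and> v \<in> EM y (-1)} = UNIV" for y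
  proof -
    have "\<exists>u v. w = u + v \<and> u \<in> EP y (-1) \<and> v \<in> EM y (-1)" for w
      using before_EP[of y w] vec.subspace_neg[OF subspace_EM after_EM[of y w]]
      by (intro exI[of _ "after y w + w"] exI[of _ "- after y w"]) simp
    then show ?thesis by blast
  qed
  have T1: "T y = pt y 1" for y by (simp add: iter_int_def)
  have shift: "EP (T y) (-1) = EP y 0" "EM (T y) (-1) = EM y 0" for y
    using EP_shift[where x = y and j = 1 and k = "-1"] EM_shift[where x = y and j = 1 and k = "-1"]
    by (simp_all add: T1)
  have c1: "cocycle T A (Suc 0) y = A y" for y by simp
  have inv1: "(*v) (A y) ` EP y (-1) \<subseteq> EP (T y) (-1)" "(*v) (A y) ` EM y (-1) \<subseteq> EM (T y) (-1)" for y
    unfolding shift using cocycle_EP[where n = "Suc 0" and y = y] cocycle_EM[where n = "Suc 0" and y = y]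
    unfolding c1 by (simp_all add: image_subset_iff)
  have "N \<ge> 1" by (simp add: N_def)
  show ?thesis
    unfolding dominated_splitting_def
  proof (intro exI conjI allI)
    show "continuous_map euclidean projective_line (\<lambda>y. EP y (-1))" by (rule continuous_EP)
    show "continuous_map euclidean projective_line (\<lambda>y. EM y (-1))" by (rule continuous_EM)
    show "1 \<le> N" by fact
  qed (use inter sum inv1 dom in blast)+
qed

end

section \<open>From a dominated splitting to a lower bound\<close>

text \<open>The symplectic form. It vanishes exactly on parallel vectors, so it reads off the
  component along one line while ignoring the other; on unit vectors its modulus is the sine of the
  angle.\<close>

definition wedge :: "complex^2 \<Rightarrow> complex^2 \<Rightarrow> complex" where
  "wedge u v = u $ 1 * v $ 2 - u $ 2 * v $ 1"

lemma wedge_linear: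
  "wedge (u + u') v = wedge u v + wedge u' v" "wedge u (v + v') = wedge u v + wedge u v'"
  "wedge (u - u') v = wedge u v - wedge u' v" "wedge u (v - v') = wedge u v - wedge u v'"
  "wedge (s *s u) v = s * wedge u v" "wedge u (s *s v) = s * wedge u v"
  "wedge u u = 0"
  by (simp_all add: wedge_def algebra_simps)

lemma wedge_matrix: "wedge (B *v u) (B *v v) = det B * wedge u v"
  by (simp add: wedge_def matrix_vector_mult_def sum_2 det_2 algebra_simps)

lemma cmod_wedge_le: "cmod (wedge u v) \<le> norm u * norm v"
proof -
  have "cmod (wedge u v) \<le> cmod (u $ 1) * cmod (v $ 2) + cmod (u $ 2) * cmod (v $ 1)"
    unfolding wedge_def using norm_triangle_ineq4 by (metis norm_mult)
  also have "\<dots> \<le> sqrt ((cmod (u $ 1))\<^sup>2 + (cmod (u $ 2))\<^sup>2) * sqrt ((cmod (v $ 2))\<^sup>2 + (cmod (v $ 1))\<^sup>2)"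
  proof -
    have "(a * c + b * d)\<^sup>2 \<le> (a\<^sup>2 + b\<^sup>2) * (c\<^sup>2 + d\<^sup>2)" for a b c d :: real
      using zero_le_power2[of "a * d - b * c"] by (simp add: power2_eq_square algebra_simps)
    then show ?thesis unfolding real_sqrt_mult[symmetric] by (rule real_le_rsqrt)
  qed
  also have "\<dots> = norm u * norm v"
    using norm_complex_2[of u] norm_complex_2[of v] by (metis add.commute norm_ge_zero real_sqrt_unique)
  finally show ?thesis .
qed

lemma wedge_expand: "wedge p q *s u = wedge u q *s p - wedge u p *s q"
  by (simp add: wedge_def vec_eq_iff forall_2 algebra_simps)

lemma wedge_zero_span:
  assumes "wedge u v = 0" "u \<noteq> 0" shows "v \<in> vec.span {u}"
proof -
  have "\<exists>s. v = s *s u"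
  proof (cases "u $ 1 = 0")
    case True
    then have "v = (v $ 2 / u $ 2) *s u"
      using assms by (auto simp: wedge_def vec_eq_iff forall_2)
    then show ?thesis ..
  next
    case False
    then have "v = (v $ 1 / u $ 1) *s u"
      using assms by (auto simp: wedge_def vec_eq_iff forall_2 field_simps)
    then show ?thesis ..
  qed
  then show ?thesis by (metis vec.span_base vec.span_scale singletonI)
qed

section \<open>Contracting recursions for square-summable sequences\<close>

lemma ell2_even_odd:
  assumes "\<psi> \<in> ell2"
  shows "ell2_norm \<psi> \<le> ell2_norm (\<lambda>k. \<psi> (2 * k - 2)) + ell2_norm (\<lambda>k. \<psi> (2 * k - 1))"
proof -
  let ?a = "\<lambda>k. \<psi> (2 * k - 2)" and ?b = "\<lambda>k. \<psi> (2 * k - 1)"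
  have "?a \<in> ell2" by (rule ell2_reindex[OF assms]) (simp add: inj_on_def)
  then obtain a where a: "((\<lambda>k. (cmod (?a k))\<^sup>2) has_sum a) UNIV" unfolding ell2_def summable_on_def by blast
  have "?b \<in> ell2" by (rule ell2_reindex[OF assms]) (simp add: inj_on_def)
  then obtain b where b: "((\<lambda>k. (cmod (?b k))\<^sup>2) has_sum b) UNIV" unfolding ell2_def summable_on_def by blast
  have "((\<lambda>k. (cmod (\<psi> (2 * k + (-2))))\<^sup>2 + (cmod (\<psi> (2 * k + (-2) + 1)))\<^sup>2) has_sum (a + b)) UNIV"
    using has_sum_add[OF a b] by simp
  then have "((\<lambda>n. (cmod (\<psi> n))\<^sup>2) has_sum (a + b)) UNIV" by (subst has_sum_split_int[where s = "-2"]) auto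
  then have "ell2_norm \<psi> = sqrt (a + b)" by (simp add: ell2_norm_def infsumI)
  moreover have "ell2_norm ?a = sqrt a" "ell2_norm ?b = sqrt b"
    using infsumI[OF a] infsumI[OF b] by (simp_all add: ell2_norm_def)
  moreover have "0 \<le> a" "0 \<le> b" using has_sum_nonneg[OF a] has_sum_nonneg[OF b] by auto
  ultimately show ?thesis using sqrt_add_le_add_sqrt by simp
qed

lemma ell2_scaled_reindex:
  assumes "\<psi> \<in> ell2" "inj s" "0 \<le> r"
  shows "(\<lambda>k. of_real r * \<psi> (s k)) \<in> ell2" "ell2_norm (\<lambda>k. of_real r * \<psi> (s k)) \<le> r * ell2_norm \<psi>"
proof -
  note re = ell2_reindex[OF assms(1,2)]
  show "(\<lambda>k. of_real r * \<psi> (s k)) \<in> ell2" by (rule ell2_scale(1)[OF re(1)])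
  have "ell2_norm (\<lambda>k. of_real r * \<psi> (s k)) = r * ell2_norm (\<lambda>k. \<psi> (s k))"
    unfolding ell2_scale(2)[OF re(1)] using assms(3) by simp
  then show "ell2_norm (\<lambda>k. of_real r * \<psi> (s k)) \<le> r * ell2_norm \<psi>"
    using mult_left_mono[OF re(2) assms(3)] by simp
qed

text \<open>Single factors \<open>\<kappa> k\<close> may exceed 1; only windows of length
  \<open>n\<close> contract. Iterating \<open>n\<close> times collects errors with weights
  \<open>K0 ^ i\<close> and leaves
  \<open>ell2_norm s \<le> ell2_norm s / 2 + ell2_norm \<theta>\<close>, where the first term is
  absorbed since \<open>s\<close> is known to be in \<open>ell2\<close>.\<close>

lemma ell2_recursion_bound:
  fixes \<kappa> :: "int \<Rightarrow> real"
  assumes s: "s \<in> ell2" and \<eta>: "\<eta> \<in> ell2" and \<kappa>: "\<And>k. 0 \<le> \<kappa> k" "\<And>k. \<kappa> k \<le> K0"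
    and rec: "\<And>k. cmod (s (k + 1)) \<le> \<kappa> k * cmod (s k) + cmod (\<eta> k)"
    and window: "\<And>k. (\<Prod>i<n. \<kappa> (k + int i)) \<le> 1 / 2"
  shows "ell2_norm s \<le> 2 * (\<Sum>i<n. K0 ^ i) * ell2_norm \<eta>"
proof -
  have K0: "0 \<le> K0" using order_trans[OF \<kappa>(1) \<kappa>(2)] .
  have inj: "inj (\<lambda>k::int. k + c)" "inj (\<lambda>k::int. k - c)" for c by (auto simp: inj_on_def)
  have "\<exists>\<theta>\<in>ell2. ell2_norm \<theta> \<le> (\<Sum>i<m. K0 ^ i) * ell2_norm \<eta> \<and>
      (\<forall>k. cmod (s (k + int m)) \<le> (\<Prod>i<m. \<kappa> (k + int i)) * cmod (s k) + cmod (\<theta> k))" for m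
  proof (induction m)
    case 0
    show ?case by (rule bexI[of _ "\<lambda>n. 0"]) auto
  next
    case (Suc m)
    then obtain \<theta> where \<theta>: "\<theta> \<in> ell2" "ell2_norm \<theta> \<le> (\<Sum>i<m. K0 ^ i) * ell2_norm \<eta>"
      "\<And>k. cmod (s (k + int m)) \<le> (\<Prod>i<m. \<kappa> (k + int i)) * cmod (s k) + cmod (\<theta> k)" by blast
    define \<theta>' where "\<theta>' k = complex_of_real (K0 * cmod (\<theta> k) + cmod (\<eta> (k + int m)))" for k
    have c\<theta>': "cmod (\<theta>' k) = K0 * cmod (\<theta> k) + cmod (\<eta> (k + int m))" for k
      using K0 by (simp add: \<theta>'_def del: of_real_add of_real_mult)
    have sh: "(\<lambda>k. \<eta> (k + int m)) \<in> ell2" "ell2_norm (\<lambda>k. \<eta> (k + int m)) \<le> ell2_norm \<eta>"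
      by (rule ell2_reindex[OF \<eta> inj(1)])+
    have sc: "(\<lambda>k. of_real K0 * \<theta> k) \<in> ell2" "ell2_norm (\<lambda>k. of_real K0 * \<theta> k) = K0 * ell2_norm \<theta>"
      using ell2_scale[OF \<theta>(1), of "of_real K0"] K0 by simp_all
    have dom: "cmod (\<theta>' k) \<le> cmod (of_real K0 * \<theta> k) + cmod (\<eta> (k + int m))" for k
      using K0 by (simp add: c\<theta>' norm_mult)
    have mem: "\<theta>' \<in> ell2" by (rule ell2_dominated2(1)[OF sc(1) sh(1) dom])
    have "ell2_norm \<theta>' \<le> K0 * ell2_norm \<theta> + ell2_norm \<eta>"
      using ell2_dominated2(2)[OF sc(1) sh(1) dom] sc(2) sh(2) by linarith
    also have "\<dots> \<le> K0 * ((\<Sum>i<m. K0 ^ i) * ell2_norm \<eta>) + ell2_norm \<eta>"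
      using \<theta>(2) K0 by (intro add_mono mult_left_mono) auto
    also have "\<dots> = (\<Sum>i<Suc m. K0 ^ i) * ell2_norm \<eta>"
      by (subst sum.lessThan_Suc_shift) (simp add: sum_distrib_left algebra_simps)
    finally have norm: "ell2_norm \<theta>' \<le> (\<Sum>i<Suc m. K0 ^ i) * ell2_norm \<eta>" .
    have "cmod (s (k + int (Suc m))) \<le> (\<Prod>i<Suc m. \<kappa> (k + int i)) * cmod (s k) + cmod (\<theta>' k)" for k
    proof -
      have "cmod (s (k + int (Suc m))) \<le> \<kappa> (k + int m) * cmod (s (k + int m)) + cmod (\<eta> (k + int m))"
        using rec[of "k + int m"] by (simp add: algebra_simps)
      also have "\<kappa> (k + int m) * cmod (s (k + int m)) \<le>
          \<kappa> (k + int m) * ((\<Prod>i<m. \<kappa> (k + int i)) * cmod (s k) + cmod (\<theta> k))"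
        by (rule mult_left_mono[OF \<theta>(3) \<kappa>(1)])
      also have "\<dots> \<le> (\<Prod>i<Suc m. \<kappa> (k + int i)) * cmod (s k) + K0 * cmod (\<theta> k)"
        using mult_right_mono[OF \<kappa>(2), of "cmod (\<theta> k)" "k + int m"] by (simp add: algebra_simps)
      finally show ?thesis by (simp add: c\<theta>')
    qed
    then show ?case using mem norm by blast
  qed
  then obtain \<theta> where \<theta>: "\<theta> \<in> ell2" "ell2_norm \<theta> \<le> (\<Sum>i<n. K0 ^ i) * ell2_norm \<eta>"
    "\<And>k. cmod (s (k + int n)) \<le> (\<Prod>i<n. \<kappa> (k + int i)) * cmod (s k) + cmod (\<theta> k)" by blast
  have half: "(\<lambda>k. (1/2) * s k) \<in> ell2" "ell2_norm (\<lambda>k. (1/2) * s k) = 1/2 * ell2_norm s"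
    using ell2_scale[OF s, of "1/2"] by simp_all
  have dom: "cmod (s (k + int n)) \<le> cmod ((1/2) * s k) + cmod (\<theta> k)" for k
    using order_trans[OF \<theta>(3) add_right_mono[OF mult_right_mono[OF window norm_ge_zero]]]
    by (simp add: norm_mult)
  have "ell2_norm s = ell2_norm (\<lambda>k. s (k - int n + int n))" by simp
  also have "\<dots> \<le> ell2_norm (\<lambda>k. s (k + int n))"
    by (rule ell2_reindex(2)[OF ell2_dominated2(1)[OF half(1) \<theta>(1) dom] inj(2)])
  also have "\<dots> \<le> 1/2 * ell2_norm s + ell2_norm \<theta>"
    using ell2_dominated2(2)[OF half(1) \<theta>(1) dom] half(2) by simp
  finally show ?thesis using \<theta>(2) by simp
qed

lemma ell2_backward_recursion_bound:
  fixes \<kappa> :: "int \<Rightarrow> real"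
  assumes s: "s \<in> ell2" and \<eta>: "\<eta> \<in> ell2" and \<kappa>: "\<And>k. 0 \<le> \<kappa> k" "\<And>k. \<kappa> k \<le> K0"
    and rec: "\<And>k. cmod (s k) \<le> \<kappa> k * cmod (s (k + 1)) + cmod (\<eta> k)"
    and window: "\<And>k. (\<Prod>i<n. \<kappa> (k + int i)) \<le> 1 / 2"
  shows "ell2_norm s \<le> 2 * (\<Sum>i<n. K0 ^ i) * ell2_norm \<eta>"
proof -
  have inj: "inj (\<lambda>k::int. - k)" "inj (\<lambda>k::int. - k - 1)" by (auto simp: inj_on_def)
  have K0: "0 \<le> K0" using order_trans[OF \<kappa>(1) \<kappa>(2)] .
  have s': "(\<lambda>k. s (- k)) \<in> ell2" by (rule ell2_reindex[OF s inj(1)])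
  have \<eta>': "(\<lambda>k. \<eta> (- k - 1)) \<in> ell2" "ell2_norm (\<lambda>k. \<eta> (- k - 1)) \<le> ell2_norm \<eta>"
    by (rule ell2_reindex[OF \<eta> inj(2)])+
  have "(\<Prod>i<n. \<kappa> (- (k + int i) - 1)) \<le> 1 / 2" for k
  proof -
    \<comment> \<open>The reflection runs through a window backwards; reversing the product turns it
      into the window that begins at \<open>- k - int n\<close>.\<close>
    have "(\<Prod>i<n. \<kappa> (- (k + int i) - 1)) = (\<Prod>i<n. \<kappa> ((- k - int n) + int (n - Suc i)))"
      by (rule prod.cong) (auto simp: of_nat_diff algebra_simps)
    also have "\<dots> = (\<Prod>i<n. \<kappa> ((- k - int n) + int i))" by (rule prod.nat_diff_reindex)
    also have "\<dots> \<le> 1 / 2" by (rule window)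
    finally show ?thesis .
  qed
  then have "ell2_norm (\<lambda>k. s (- k)) \<le> 2 * (\<Sum>i<n. K0 ^ i) * ell2_norm (\<lambda>k. \<eta> (- k - 1))"
    using rec[of "- k - 1" for k] \<kappa>
    by (intro ell2_recursion_bound[OF s' \<eta>'(1), where \<kappa> = "\<lambda>k. \<kappa> (- k - 1)"]) (auto simp: algebra_simps)
  also have "\<dots> \<le> 2 * (\<Sum>i<n. K0 ^ i) * ell2_norm \<eta>"
    using \<eta>'(2) K0 by (intro mult_left_mono mult_nonneg_nonneg sum_nonneg) auto
  also have "ell2_norm s = ell2_norm (\<lambda>k. (\<lambda>k. s (- k)) (- k))" by simp
  moreover have "\<dots> \<le> ell2_norm (\<lambda>k. s (- k))" by (rule ell2_reindex(2)[OF s' inj(1)])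
  ultimately show ?thesis by linarith
qed

section \<open>Links read backwards and tested by the symplectic form\<close>

context cmv_energy
begin

lemma W_le_D: "cmod (W y) \<le> cmod (D y)"
proof -
  have "complex_of_real ((cmod (D y))\<^sup>2 - (cmod (W y))\<^sup>2) = complex_of_real ((cmod (tr y))\<^sup>2)"
    using D_W[of y] by (simp only: of_real_diff complex_norm_square)
  then have "(cmod (D y))\<^sup>2 - (cmod (W y))\<^sup>2 = (cmod (tr y))\<^sup>2" by (simp only: of_real_eq_iff)
  then have "(cmod (W y))\<^sup>2 \<le> (cmod (D y))\<^sup>2" using zero_le_power2[of "cmod (tr y)"] by linarith
  then show ?thesis by (rule power2_le_imp_le) simp
qed

lemma det_A: "det (A y) = tr y * cnj (tr y)"
  using D_W[of y] by (simp add: det_2 A_entries mult.commute)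

lemma cmod_D_le: "cmod (D y) \<le> 2"
proof -
  have "cmod (D y) \<le> cmod z + cmod (cnj (af y) * ag y)" unfolding D_def by (rule norm_triangle_ineq)
  also have "\<dots> \<le> 1 + 1 * 1" unfolding norm_mult complex_mod_cnj zn
    by (intro add_mono mult_mono coeff_le_1) auto
  finally show ?thesis by simp
qed

text \<open>The coefficients form the adjugate of \<open>A\<close>. Since \<open>tr\<close> may be
  0, inverting \<open>A\<close> in \<open>link_forward\<close> is not an option; the link is solved
  anew from right to left, clearing \<open>cnj (rf y)\<close> first and \<open>cnj (rg y)\<close>
  second.\<close>

lemma link_backward:
  assumes "link y h1 h2 a b c p q r"
  shows "cnj (tr y) * (z * a) = D y * (z * c) - W y * r + (D y * h2 - ag y * cnj (rf y) * h1)"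
    "cnj (tr y) * p = - cnj (W y) * (z * c) + cnj (D y) * r + (- cnj (W y) * h2 - cnj z * cnj (rf y) * h1)"
proof -
  define \<alpha> \<beta> \<gamma> \<delta> \<alpha>' \<beta>' \<gamma>' \<delta>' z' where v: "\<alpha> = af y" "\<beta> = rf y" "\<gamma> = ag y" "\<delta> = rg y"
    "\<alpha>' = cnj (af y)" "\<beta>' = cnj (rf y)" "\<gamma>' = cnj (ag y)" "\<delta>' = cnj (rg y)" "z' = cnj z"
  have e: "z * z' = 1" "\<alpha> * \<alpha>' + \<beta> * \<beta>' = 1" "\<gamma> * \<gamma>' + \<delta> * \<delta>' = 1"
    using z_cnj(1) coeff_norm_cnj[of y] by (simp_all add: v)
  have l: "p = \<gamma>' * a + \<delta> * b" "q = \<delta>' * a - \<gamma> * b" "z * b + h1 = \<alpha>' * q + \<beta> * r"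
    "z * c + h2 = \<beta>' * q - \<alpha> * r"
    using assms by (simp_all add: link_def v)
  have q: "\<beta>' * q = z * c + h2 + \<alpha> * r" using l by simp
  have b: "\<beta>' * (z * b) = \<alpha>' * (z * c) + r + \<alpha>' * h2 - \<beta>' * h1" using l e by algebra
  have a: "\<delta>' * a = q + \<gamma> * b" using l by simp
  have p: "\<delta>' * p = \<gamma>' * q + b" using l e by algebra
  have "\<beta>' * \<delta>' * (z * a) = z * (\<beta>' * q) + \<gamma> * (\<beta>' * (z * b))" using a by algebra
  also have "\<dots> = (z + \<alpha>' * \<gamma>) * (z * c) - (- z * \<alpha> - \<gamma>) * r + ((z + \<alpha>' * \<gamma>) * h2 - \<gamma> * \<beta>' * h1)"
    unfolding q b by algebra
  finally show "cnj (tr y) * (z * a) = D y * (z * c) - W y * r + (D y * h2 - ag y * cnj (rf y) * h1)"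
    by (simp add: D_def W_def tr_def v)
  have "\<beta>' * \<delta>' * p = \<gamma>' * (\<beta>' * q) + z' * (\<beta>' * (z * b))" using p e(1) by algebra
  also have "\<dots> = - (- z' * \<alpha>' - \<gamma>') * (z * c) + (z' + \<alpha> * \<gamma>') * r + (- (- z' * \<alpha>' - \<gamma>') * h2 - z' * \<beta>' * h1)"
    unfolding q b by algebra
  finally show "cnj (tr y) * p = - cnj (W y) * (z * c) + cnj (D y) * r + (- cnj (W y) * h2 - cnj z * cnj (rf y) * h1)"
    by (simp add: D_def W_def tr_def v)
qed

text \<open>Eliminating \<open>q\<close> yields the odd entry from its even neighbours; the vectors
  \<open>vt\<close> see even indices only.\<close>

lemma link_middle:
  assumes "link y h1 h2 a b c p q r"
  shows "D y * b = cnj (af y) * cnj (rg y) * a + rf y * r - h1"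
proof -
  have alg: "(z + w * y) * b = w * x * a + v * r - h1" if "q = x * a - y * b" "z * b + h1 = w * q + v * r"
    for w x y v :: complex
    using that by algebra
  show ?thesis unfolding D_def by (rule alg) (use assms in \<open>auto simp: link_def\<close>)
qed

text \<open>Both relations of a link between neighbouring vectors are tested against a vector by the symplectic form,
  for which \<open>adj A\<close> is the transpose of \<open>A\<close>.\<close>

lemma link_wedge:
  assumes "link y h1 h2 a b c p q r"
  defines "u \<equiv> vector [z * a, p]" and "v \<equiv> vector [z * c, r]"
  shows "cmod (cnj (tr y) * wedge u e - wedge v (A y *v e)) \<le> 4 * (cmod h1 + cmod h2) * norm e"
    "cmod (tr y * wedge v e - wedge (A y *v u) e) \<le> 4 * (cmod h1 + cmod h2) * norm e"
proof -
  \<comment> \<open>\<open>d\<close> is the inhomogeneous part of \<open>link_backward\<close>; each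
    coordinate has two coefficients of modulus at most 2.\<close>
  define d :: "complex^2" where "d = vector [D y * h2 - ag y * cnj (rf y) * h1, - cnj (W y) * h2 - cnj z * cnj (rf y) * h1]"
  have bd: "cmod x * cmod y \<le> 2 * cmod y" if "cmod x \<le> 2" for x y :: complex
    using that by (intro mult_right_mono) auto
  have le1: "cmod (x * x') \<le> 2" if "cmod x \<le> 1" "cmod x' \<le> 1" for x x' :: complex
    using mult_mono[OF that] by (simp add: norm_mult)
  have le2: "cmod (- x) \<le> 2" if "cmod x \<le> 2" for x :: complex using that by simp
  have h: "cmod (x * h2 - x' * h1) \<le> 2 * (cmod h1 + cmod h2)" if "cmod x \<le> 2" "cmod x' \<le> 2" for x x'
    using norm_triangle_ineq4[of "x * h2" "x' * h1"] bd[OF that(1), of h2] bd[OF that(2), of h1] by (simp add: norm_mult)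
  have W2: "cmod (W y) \<le> 2" using W_le_D[of y] cmod_D_le[of y] by simp
  have "cmod (d $ 1) \<le> 2 * (cmod h1 + cmod h2)"
    unfolding d_def vector_2 by (rule h[OF cmod_D_le le1[OF coeff_le_1(3)]]) (simp add: coeff_le_1)
  moreover have "cmod (d $ 2) \<le> 2 * (cmod h1 + cmod h2)"
    unfolding d_def vector_2 by (rule h[OF le2 le1]) (simp_all add: W2 zn coeff_le_1)
  ultimately have d: "norm d \<le> 4 * (cmod h1 + cmod h2)" using norm_complex_2_le[of d] by linarith
  have "cnj (tr y) * wedge u e - wedge v (A y *v e) =
      (cnj (tr y) * (z * a)) * e $ 2 - (cnj (tr y) * p) * e $ 1 - wedge v (A y *v e)"
    by (simp add: wedge_def u_def algebra_simps)
  also have "\<dots> = wedge d e"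
    unfolding link_backward[OF assms(1)] by (simp add: wedge_def d_def v_def A_mult algebra_simps)
  finally show "cmod (cnj (tr y) * wedge u e - wedge v (A y *v e)) \<le> 4 * (cmod h1 + cmod h2) * norm e"
    using order_trans[OF cmod_wedge_le mult_right_mono[OF d norm_ge_zero]] by simp
  define d' :: "complex^2" where "d' = vector [- (rg y * af y * h1 + rg y * rf y * h2), rg y * h1]"
  have "cmod (rg y * af y * h1 + rg y * rf y * h2) \<le> 2 * (cmod h1 + cmod h2)"
    using norm_triangle_ineq[of "rg y * af y * h1" "rg y * rf y * h2"]
      bd[OF le1[OF coeff_le_1(4)[of y] coeff_le_1(1)[of y]], of h1] bd[OF le1[OF coeff_le_1(4)[of y] coeff_le_1(2)[of y]], of h2]
    by (simp add: norm_mult)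
  moreover have "cmod (rg y * h1) \<le> 2 * (cmod h1 + cmod h2)"
  proof -
    have "cmod (rg y) \<le> 2" using coeff_le_1(4)[of y] by linarith
    from bd[OF this, of h1] have "cmod (rg y * h1) \<le> 2 * cmod h1" by (simp only: norm_mult)
    also have "\<dots> \<le> 2 * (cmod h1 + cmod h2)" by simp
    finally show ?thesis .
  qed
  ultimately have "cmod (d' $ 1) \<le> 2 * (cmod h1 + cmod h2)" "cmod (d' $ 2) \<le> 2 * (cmod h1 + cmod h2)"
    unfolding d'_def vector_2 norm_minus_cancel by blast+
  then have d': "norm d' \<le> 4 * (cmod h1 + cmod h2)" using norm_complex_2_le[of d'] by linarith
  have "tr y * wedge v e - wedge (A y *v u) e =
      (tr y * (z * c)) * e $ 2 - (tr y * r) * e $ 1 - wedge (A y *v u) e"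
    by (simp add: wedge_def v_def algebra_simps)
  also have "\<dots> = wedge d' e"
    unfolding link_forward[OF assms(1)] by (simp add: wedge_def d'_def u_def A_mult algebra_simps)
  finally show "cmod (tr y * wedge v e - wedge (A y *v u) e) \<le> 4 * (cmod h1 + cmod h2) * norm e"
    using order_trans[OF cmod_wedge_le mult_right_mono[OF d' norm_ge_zero]] by simp
qed

end

text \<open>The quantitative content of a dominated splitting: unit vectors chosen pointwise, and
  uniform constants. The window concerns \<open>|tr| / |a|\<close>, the factor of the scalar
  recursions, rather than \<open>|b| / |a|\<close>, which compares the two lines.\<close>

locale cmv_splitting = cmv_energy +
  fixes ep em :: "'a \<Rightarrow> complex^2" and a b :: "'a \<Rightarrow> complex" and c a0 :: real and n :: nat
  assumes unit: "norm (ep y) = 1" "norm (em y) = 1"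
    and eigen: "A y *v ep y = a y *s ep (T y)" "A y *v em y = b y *s em (T y)"
    and angle: "c > 0" "cmod (wedge (ep y) (em y)) \<ge> c"
    and a_lower: "a0 > 0" "cmod (a y) \<ge> a0"
    and window: "(\<Prod>i<n. cmod (tr ((T ^^ i) y)) / cmod (a ((T ^^ i) y))) \<le> 1 / 2"
begin

text \<open>No entry of \<open>A\<close> exceeds \<open>|D|\<close> in modulus, so a small
  \<open>D y\<close> would make \<open>A y\<close> small on \<open>ep y\<close>; the four entries
  account for the 4.\<close>

lemma D_lower: "cmod (D y) \<ge> a0 / 4"
proof -
  have u: "cmod (ep y $ i) \<le> 1" for i using Finite_Cartesian_Product.norm_nth_le[of "ep y" i] unit by simp
  have t: "cmod (p * ep y $ 1 + q * ep y $ 2) \<le> 2 * cmod (D y)" if "cmod p \<le> cmod (D y)" "cmod q \<le> cmod (D y)" for p q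
  proof -
    have "cmod p * cmod (ep y $ 1) \<le> cmod (D y) * 1" "cmod q * cmod (ep y $ 2) \<le> cmod (D y) * 1"
      by (intro mult_mono u that; simp)+
    then show ?thesis using norm_triangle_ineq[of "p * ep y $ 1" "q * ep y $ 2"] by (simp add: norm_mult)
  qed
  have "norm (A y *v ep y) \<le> 4 * cmod (D y)"
    using norm_complex_2_le[of "A y *v ep y"] t[of "cnj (D y)" "W y"] t[of "cnj (W y)" "D y"] W_le_D[of y]
    unfolding A_mult by simp
  then show ?thesis using a_lower(2)[of y] unit by (simp add: eigen norm_scalar_vec)
qed

definition "\<kappa> y = cmod (tr y) / cmod (a y)"

lemma \<kappa>_bounds: "0 \<le> \<kappa> y" "\<kappa> y \<le> 1 / a0"
proof -
  have "cmod (tr y) \<le> 1" using mult_mono[OF coeff_le_1(2,4)[of y]] by (simp add: tr_def norm_mult)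
  then show "0 \<le> \<kappa> y" "\<kappa> y \<le> 1 / a0" using a_lower by (auto simp: \<kappa>_def intro!: frac_le)
qed

lemma window_\<kappa>: "(\<Prod>i<n. \<kappa> (pt x (k + int i))) \<le> 1 / 2"
proof -
  have "pt x (k + int i) = (T ^^ i) (pt x k)" for i
    using iter_int_add[OF bij, of "int i" k x] by (simp add: iter_int_of_nat add.commute)
  then show ?thesis using window[of "pt x k"] by (simp add: \<kappa>_def)
qed

lemma bounded_below: "\<exists>K>0. \<forall>\<psi>\<in>ell2. ell2_norm \<psi> \<le> K * ell2_norm (\<lambda>n. E x \<psi> n - z * \<psi> n)"
proof -
  \<comment> \<open>\<open>G\<close> is the constant of the recursion lemmas for factors at most
    \<open>1 / a0\<close>. The 8 is the 4 of \<open>link_wedge\<close>, for the odd and the even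
    entries of \<open>h\<close>; each \<open>1 / c\<close> pays for a division by the angle;
    \<open>Co\<close> recovers odd entries through \<open>D_lower\<close>, from two even ones and
    one of \<open>h\<close>.\<close>
  define G where "G = 2 * (\<Sum>i<n. (1 / a0) ^ i)"
  have G: "0 \<le> G" using a_lower by (auto simp: G_def intro!: sum_nonneg)
  define Cs where "Cs = G * (8 / a0)"
  define Ct where "Ct = G * (8 / (a0 * c))"
  define Cu where "Cu = Ct + Cs / c"
  define Co where "Co = (4 / a0) * (2 * Cu + 1)"
  have nn: "0 \<le> Cs" "0 \<le> Ct" "0 \<le> Cu" "0 \<le> Co"
    using G a_lower angle by (auto simp: Cs_def Ct_def Cu_def Co_def)
  have "ell2_norm \<psi> \<le> (Cu + Co + 1) * ell2_norm (\<lambda>n. E x \<psi> n - z * \<psi> n)" if \<psi>: "\<psi> \<in> ell2" for \<psi>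
  proof -
    define h where "h = (\<lambda>n. E x \<psi> n - z * \<psi> n)"
    define \<phi> where "\<phi> = M x \<psi>"
    have h: "h \<in> ell2" unfolding h_def using \<psi> E_isometry by (intro ell2_diff ell2_scale) auto
    have \<phi>: "\<phi> \<in> ell2" unfolding \<phi>_def using \<psi> M_isometry by blast
    have inj: "inj (\<lambda>k::int. 2 * k - 2)" "inj (\<lambda>k::int. 2 * k - 1)" "inj (\<lambda>k::int. 2 * k)" "inj (\<lambda>k::int. k + 1)"
      by (auto simp: inj_on_def)
    define u where "u k = vt \<psi> \<phi> (k - 1)" for k
    have lk: "link (pt x k) (h (2 * k - 1)) (h (2 * k)) (\<psi> (2 * k - 2)) (\<psi> (2 * k - 1)) (\<psi> (2 * k))
        (\<phi> (2 * k - 2)) (\<phi> (2 * k - 1)) (\<phi> (2 * k))" for k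
      using link_at unfolding h_def \<phi>_def .
    have uk: "u k = vector [z * \<psi> (2 * k - 2), \<phi> (2 * k - 2)]" "u (k + 1) = vector [z * \<psi> (2 * k), \<phi> (2 * k)]" for k
      by (simp_all add: u_def vt_def)
    have Tk: "T (pt x k) = pt x (k + 1)" for k using iter_int_succ[OF bij] by simp
    define w where "w k = wedge (ep (pt x k)) (em (pt x k))" for k
    have w: "cmod (w k) \<ge> c" "w k \<noteq> 0" for k using angle(2)[of "pt x k"] angle(1) by (auto simp: w_def)
    \<comment> \<open>Coordinates of \<open>u k\<close> in the splitting: \<open>t k\<close> along
      \<open>ep\<close> and \<open>- s k / w k\<close> along \<open>em\<close>. Testing the backward
      relation with \<open>ep\<close> bounds \<open>s (k + 1)\<close> by \<open>s k\<close>; testing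
      the forward one with \<open>em\<close> bounds \<open>t k\<close> by \<open>t (k + 1)\<close>.
      Either way one divides by \<open>a\<close>.\<close>
    define s where "s k = wedge (u k) (ep (pt x k))" for k
    define t where "t k = wedge (u k) (em (pt x k)) / w k" for k
    have decomp: "w k *s u k = (w k * t k) *s ep (pt x k) - s k *s em (pt x k)" for k
    proof -
      have wt: "w k * t k = wedge (u k) (em (pt x k))" using w(2)[of k] by (simp add: t_def)
      show ?thesis unfolding wt unfolding s_def w_def by (rule wedge_expand)
    qed
    define H where "H k = 4 * (cmod (h (2 * k - 1)) + cmod (h (2 * k)))" for k
    have H0: "0 \<le> H k" for k by (simp add: H_def)
    have a0: "cmod (a y) > 0" for y using a_lower(2)[of y] a_lower(1) by linarith
    have s_rec: "cmod (s (k + 1)) \<le> \<kappa> (pt x k) * cmod (s k) + cmod (of_real (H k / a0))" for k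
    proof -
      have "cmod (cnj (tr (pt x k)) * s k - a (pt x k) * s (k + 1)) \<le> H k"
        using link_wedge(1)[OF lk, of k "ep (pt x k)"]
        by (simp add: uk[symmetric] eigen wedge_linear unit Tk s_def H_def)
      then have "cmod (a (pt x k) * s (k + 1)) \<le> cmod (cnj (tr (pt x k)) * s k) + H k"
        using norm_triangle_ineq2[of "a (pt x k) * s (k + 1)" "cnj (tr (pt x k)) * s k"]
        by (simp add: norm_minus_commute)
      then have "cmod (a (pt x k)) * cmod (s (k + 1)) \<le> cmod (tr (pt x k)) * cmod (s k) + H k"
        by (simp add: norm_mult)
      then have "cmod (s (k + 1)) \<le> \<kappa> (pt x k) * cmod (s k) + H k / cmod (a (pt x k))"
        using a0[of "pt x k"] by (simp add: \<kappa>_def field_simps)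
      also have "H k / cmod (a (pt x k)) \<le> H k / a0"
        using a_lower H0[of k] by (intro frac_le) auto
      also have "H k / a0 = cmod (complex_of_real (H k / a0))"
        using H0[of k] a_lower(1) by (simp only: norm_of_real) simp
      finally show ?thesis by simp
    qed
    have t_rec: "cmod (t k) \<le> \<kappa> (pt x k) * cmod (t (k + 1)) + cmod (of_real (H k / (a0 * c)))" for k
    proof -
      have "w k *s (A (pt x k) *v u k) = A (pt x k) *v (w k *s u k)" by (simp add: vec.scale)
      also have "\<dots> = A (pt x k) *v ((w k * t k) *s ep (pt x k) - s k *s em (pt x k))"
        by (simp only: decomp)
      also have "\<dots> = (w k * t k * a (pt x k)) *s ep (pt x (k + 1)) - (s k * b (pt x k)) *s em (pt x (k + 1))"
        by (simp add: vec.diff vec.scale eigen Tk vector_smult_assoc mult.assoc)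
      finally have eq: "w k *s (A (pt x k) *v u k) =
          (w k * t k * a (pt x k)) *s ep (pt x (k + 1)) - (s k * b (pt x k)) *s em (pt x (k + 1))" .
      have "w k * wedge (A (pt x k) *v u k) (em (pt x (k + 1))) =
          wedge (w k *s (A (pt x k) *v u k)) (em (pt x (k + 1)))" by (simp only: wedge_linear)
      also have "\<dots> = w k * t k * a (pt x k) * w (k + 1)" unfolding eq by (simp add: wedge_linear w_def)
      finally have "w k * wedge (A (pt x k) *v u k) (em (pt x (k + 1))) = w k * t k * a (pt x k) * w (k + 1)" .
      then have "wedge (A (pt x k) *v u k) (em (pt x (k + 1))) = t k * a (pt x k) * w (k + 1)"
        using w(2)[of k] by (simp add: mult.assoc)
      moreover have "wedge (u (k + 1)) (em (pt x (k + 1))) = t (k + 1) * w (k + 1)"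
        using w(2) by (simp add: t_def)
      ultimately have "cmod (tr (pt x k) * (t (k + 1) * w (k + 1)) - t k * a (pt x k) * w (k + 1)) \<le> H k"
        using link_wedge(2)[OF lk, of k "em (pt x (k + 1))"]
        by (simp add: uk[symmetric] unit H_def)
      also have "tr (pt x k) * (t (k + 1) * w (k + 1)) - t k * a (pt x k) * w (k + 1) =
          (tr (pt x k) * t (k + 1) - a (pt x k) * t k) * w (k + 1)" by (simp add: algebra_simps)
      finally have "cmod (tr (pt x k) * t (k + 1) - a (pt x k) * t k) * cmod (w (k + 1)) \<le> H k"
        by (simp add: norm_mult)
      moreover have "cmod (tr (pt x k) * t (k + 1) - a (pt x k) * t k) * c \<le>
          cmod (tr (pt x k) * t (k + 1) - a (pt x k) * t k) * cmod (w (k + 1))"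
        using w(1) by (intro mult_left_mono) auto
      ultimately have "cmod (tr (pt x k) * t (k + 1) - a (pt x k) * t k) * c \<le> H k" by linarith
      then have "cmod (tr (pt x k) * t (k + 1) - a (pt x k) * t k) \<le> H k / c"
        using angle(1) by (simp add: field_simps)
      then have "cmod (a (pt x k) * t k) \<le> cmod (tr (pt x k) * t (k + 1)) + H k / c"
        using norm_triangle_ineq2[of "a (pt x k) * t k" "tr (pt x k) * t (k + 1)"]
        by (simp add: norm_minus_commute)
      then have "cmod (t k) \<le> \<kappa> (pt x k) * cmod (t (k + 1)) + (H k / c) / cmod (a (pt x k))"
        using a0[of "pt x k"] by (simp add: \<kappa>_def norm_mult field_simps)
      also have "(H k / c) / cmod (a (pt x k)) \<le> (H k / c) / a0"
        using a_lower H0[of k] angle(1) by (intro frac_le) auto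
      also have "(H k / c) / a0 = cmod (complex_of_real (H k / (a0 * c)))"
        using H0[of k] a_lower(1) angle(1) by (simp only: norm_of_real) simp
      finally show ?thesis by simp
    qed
    have Hmem: "(\<lambda>k. complex_of_real (H k / d)) \<in> ell2 \<and>
        ell2_norm (\<lambda>k. complex_of_real (H k / d)) \<le> 8 / d * ell2_norm h" if d: "d > 0" for d
    proof -
      have 1: "(\<lambda>k. of_real (4 / d) * h (2 * k - 1)) \<in> ell2"
        "ell2_norm (\<lambda>k. of_real (4 / d) * h (2 * k - 1)) \<le> 4 / d * ell2_norm h"
        using d by (intro ell2_scaled_reindex[OF h inj(2)]; simp)+
      have 2: "(\<lambda>k. of_real (4 / d) * h (2 * k)) \<in> ell2"
        "ell2_norm (\<lambda>k. of_real (4 / d) * h (2 * k)) \<le> 4 / d * ell2_norm h"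
        using d by (intro ell2_scaled_reindex[OF h inj(3)]; simp)+
      have le: "cmod (complex_of_real (H k / d)) \<le> cmod (of_real (4 / d) * h (2 * k - 1)) + cmod (of_real (4 / d) * h (2 * k))" for k
      proof -
        have e1: "cmod (complex_of_real (H k / d)) = H k / d" using H0[of k] d by (simp only: norm_of_real) simp
        have e2: "cmod (complex_of_real (4 / d)) = 4 / d" using d by (simp only: norm_of_real) simp
        show ?thesis unfolding e1 norm_mult e2 unfolding H_def by (simp add: distrib_left add_divide_distrib)
      qed
      show ?thesis using ell2_dominated2[OF 1(1) 2(1) le] 1(2) 2(2) by simp
    qed
    have e\<psi>: "(\<lambda>k. \<psi> (2 * k - 2)) \<in> ell2" and e\<phi>: "(\<lambda>k. \<phi> (2 * k - 2)) \<in> ell2"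
      by (rule ell2_reindex[OF \<psi> inj(1)], rule ell2_reindex[OF \<phi> inj(1)])
    have norm_u: "norm (u k) \<le> cmod (\<psi> (2 * k - 2)) + cmod (\<phi> (2 * k - 2))" for k
      using norm_complex_2_le[of "u k"] by (simp add: uk(1) norm_mult zn)
    have smem: "s \<in> ell2"
    proof (rule ell2_dominated2(1)[OF e\<psi> e\<phi>])
      fix k show "cmod (s k) \<le> cmod (\<psi> (2 * k - 2)) + cmod (\<phi> (2 * k - 2))"
        using order_trans[OF cmod_wedge_le[of "u k" "ep (pt x k)"]] norm_u[of k] unit by (simp add: s_def)
    qed
    have tmem: "t \<in> ell2"
    proof -
      have "(\<lambda>k. t k * of_real c) \<in> ell2"
      proof (rule ell2_dominated2(1)[OF e\<psi> e\<phi>])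
        fix k
        have "cmod (t k) * c \<le> cmod (t k) * cmod (w k)" using w(1) by (intro mult_left_mono) auto
        also have "\<dots> = cmod (wedge (u k) (em (pt x k)))" using w(2)[of k] by (simp add: t_def norm_divide)
        also have "\<dots> \<le> norm (u k)" using cmod_wedge_le[of "u k" "em (pt x k)"] unit by simp
        also note norm_u[of k]
        finally show "cmod (t k * of_real c) \<le> cmod (\<psi> (2 * k - 2)) + cmod (\<phi> (2 * k - 2))"
          using angle(1) by (simp add: norm_mult)
      qed
      from ell2_scale(1)[OF this, of "of_real (1 / c)"] show ?thesis using angle(1) by simp
    qed
    have "ell2_norm s \<le> G * ell2_norm (\<lambda>k. complex_of_real (H k / a0))"
      unfolding G_def
      by (rule ell2_recursion_bound[OF smem conjunct1[OF Hmem[OF a_lower(1)]] \<kappa>_bounds s_rec window_\<kappa>])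
    also have "\<dots> \<le> G * (8 / a0 * ell2_norm h)" using Hmem[OF a_lower(1)] G by (intro mult_left_mono) auto
    finally have s_le: "ell2_norm s \<le> Cs * ell2_norm h" by (simp add: Cs_def)
    have ac: "a0 * c > 0" using a_lower(1) angle(1) by simp
    have "ell2_norm t \<le> G * ell2_norm (\<lambda>k. complex_of_real (H k / (a0 * c)))"
      unfolding G_def
      by (rule ell2_backward_recursion_bound[OF tmem conjunct1[OF Hmem[OF ac]] \<kappa>_bounds t_rec window_\<kappa>])
    also have "\<dots> \<le> G * (8 / (a0 * c) * ell2_norm h)" using Hmem[OF ac] G by (intro mult_left_mono) auto
    finally have t_le: "ell2_norm t \<le> Ct * ell2_norm h" by (simp add: Ct_def)
    have sc: "(\<lambda>k. of_real (1 / c) * s k) \<in> ell2" "ell2_norm (\<lambda>k. of_real (1 / c) * s k) \<le> Cs / c * ell2_norm h"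
    proof -
      have id: "inj (\<lambda>k::int. k)" "0 \<le> 1 / c" using angle(1) by auto
      show "(\<lambda>k. of_real (1 / c) * s k) \<in> ell2" by (rule ell2_scaled_reindex(1)[OF smem id])
      have "1 / c * ell2_norm s \<le> 1 / c * (Cs * ell2_norm h)" by (rule mult_left_mono[OF s_le id(2)])
      then show "ell2_norm (\<lambda>k. of_real (1 / c) * s k) \<le> Cs / c * ell2_norm h"
        using ell2_scaled_reindex(2)[OF smem id] by simp
    qed
    have u_le: "norm (u k) \<le> cmod (t k) + cmod (of_real (1 / c) * s k)" for k
    proof -
      have "norm (w k *s u k) \<le> norm ((w k * t k) *s ep (pt x k)) + norm (s k *s em (pt x k))"
        unfolding decomp by (rule norm_triangle_ineq4)
      then have "cmod (w k) * norm (u k) \<le> cmod (w k) * cmod (t k) + cmod (s k)"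
        by (simp add: norm_scalar_vec unit norm_mult)
      moreover have "cmod (s k) \<le> cmod (w k) * (cmod (s k) / c)"
        using mult_right_mono[OF w(1)[of k], of "cmod (s k) / c"] angle(1) by simp
      ultimately have "cmod (w k) * norm (u k) \<le> cmod (w k) * (cmod (t k) + cmod (s k) / c)"
        by (simp add: distrib_left)
      then have "norm (u k) \<le> cmod (t k) + cmod (s k) / c" using w[of k] by simp
      then show ?thesis using angle(1) by (simp add: norm_mult norm_divide)
    qed
    have c\<psi>: "cmod (\<psi> (2 * k - 2)) \<le> norm (u k)" and c\<phi>: "cmod (\<phi> (2 * k - 2)) \<le> norm (u k)" for k
      using cmod_le_norm_vt(1)[of \<psi> "k - 1" \<phi>] cmod_le_norm_vt(2)[of \<phi> "k - 1" \<psi>] by (simp_all add: u_def)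
    have "ell2_norm (\<lambda>k. \<psi> (2 * k - 2)) \<le> ell2_norm t + ell2_norm (\<lambda>k. of_real (1 / c) * s k)"
      by (rule ell2_dominated2(2)[OF tmem sc(1)]) (use c\<psi> u_le order_trans in blast)
    then have \<psi>_le: "ell2_norm (\<lambda>k. \<psi> (2 * k - 2)) \<le> Cu * ell2_norm h"
      using t_le sc(2) by (simp add: Cu_def algebra_simps)
    have "ell2_norm (\<lambda>k. \<phi> (2 * k - 2)) \<le> ell2_norm t + ell2_norm (\<lambda>k. of_real (1 / c) * s k)"
      by (rule ell2_dominated2(2)[OF tmem sc(1)]) (use c\<phi> u_le order_trans in blast)
    then have \<phi>_le: "ell2_norm (\<lambda>k. \<phi> (2 * k - 2)) \<le> Cu * ell2_norm h"
      using t_le sc(2) by (simp add: Cu_def algebra_simps)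
    have \<phi>': "(\<lambda>k. \<phi> (2 * k)) \<in> ell2" "ell2_norm (\<lambda>k. \<phi> (2 * k)) \<le> Cu * ell2_norm h"
      using ell2_reindex[OF e\<phi> inj(4)] \<phi>_le by simp_all
    let ?q = "complex_of_real (4 / a0)"
    have q: "cmod ?q = 4 / a0" using a_lower(1) by (simp only: norm_of_real) simp
    have odd: "cmod (\<psi> (2 * k - 1)) \<le> cmod (?q * \<psi> (2 * k - 2)) + cmod (of_real (cmod (?q * \<phi> (2 * k)) + cmod (?q * h (2 * k - 1))))" for k
    proof -
      have "D (pt x k) * \<psi> (2 * k - 1) = cnj (af (pt x k)) * cnj (rg (pt x k)) * \<psi> (2 * k - 2) + rf (pt x k) * \<phi> (2 * k) - h (2 * k - 1)"
        by (rule link_middle[OF lk])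
      then have "cmod (D (pt x k)) * cmod (\<psi> (2 * k - 1)) =
          cmod (cnj (af (pt x k)) * cnj (rg (pt x k)) * \<psi> (2 * k - 2) + rf (pt x k) * \<phi> (2 * k) - h (2 * k - 1))"
        by (metis norm_mult)
      also have "\<dots> \<le> cmod (cnj (af (pt x k)) * cnj (rg (pt x k)) * \<psi> (2 * k - 2)) + cmod (rf (pt x k) * \<phi> (2 * k)) + cmod (h (2 * k - 1))"
        by (meson add_right_mono norm_triangle_ineq norm_triangle_ineq4 order_trans)
      also have "\<dots> \<le> 1 * 1 * cmod (\<psi> (2 * k - 2)) + 1 * cmod (\<phi> (2 * k)) + cmod (h (2 * k - 1))"
        unfolding norm_mult complex_mod_cnj by (intro add_mono mult_mono coeff_le_1) auto
      finally have 1: "cmod (D (pt x k)) * cmod (\<psi> (2 * k - 1)) \<le> cmod (\<psi> (2 * k - 2)) + cmod (\<phi> (2 * k)) + cmod (h (2 * k - 1))"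
        by simp
      have "a0 / 4 * cmod (\<psi> (2 * k - 1)) \<le> cmod (D (pt x k)) * cmod (\<psi> (2 * k - 1))"
        by (rule mult_right_mono[OF D_lower norm_ge_zero])
      then have "a0 / 4 * cmod (\<psi> (2 * k - 1)) \<le> cmod (\<psi> (2 * k - 2)) + cmod (\<phi> (2 * k)) + cmod (h (2 * k - 1))"
        using 1 by linarith
      then have "cmod (\<psi> (2 * k - 1)) \<le> 4 / a0 * (cmod (\<psi> (2 * k - 2)) + cmod (\<phi> (2 * k)) + cmod (h (2 * k - 1)))"
        using a_lower(1) by (simp add: field_simps)
      also have "\<dots> = cmod ?q * cmod (\<psi> (2 * k - 2)) + (cmod ?q * cmod (\<phi> (2 * k)) + cmod ?q * cmod (h (2 * k - 1)))"
        unfolding q by (simp add: distrib_left)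
      finally show ?thesis unfolding norm_mult[symmetric]
        by (simp only: norm_of_real abs_of_nonneg add_nonneg_nonneg norm_ge_zero)
    qed
    have q1: "(\<lambda>k. ?q * \<psi> (2 * k - 2)) \<in> ell2" "ell2_norm (\<lambda>k. ?q * \<psi> (2 * k - 2)) \<le> 4 / a0 * (Cu * ell2_norm h)"
      using ell2_scale[OF e\<psi>, of ?q] mult_left_mono[OF \<psi>_le, of "4 / a0"] a_lower(1) unfolding q by auto
    have q2: "(\<lambda>k. ?q * \<phi> (2 * k)) \<in> ell2" "ell2_norm (\<lambda>k. ?q * \<phi> (2 * k)) \<le> 4 / a0 * (Cu * ell2_norm h)"
      using ell2_scale[OF \<phi>'(1), of ?q] mult_left_mono[OF \<phi>'(2), of "4 / a0"] a_lower(1) unfolding q by auto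
    have q3: "(\<lambda>k. ?q * h (2 * k - 1)) \<in> ell2" "ell2_norm (\<lambda>k. ?q * h (2 * k - 1)) \<le> 4 / a0 * ell2_norm h"
      using ell2_scale[OF ell2_reindex(1)[OF h inj(2)], of ?q] mult_left_mono[OF ell2_reindex(2)[OF h inj(2)], of "4 / a0"]
        a_lower(1) unfolding q by auto
    let ?r = "\<lambda>k. complex_of_real (cmod (?q * \<phi> (2 * k)) + cmod (?q * h (2 * k - 1)))"
    have rle: "cmod (?r k) \<le> cmod (?q * \<phi> (2 * k)) + cmod (?q * h (2 * k - 1))" for k
      by (simp only: norm_of_real abs_of_nonneg add_nonneg_nonneg norm_ge_zero order_refl)
    have r: "?r \<in> ell2" "ell2_norm ?r \<le> ell2_norm (\<lambda>k. ?q * \<phi> (2 * k)) + ell2_norm (\<lambda>k. ?q * h (2 * k - 1))"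
      by (rule ell2_dominated2[OF q2(1) q3(1) rle])+
    have "ell2_norm (\<lambda>k. \<psi> (2 * k - 1)) \<le> ell2_norm (\<lambda>k. ?q * \<psi> (2 * k - 2)) + ell2_norm ?r"
      by (rule ell2_dominated2(2)[OF q1(1) r(1) odd])
    also have "\<dots> \<le> 4 / a0 * (Cu * ell2_norm h) + (4 / a0 * (Cu * ell2_norm h) + 4 / a0 * ell2_norm h)"
      using q1(2) r(2) q2(2) q3(2) by linarith
    also have "\<dots> = Co * ell2_norm h" by (simp add: Co_def algebra_simps add_divide_distrib)
    finally have "ell2_norm \<psi> \<le> Cu * ell2_norm h + Co * ell2_norm h"
      using ell2_even_odd[OF \<psi>] \<psi>_le by linarith
    also have "\<dots> \<le> (Cu + Co + 1) * ell2_norm h" by (simp add: algebra_simps)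
    finally show ?thesis unfolding h_def .
  qed
  \<comment> \<open>The summand 1 secures a positive constant.\<close>
  then show ?thesis using nn by (intro exI[of _ "Cu + Co + 1"]) auto
qed

end

section \<open>Constants of a dominated splitting\<close>

text \<open>A vector \<open>u0\<close> off the line \<open>F x0\<close> is separated by an angle:
  the lines making more than a fixed angle with \<open>u0\<close> form an open set, the condition
  being homogeneous in the spanning vector, and no vector near \<open>u0\<close> lies on such a
  line.\<close>

lemma line_field_closed:
  fixes F :: "'a::topological_space \<Rightarrow> (complex^2) set"
  assumes F: "continuous_map euclidean projective_line F"
  shows "closed {(x, u). u \<in> F x}"
proof -
  have line: "F x \<in> complex_lines" for x
    using F unfolding continuous_map_def topspace_projective_line by auto
  have "open (- {(x, u). u \<in> F x})"
  proof (rule open_prod_intro)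
    fix p assume "p \<in> - {(x, u). u \<in> F x}"
    then obtain x0 u0 where p: "p = (x0, u0)" "u0 \<notin> F x0" by (cases p) auto
    obtain w0 where w0: "w0 \<in> F x0" "w0 \<noteq> 0" using complex_line_nonzero line by blast
    have "wedge w0 u0 \<noteq> 0"
      using wedge_zero_span[of w0 u0] w0(2) p(2) complex_line_eq_span[OF line w0] by blast
    \<comment> \<open>Half the normalised wedge: strict at \<open>F x0\<close>, whereas a
      \<open>u\<close> within \<open>e\<close> of \<open>u0\<close> on a line of \<open>U\<close>
      would force \<open>cmod (wedge w u0) \<le> norm w * e\<close>.\<close>
    define e where "e = cmod (wedge w0 u0) / (2 * norm w0)"
    have e: "e > 0" using \<open>wedge w0 u0 \<noteq> 0\<close> w0(2) by (simp add: e_def)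
    define U where "U = {l \<in> complex_lines. \<forall>w\<in>l. w \<noteq> 0 \<longrightarrow> e * norm w < cmod (wedge w u0)}"
    have U: "vec.span {v} \<in> U \<longleftrightarrow> e * norm v < cmod (wedge v u0)" if v: "v \<noteq> 0" for v
    proof
      assume "vec.span {v} \<in> U"
      then show "e * norm v < cmod (wedge v u0)" using v by (simp add: U_def vec.span_base)
    next
      assume lt: "e * norm v < cmod (wedge v u0)"
      have "e * norm w < cmod (wedge w u0)" if w: "w \<in> vec.span {v}" "w \<noteq> 0" for w
      proof -
        obtain s where s: "w = s *s v" using w(1) by (auto simp: vec.span_singleton)
        then have "cmod s > 0" using w(2) by auto
        then have "cmod s * (e * norm v) < cmod s * cmod (wedge v u0)" using lt by simp
        then show ?thesis by (simp add: s norm_scalar_vec wedge_linear norm_mult algebra_simps)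
      qed
      then show "vec.span {v} \<in> U" using span_in_complex_lines[OF v] by (simp add: U_def)
    qed
    have "v \<noteq> 0 \<and> vec.span {v} \<in> U \<longleftrightarrow> e * norm v < cmod (wedge v u0)" for v
      using U[of v] by (cases "v = 0") (simp_all add: wedge_def)
    then have "{v. v \<noteq> 0 \<and> vec.span {v} \<in> U} = {v. e * norm v < cmod (wedge v u0)}" by simp
    moreover have "open {v. e * norm v < cmod (wedge v u0)}"
      unfolding wedge_def by (intro open_Collect_less continuous_intros)
    ultimately have "openin projective_line U"
      by (auto simp: openin_projective_line U_def)
    then have S: "open {x. F x \<in> U}" using F unfolding continuous_map_def by simp
    have "e * norm w0 < cmod (wedge w0 u0)" using \<open>wedge w0 u0 \<noteq> 0\<close> w0(2) by (simp add: e_def)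
    then have "F x0 \<in> U" using U[OF w0(2)] complex_line_eq_span[OF line w0] by simp
    moreover have "u \<notin> F x" if x: "F x \<in> U" and u: "u \<in> ball u0 e" for x u
    proof
      assume uF: "u \<in> F x"
      obtain w where w: "w \<in> F x" "w \<noteq> 0" using complex_line_nonzero line by blast
      have "u \<in> vec.span {w}" using uF complex_line_eq_span[OF line w] by simp
      then obtain s where "u = s *s w" by (auto simp: vec.span_singleton)
      then have "wedge w u0 = wedge w (u0 - u)" by (simp add: wedge_linear)
      then have "cmod (wedge w u0) \<le> norm w * norm (u0 - u)" using cmod_wedge_le by metis
      also have "\<dots> \<le> norm w * e" using u by (intro mult_left_mono) (auto simp: dist_norm)
      finally show False using x w by (auto simp: U_def mult.commute)
    qed
    ultimately show "\<exists>A B. open A \<and> open B \<and> p \<in> A \<times> B \<and> A \<times> B \<subseteq> - {(x, u). u \<in> F x}"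
      using S e p(1) by (intro exI[of _ "{x. F x \<in> U}"] exI[of _ "ball u0 e"]) auto
  qed
  then show ?thesis by (simp add: closed_def)
qed

lemma compact_positive_lower_bound:
  fixes h :: "'a::topological_space \<Rightarrow> real"
  assumes "compact P" "continuous_on P h" "\<And>p. p \<in> P \<Longrightarrow> 0 < h p"
  shows "\<exists>c>0. \<forall>p\<in>P. c \<le> h p"
proof (cases "P = {}")
  case True
  then show ?thesis using zero_less_one by blast
next
  case False
  then obtain p where "p \<in> P" "\<And>p'. p' \<in> P \<Longrightarrow> h p \<le> h p'"
    using continuous_attains_inf[OF assms(1) _ assms(2)] by blast
  then show ?thesis using assms(3) by blast
qed

lemma continuous_on_matrix_mult:
  fixes P Q :: "'a::topological_space \<Rightarrow> complex^2^2"
  assumes "continuous_on S P" "continuous_on S Q"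
  shows "continuous_on S (\<lambda>x. P x ** Q x)"
  unfolding matrix_matrix_mult_def by (intro continuous_intros assms)

lemma continuous_on_matrix_vector:
  fixes P :: "'a::topological_space \<Rightarrow> complex^2^2"
  assumes "continuous_on S P" "continuous_on S v"
  shows "continuous_on S (\<lambda>x. P x *v v x)"
  unfolding matrix_vector_mult_def by (intro continuous_intros assms)

lemma prod_lessThan_add:
  fixes F :: "nat \<Rightarrow> real"
  shows "(\<Prod>i<k + l. F i) = (\<Prod>i<k. F i) * (\<Prod>i<l. F (k + i))"
  by (induction l) (simp_all add: mult.assoc)

lemma norm_one_in_line:
  assumes "l \<in> complex_lines" shows "\<exists>u\<in>l. norm u = 1"
proof -
  obtain w where w: "w \<in> l" "w \<noteq> 0" using complex_line_nonzero assms by blast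
  have "of_real (1 / norm w) *s w \<in> l"
    using assms w(1) by (simp add: complex_lines_def vec.subspace_scale)
  moreover have "norm (complex_of_real (1 / norm w) *s w) = 1"
    unfolding norm_scalar_vec using w(2) by (simp add: norm_divide)
  ultimately show ?thesis by blast
qed

section \<open>Uniform constants by compactness\<close>

context cmv_energy
begin

lemma cont_A: "continuous_on UNIV A"
proof -
  have c: "continuous_on UNIV (\<lambda>y. alpha (f y))" "continuous_on UNIV (\<lambda>y. alpha (g y))"
    unfolding alpha_def by (intro continuous_intros cont)+
  have e: "continuous_on UNIV (\<lambda>y. A y $ i $ j)" for i j
  proof -
    have "i = 1 \<or> i = 2" "j = 1 \<or> j = 2" using exhaust_2 by auto
    then show ?thesis
      by (elim disjE; simp add: A_entries D_def W_def; intro continuous_intros c)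
  qed
  have "continuous_on UNIV (\<lambda>y. \<chi> i. \<chi> j. A y $ i $ j)"
    by (rule continuous_on_vec_lambda, rule continuous_on_vec_lambda, rule e)
  then show ?thesis by (simp add: vec_lambda_eta)
qed

lemma cont_T: "continuous_on UNIV T"
  unfolding continuous_on_iff using isom by auto

lemma cont_iterate: "continuous_on UNIV (T ^^ n)"
proof (induction n)
  case (Suc n)
  then show ?case using continuous_on_compose[OF Suc, of T] cont_T continuous_on_subset by (auto simp: o_def)
qed (simp add: id_def)

lemma cont_cocycle: "continuous_on UNIV (cocycle T A n)"
proof (induction n)
  case (Suc n)
  have "continuous_on UNIV (\<lambda>x. A ((T ^^ n) x))"
    using continuous_on_compose2[OF cont_A cont_iterate] by blast
  then have "continuous_on UNIV (\<lambda>x. A ((T ^^ n) x) ** cocycle T A n x)"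
    by (rule continuous_on_matrix_mult[OF _ Suc])
  then show ?case by simp
qed simp

lemma cocycle_kernel: "A x *v u = 0 \<Longrightarrow> cocycle T A (Suc n) x *v u = 0"
proof (induction n)
  case (Suc n)
  have "cocycle T A (Suc (Suc n)) x *v u = A ((T ^^ Suc n) x) *v (cocycle T A (Suc n) x *v u)"
    by (simp add: matrix_vector_mul_assoc)
  then show ?case using Suc by simp
qed simp

lemma cocycle_eigen:
  assumes "\<And>y. A y *v e y = s y *s e (T y)"
  shows "cocycle T A n y *v e y = (\<Prod>i<n. s ((T ^^ i) y)) *s e ((T ^^ n) y)"
proof (induction n)
  case (Suc n)
  have "cocycle T A (Suc n) y *v e y = A ((T ^^ n) y) *v (cocycle T A n y *v e y)"
    by (simp add: matrix_vector_mul_assoc)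
  then show ?case by (simp add: Suc vec.scale assms vector_smult_assoc mult.commute)
qed simp

lemma dominated_imp_splitting:
  assumes "dominated_splitting T A"
  shows "\<exists>ep em a b c a0 n. cmv_splitting T f g z ep em a b c a0 n"
proof -
  from assms obtain Ep Em N where cont: "continuous_map euclidean projective_line Ep" "continuous_map euclidean projective_line Em"
    and split: "\<forall>x. Ep x \<inter> Em x = {0} \<and> {u + v |u v. u \<in> Ep x \<and> v \<in> Em x} = UNIV"
    and maps: "\<forall>x. (*v) (A x) ` Ep x \<subseteq> Ep (T x) \<and> (*v) (A x) ` Em x \<subseteq> Em (T x)"
    and N: "N \<ge> 1"
    and dom_all: "\<forall>x. \<forall>u\<in>Ep x. \<forall>v\<in>Em x. norm u = 1 \<longrightarrow> norm v = 1 \<longrightarrow>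
       norm (cocycle T A N x *v u) > norm (cocycle T A N x *v v)"
    unfolding dominated_splitting_def by (elim exE conjE) (rule that; assumption)
  have dom: "norm (cocycle T A N x *v u) > norm (cocycle T A N x *v v)"
    if "u \<in> Ep x" "v \<in> Em x" "norm u = 1" "norm v = 1" for x u v
    by (rule dom_all[rule_format, OF that])
  have inter: "Ep x \<inter> Em x = {0}" for x by (rule conjunct1[OF spec[OF split]])
  have invariant: "(*v) (A x) ` Ep x \<subseteq> Ep (T x)" "(*v) (A x) ` Em x \<subseteq> Em (T x)" for x
    by (rule conjunct1[OF spec[OF maps]], rule conjunct2[OF spec[OF maps]])
  have lines: "Ep x \<in> complex_lines" "Em x \<in> complex_lines" for x
    using cont unfolding continuous_map_def topspace_projective_line by auto
  \<comment> \<open>Pairs of unit vectors, one from each line, over all base points. Closed graphs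
    make this set compact; the constants are taken over all of it, so the later choice of
    \<open>ep\<close> and \<open>em\<close> may be arbitrary.\<close>
  define P where "P = {(x, u, v). u \<in> Ep x \<and> v \<in> Em x \<and> norm u = 1 \<and> norm v = 1}"
  have P: "compact P"
  proof -
    have eq: "P = (UNIV \<times> sphere 0 1 \<times> sphere 0 1) \<inter>
        ((\<lambda>p. (fst p, fst (snd p))) -` {(x, u). u \<in> Ep x} \<inter> (\<lambda>p. (fst p, snd (snd p))) -` {(x, u). u \<in> Em x})"
      by (auto simp: P_def)
    have cl: "closed ((\<lambda>p. (fst p, fst (snd p))) -` {(x, u). u \<in> Ep x} \<inter>
        (\<lambda>p. (fst p, snd (snd p))) -` {(x, u). u \<in> Em x})"
      by (intro closed_Int closed_vimage line_field_closed cont continuous_intros)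
    show ?thesis unfolding eq
      by (rule compact_Int_closed[OF compact_Times[OF compact_space compact_Times[OF compact_sphere compact_sphere]] cl])
  qed
  have contP: "continuous_on P (\<lambda>p. B (fst p) *v fst (snd p))" "continuous_on P (\<lambda>p. B (fst p) *v snd (snd p))"
    if "continuous_on UNIV B" for B :: "'a \<Rightarrow> complex^2^2"
    by (intro continuous_on_matrix_vector continuous_on_compose2[OF that] continuous_intros; simp)+
  have "\<exists>d>0. \<forall>p\<in>P. d \<le> norm (cocycle T A N (fst p) *v fst (snd p)) - norm (cocycle T A N (fst p) *v snd (snd p))"
  proof (rule compact_positive_lower_bound[OF P])
    show "continuous_on P (\<lambda>p. norm (cocycle T A N (fst p) *v fst (snd p)) - norm (cocycle T A N (fst p) *v snd (snd p)))"
      by (intro continuous_intros contP cont_cocycle)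
    show "0 < norm (cocycle T A N (fst p) *v fst (snd p)) - norm (cocycle T A N (fst p) *v snd (snd p))"
      if "p \<in> P" for p using that dom by (cases p) (simp add: P_def)
  qed
  then obtain \<delta> where \<delta>: "\<delta> > 0" "\<And>x u v. (x, u, v) \<in> P \<Longrightarrow> \<delta> \<le> norm (cocycle T A N x *v u) - norm (cocycle T A N x *v v)"
    by (metis fst_conv snd_conv)
  obtain B where B: "B > 0" "\<And>x u v. (x, u, v) \<in> P \<Longrightarrow> norm (cocycle T A N x *v u) \<le> B"
  proof -
    have "bounded ((\<lambda>p. cocycle T A N (fst p) *v fst (snd p)) ` P)"
      by (intro compact_imp_bounded compact_continuous_image contP cont_cocycle P)
    then obtain B where "B > 0" "\<And>p. p \<in> P \<Longrightarrow> norm (cocycle T A N (fst p) *v fst (snd p)) \<le> B"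
      unfolding bounded_pos by blast
    then show ?thesis using that[of B] by force
  qed
  have "\<exists>c>0. \<forall>p\<in>P. c \<le> cmod (wedge (fst (snd p)) (snd (snd p)))"
  proof (rule compact_positive_lower_bound[OF P])
    show "continuous_on P (\<lambda>p. cmod (wedge (fst (snd p)) (snd (snd p))))"
      unfolding wedge_def by (intro continuous_intros)
    fix p assume p: "p \<in> P"
    obtain x u v where xuv: "p = (x, u, v)" by (cases p)
    have uv: "u \<in> Ep x" "v \<in> Em x" "norm u = 1" "norm v = 1" using p by (simp_all add: P_def xuv)
    have "wedge u v \<noteq> 0"
    proof
      assume "wedge u v = 0"
      have u0: "u \<noteq> 0" using uv by auto
      have "v \<in> Ep x"
        using wedge_zero_span[OF \<open>wedge u v = 0\<close> u0] complex_line_eq_span[OF lines(1) uv(1) u0] by simp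
      then have "v \<in> Ep x \<inter> Em x" using uv(2) by simp
      then show False unfolding inter using uv(4) by auto
    qed
    then show "0 < cmod (wedge (fst (snd p)) (snd (snd p)))" by (simp add: xuv)
  qed
  then obtain c where c: "c > 0" "\<And>x u v. (x, u, v) \<in> P \<Longrightarrow> c \<le> cmod (wedge u v)"
    by (metis fst_conv snd_conv)
  \<comment> \<open>Strict domination keeps the cocycle over \<open>N\<close> steps from killing a
    unit vector of \<open>Ep x\<close>, hence also its first factor \<open>A x\<close>.\<close>
  have "\<exists>a0>0. \<forall>p\<in>P. a0 \<le> norm (A (fst p) *v fst (snd p))"
  proof (rule compact_positive_lower_bound[OF P])
    show "continuous_on P (\<lambda>p. norm (A (fst p) *v fst (snd p)))"
      by (intro continuous_intros contP cont_A)
    fix p assume p: "p \<in> P"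
    obtain x u v where xuv: "p = (x, u, v)" by (cases p)
    have "norm (cocycle T A N x *v v) < norm (cocycle T A N x *v u)"
      using dom[of u x v] p by (simp add: P_def xuv)
    then have "cocycle T A N x *v u \<noteq> 0" by force
    moreover obtain m where "N = Suc m" using N by (cases N) auto
    ultimately have "A x *v u \<noteq> 0" using cocycle_kernel[of x u m] by auto
    then show "0 < norm (A (fst p) *v fst (snd p))" by (simp add: xuv)
  qed
  then obtain a0 where a0: "a0 > 0" "\<And>x u v. (x, u, v) \<in> P \<Longrightarrow> a0 \<le> norm (A x *v u)"
    by (metis fst_conv snd_conv)
  have "\<exists>ep. \<forall>x. ep x \<in> Ep x \<and> norm (ep x) = 1" "\<exists>em. \<forall>x. em x \<in> Em x \<and> norm (em x) = 1"
    using norm_one_in_line lines by meson+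
  then obtain ep em where ep: "\<And>x. ep x \<in> Ep x" "\<And>x. norm (ep x) = 1"
    and em: "\<And>x. em x \<in> Em x" "\<And>x. norm (em x) = 1" by blast
  have memP: "(x, ep x, em x) \<in> P" for x using ep em by (simp add: P_def)
  have eig: "\<exists>s. A x *v u = s *s e" if "A x *v u \<in> l" "l \<in> complex_lines" "e \<in> l" "norm e = 1" for x u e l
  proof -
    have "A x *v u \<in> vec.span {e}" using that complex_line_eq_span[OF that(2,3)] by fastforce
    then show ?thesis by (auto simp: vec.span_singleton)
  qed
  have "\<exists>s. A x *v ep x = s *s ep (T x)" "\<exists>s. A x *v em x = s *s em (T x)" for x
    using eig[of x "ep x" "Ep (T x)" "ep (T x)"] eig[of x "em x" "Em (T x)" "em (T x)"]
      invariant[of x] ep em lines by (auto simp: image_subset_iff)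
  then obtain a b where ab: "\<And>x. A x *v ep x = a x *s ep (T x)" "\<And>x. A x *v em x = b x *s em (T x)"
    by metis
  have a_lower: "cmod (a x) \<ge> a0" for x
    using a0(2)[OF memP, of x] by (simp add: ab norm_scalar_vec ep)
  then have a_pos: "cmod (a x) > 0" for x using a0(1) by (meson less_le_trans)
  define \<omega> where "\<omega> x = cmod (wedge (ep x) (em x))" for x
  have \<omega>: "c \<le> \<omega> x" "\<omega> x \<le> 1" for x
    using c(2)[OF memP, of x] cmod_wedge_le[of "ep x" "em x"] by (simp_all add: \<omega>_def ep em)
  then have \<omega>_pos: "\<omega> x > 0" for x using c(1) by (meson less_le_trans)
  define r where "r x = cmod (b x) / cmod (a x)" for x
  define \<kappa> where "\<kappa> x = cmod (tr x) / cmod (a x)" for x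
  \<comment> \<open>The additive gap \<open>\<delta>\<close> becomes a ratio because the larger norm
    is at most \<open>B\<close>; \<open>max 0\<close> makes \<open>q\<close> nonnegative without
    comparing \<open>\<delta>\<close> and \<open>B\<close>.\<close>
  define q where "q = max 0 (1 - \<delta> / B)"
  have q: "0 \<le> q" "q < 1" using \<delta>(1) B(1) by (auto simp: q_def)
  have window_r: "(\<Prod>i<N. r ((T ^^ i) x)) \<le> q" for x
  proof -
    have e: "norm (cocycle T A N x *v ep x) = (\<Prod>i<N. cmod (a ((T ^^ i) x)))"
      "norm (cocycle T A N x *v em x) = (\<Prod>i<N. cmod (b ((T ^^ i) x)))"
      by (simp_all add: cocycle_eigen[OF ab(1)] cocycle_eigen[OF ab(2)] norm_scalar_vec ep em prod_norm)
    have pos: "(\<Prod>i<N. cmod (a ((T ^^ i) x))) > 0" using a_pos by (intro prod_pos) auto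
    have "norm (cocycle T A N x *v em x) \<le> norm (cocycle T A N x *v ep x) - \<delta>"
      using \<delta>(2)[OF memP, of x] by linarith
    also have "\<dots> \<le> norm (cocycle T A N x *v ep x) * (1 - \<delta> / B)"
      using mult_left_mono[OF B(2)[OF memP, of x], of "\<delta> / B"] \<delta>(1) B(1) by (simp add: field_simps)
    also have "\<dots> \<le> norm (cocycle T A N x *v ep x) * q"
      by (intro mult_left_mono) (auto simp: q_def)
    finally have "(\<Prod>i<N. cmod (b ((T ^^ i) x))) / (\<Prod>i<N. cmod (a ((T ^^ i) x))) \<le> q"
      unfolding e using pos by (simp add: field_simps)
    then show ?thesis by (simp add: r_def prod_dividef)
  qed
  have r0: "0 \<le> r x" for x by (simp add: r_def)
  have long_window: "(\<Prod>i<m * N. r ((T ^^ i) x)) \<le> q ^ m" for m x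
  proof (induction m)
    case (Suc m)
    have "(\<Prod>i<Suc m * N. r ((T ^^ i) x)) = (\<Prod>i<m * N. r ((T ^^ i) x)) * (\<Prod>i<N. r ((T ^^ i) ((T ^^ (m * N)) x)))"
      using prod_lessThan_add[of "\<lambda>i. r ((T ^^ i) x)" "m * N" N]
      by (simp add: add.commute funpow_add[symmetric] o_def flip: funpow_add[THEN fun_cong, unfolded o_def])
    also have "\<dots> \<le> q ^ m * q"
      using Suc window_r q(1) r0 by (intro mult_mono prod_nonneg) auto
    finally show ?case by (simp add: mult.commute)
  qed simp
  \<comment> \<open>\<open>wedge_matrix\<close> on the frame \<open>ep x\<close>,
    \<open>em x\<close>, in modulus:
    \<open>|a| * |b| * \<omega> (T x) = |tr|^2 * \<omega> x\<close>. Divide by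
    \<open>|a|^2 * \<omega> x\<close>.\<close>
  have \<kappa>_sq: "(\<kappa> x)\<^sup>2 = r x * (\<omega> (T x) / \<omega> x)" for x
  proof -
    have "a x * b x * wedge (ep (T x)) (em (T x)) = (tr x * cnj (tr x)) * wedge (ep x) (em x)"
      using wedge_matrix[of "A x" "ep x" "em x"] by (simp add: ab wedge_linear det_A ac_simps)
    then have "cmod (a x * b x * wedge (ep (T x)) (em (T x))) = cmod ((tr x * cnj (tr x)) * wedge (ep x) (em x))"
      by simp
    then have *: "cmod (a x) * cmod (b x) * \<omega> (T x) = (cmod (tr x))\<^sup>2 * \<omega> x"
      by (simp add: norm_mult \<omega>_def power2_eq_square)
    have "r x * (\<omega> (T x) / \<omega> x) = (cmod (a x) * cmod (b x) * \<omega> (T x)) / ((cmod (a x))\<^sup>2 * \<omega> x)"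
      using a_pos[of x] \<omega>_pos[of x] by (simp add: r_def power2_eq_square field_simps)
    then show ?thesis unfolding * using \<omega>_pos[of x] by (simp add: \<kappa>_def power_divide)
  qed
  have telescope: "(\<Prod>i<n. (\<kappa> ((T ^^ i) x))\<^sup>2) = (\<Prod>i<n. r ((T ^^ i) x)) * (\<omega> ((T ^^ n) x) / \<omega> x)" for n x
  proof (induction n)
    case (Suc n)
    have "\<omega> ((T ^^ n) x) \<noteq> 0" using \<omega>_pos[of "(T ^^ n) x"] by simp
    then show ?case unfolding prod.lessThan_Suc Suc unfolding \<kappa>_sq by simp
  qed (use \<omega>_pos in \<open>simp add: less_imp_neq[symmetric]\<close>)
  \<comment> \<open>The telescoped quotient of angles is at most \<open>1 / c\<close>, so
    \<open>q ^ m / c < 1/4\<close>, the square of the required window bound.\<close>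
  obtain m where m: "q ^ m < c / 4" using real_arch_pow_inv[of "c / 4" q] q c(1) by auto
  have "(\<Prod>i<m * N. \<kappa> ((T ^^ i) x)) \<le> 1 / 2" for x
  proof -
    have "(\<Prod>i<m * N. \<kappa> ((T ^^ i) x))\<^sup>2 = (\<Prod>i<m * N. r ((T ^^ i) x)) * (\<omega> ((T ^^ (m * N)) x) / \<omega> x)"
      unfolding telescope[symmetric] by (simp add: prod_power_distrib)
    also have "\<dots> \<le> q ^ m * (1 / c)"
      using long_window \<omega> \<omega>_pos c(1) q(1) by (intro mult_mono frac_le) (auto simp: less_imp_le)
    also have "\<dots> \<le> (1 / 2)\<^sup>2" using m c(1) by (simp add: power2_eq_square field_simps)
    finally show ?thesis by (rule power2_le_imp_le) simp
  qed
  then have "cmv_splitting T f g z ep em a b c a0 (m * N)"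
    using ep em ab c(1) \<omega>(1) a0(1) a_lower by unfold_locales (auto simp: \<omega>_def \<kappa>_def)
  then show ?thesis by blast
qed

lemma dominated_not_in_spectrum:
  assumes "dominated_splitting T A" shows "z \<notin> spectrum (E x)"
proof -
  obtain ep em a b c a0 n where "cmv_splitting T f g z ep em a b c a0 n"
    using dominated_imp_splitting[OF assms] by blast
  then interpret cmv_splitting T f g z ep em a b c a0 n .
  obtain K where "K > 0" "\<And>\<psi>. \<psi> \<in> ell2 \<Longrightarrow> ell2_norm \<psi> \<le> K * ell2_norm (\<lambda>n. E x \<psi> n - z * \<psi> n)"
    using bounded_below[of x] by blast
  then have "\<exists>K. inv_bound K (\<lambda>\<psi> n. E x \<psi> n - z * \<psi> n)"
    using isometry_minus_unit_inv_bound[OF lin_E E_isometry E_surj zn] by blast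
  then show ?thesis using not_in_spectrum_E_iff by blast
qed

end

theorem theorem6p1:
  fixes T :: "'a::metric_space \<Rightarrow> 'a"
    and \<mu> :: "'a measure"
    and f g :: "'a \<Rightarrow> complex^2^2"
  assumes "compact (UNIV :: 'a set)"
    and "strictly_ergodic T"
    and "\<forall>x y. dist (T x) (T y) = dist x y"
    and "invariant_prob T \<mu>"
    and "measure_support \<mu> = UNIV"
    and "continuous_on UNIV f" and "\<forall>x. f x \<in> iSU2"
    and "continuous_on UNIV g" and "\<forall>x. g x \<in> iSU2"
    and "(\<integral>\<^sup>+x. neg_ln (cmod (rho (f x))) \<partial>\<mu>) + (\<integral>\<^sup>+x. neg_ln (cmod (rho (g x))) \<partial>\<mu>) < \<infinity>"
  shows "\<forall>x. spectrum (gcmv T f g x) =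
    {z. cmod z = 1 \<and> \<not> dominated_splitting T (\<lambda>y. transfer_f z f y ** transfer_g z g y)}"
proof (intro allI set_eqI)
  fix x z
  have min: "minimal T" and hom: "\<exists>S. homeomorphism UNIV UNIV T S"
    using assms(2) by (auto simp: strictly_ergodic_def)
  then have "bij T" by (metis UNIV_I bij_iff homeomorphism_def)
  then interpret cmv_family T f g
    using assms by unfold_locales auto
  have "z \<notin> spectrum (E x) \<longleftrightarrow> dominated_splitting T (\<lambda>y. transfer_f z f y ** transfer_g z g y)" if z: "cmod z = 1"
  proof -
    interpret cmv_energy T f g z by unfold_locales (rule z)
    have A: "(\<lambda>y. transfer_f z f y ** transfer_g z g y) = A" by (simp add: A_def fun_eq_iff)
    show ?thesis unfolding A
    proof
      assume "z \<notin> spectrum (E x)"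
      then obtain K where "K > 0" "\<And>y. inv_bound K (\<lambda>\<psi> n. E y \<psi> n - z * \<psi> n)"
        using uniform_inv_bound[OF min] by blast
      then interpret cmv_resolvent T f g z K by unfold_locales
      show "dominated_splitting T A" by (rule dominated)
    qed (rule dominated_not_in_spectrum)
  qed
  then show "z \<in> spectrum (gcmv T f g x) \<longleftrightarrow>
      z \<in> {z. cmod z = 1 \<and> \<not> dominated_splitting T (\<lambda>y. transfer_f z f y ** transfer_g z g y)}"
    using spectrum_subset_circle by blast
qed

end
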